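(* Let $X=c_0(\mathbb{R})$ or $X=l^p(\mathbb{R})$ with $1\le p<\infty$, let $0<\alpha\le 1$, let $L:X\to X$ be the weighted shift with weights $(\alpha_n)_{n\ge1}$ and assume that $\sum_{n=1}^\infty (d_n)^{-\alpha}<\infty$. Let $A\in \mathrm{Lip}_b(D_X^\alpha,X)$, and let $\mathcal{L}_A$ be the Ruelle operator of $A$ with respect to the a priori probability $m$. a) If $A\in\mathcal{SV}(X)$, then there exist $\lambda_A>0$ and $\psi_A\in \mathrm{Lip}_b(D_X^\alpha,X)$ with $\inf_{x\in X}\psi_A(x)>0$ such that $\mathcal{L}_A(\psi_A)(x)=\lambda_A\psi_A(x)$ for each $x\in X$. Moreover, $\lambda_A$ is equal to the spectral radius of the action of $\mathcal{L}_A$ on $\mathrm{Lip}_b(D_X^\alpha,X)$, and any positive eigenfunction of $\mathcal{L}_A$ in $\mathrm{Lip}_b(D_X^\alpha,X)$ is colinear to $\psi_A$. b) If $m$ has adapted tails and $\mathcal{L}_A(1)=1$, then there exists a unique $\sigma$-additive Borel probability measure $\mu_A$ on $X$ which is a fixed point of $\mathcal{L}_A^*$. Moreover, $\lim_{n\to\infty}(\mathcal{L}_A^n)^*(\nu)=\mu_A$ in the weak-$*$ topology for any Borel probability measure $\nu$ on $X$. In particular, $\mu_A$ is an $L$-invariant and mixing probability measure (and therefore conservative and ergodic). c) If $A\in\mathcal{SV}(X)$ and $m$ has adapted tails, then there exists a unique fixed point $\mu_A$ of the operator $\mathcal{L}_{\overline A}^*$ (acting on $\sigma$-additive Borel probability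 measures), where $\overline A=A+\log(\psi_A)-\log(\psi_A\circ L)-\log(\lambda_A)$ with $\lambda_A,\psi_A$ as in a). Moreover, $\mu_A$ is an $L$-invariant and mixing $\sigma$-additive probability measure. d) If $A\in\mathcal{SV}(X)$, $m$ has adapted tails, $\mu_A$ is the measure in c) and $\pi_1:X\to\mathbb{R}$ is the projection on the first coordinate, then $\mathrm{supp}(\mu_A)\supset \pi_1^{-1}(\mathrm{supp}(m))$, and hence $\mathrm{supp}(\mu_A)=X$.
   Context: $c_0(\mathbb{R})$ is the space of real sequences $(x_n)_{n\ge1}$ converging to $0$ with the sup norm, and $l^p(\mathbb{R})$ carries the usual $p$-norm; $\|\cdot\|_X$ is the norm of $X$, $D_X(x,y)=\|x-y\|_X$ and $D_X^\alpha(x,y)=\|x-y\|_X^\alpha$. $\mathrm{Lip}_b(D_X^\alpha,X)$ is the set of bounded functions $\varphi:X\to\mathbb{R}$ with $\mathrm{Lip}_{\varphi,D_X^\alpha}:=\sup_{x\ne y}|\varphi(x)-\varphi(y)|/\|x-y\|_X^\alpha<\infty$, with norm $\|\varphi\|_\infty+\mathrm{Lip}_{\varphi,D_X^\alpha}$. $\mathcal{C}(X)$, resp. $\mathcal{C}_b(X)$, is the set of continuous, resp. bounded continuous, functions $X\to\mathbb{R}$. Weighted shift: fix $0<c<c'$ with $c'>1$ and a sequence $(\alpha_n)_{n\ge1}$ with $\alpha_n\in(c,c')$ for all $n$; $L((x_n)_{n\ge1})=(\alpha_nx_{n+1})_{n\ge1}$. Put $\beta_k^n=\alpha_k\cdots\alpha_{k+n-1}$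 and $d_n=\inf_{k\ge1}\beta_k^n$. A priori probability: $m$ is a fixed Borel probability measure on $\mathbb{R}$ whose support is $\mathbb{R}$. Ruelle operator: for a bounded Hölder continuous $A$ and $\varphi\in\mathcal{C}_b(X)$, $$\mathcal{L}_A(\varphi)(x_1,x_2,\dots)=\int_{\mathbb{R}}e^{A(r,x_1/\alpha_1,x_2/\alpha_2,\dots)}\varphi(r,x_1/\alpha_1,x_2/\alpha_2,\dots)\,dm(r).$$ The dual $\mathcal{L}_A^*$ acts on finite Borel measures by $\int\varphi\,d\mathcal{L}_A^*(\mu)=\int\mathcal{L}_A(\varphi)\,d\mu$ for $\varphi\in \mathcal C_b(X)$; if $\mathcal{L}_A(1)=1$ it maps Borel probability measures to Borel probability measures. Summable variation: $\mathcal{SV}(X)$ is the set of $A\in\mathcal{C}(X)$ with $\sum_{n\ge1}V_n(A)<\infty$, where $V_n(A)=\sup\{|A(x)-A(y)|: x,y\in X,\ x_i=y_i,\ 1\le i\le n\}$. Adapted tails: $m$ has adapted tails if for any $\epsilon>0$ there is a sequence of positive numbers $(\kappa_n)_{n\ge1}$ belonging to $X$ such that $\sum_{n=1}^\infty m(\mathbb{R}\setminus[-\beta_1^n\kappa_n,\beta_1^n\kappa_n])<\epsilon$. $\mathrm{supp}(\nu)$ is the set of points all of whose open balls have positive $\nu$-measure. *)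

theory Defs
  imports "HOL-Probability.Probability"
begin

text \<open>
  Sequences indexed by \<open>n \<ge> 1\<close> are encoded as functions on \<^typ>\<open>nat\<close> starting at \<open>0\<close>: the
  coordinate \<open>x\<^sub>n\<close> is \<open>x (n - 1)\<close>, the weight \<open>\<alpha>\<^sub>n\<close> is \<open>a (n - 1)\<close>.  A sequence space is given by
  its carrier \<open>X\<close> and its norm \<open>N\<close>.  Functions on \<open>X\<close> are total functions whose values outside
  \<open>X\<close> are irrelevant.
\<close>

definition c0 :: "(nat \<Rightarrow> real) set" where
  "c0 = {x. x \<longlonglongrightarrow> 0}"

text \<open>The value \<open>0\<close> outside \<open>c0\<close> only serves to make the induced distance nonnegative on all
  arguments, as the locale \<open>Metric_space\<close> demands.\<close>

definition c0_norm :: "(nat \<Rightarrow> real) \<Rightarrow> real" where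
  "c0_norm x = (if x \<in> c0 then SUP n. \<bar>x n\<bar> else 0)"

definition lp :: "real \<Rightarrow> (nat \<Rightarrow> real) set" where
  "lp p = {x. summable (\<lambda>n. \<bar>x n\<bar> powr p)}"

definition lp_norm :: "real \<Rightarrow> (nat \<Rightarrow> real) \<Rightarrow> real" where
  "lp_norm p x = (\<Sum>n. \<bar>x n\<bar> powr p) powr (1 / p)"

definition norm_dist :: "((nat \<Rightarrow> real) \<Rightarrow> real) \<Rightarrow> (nat \<Rightarrow> real) \<Rightarrow> (nat \<Rightarrow> real) \<Rightarrow> real" where
  "norm_dist N x y = N (\<lambda>i. x i - y i)"

definition holder_dist ::
    "((nat \<Rightarrow> real) \<Rightarrow> real) \<Rightarrow> real \<Rightarrow> (nat \<Rightarrow> real) \<Rightarrow> (nat \<Rightarrow> real) \<Rightarrow> real" where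
  "holder_dist N \<alpha> x y = norm_dist N x y powr \<alpha>"

definition norm_topology ::
    "(nat \<Rightarrow> real) set \<Rightarrow> ((nat \<Rightarrow> real) \<Rightarrow> real) \<Rightarrow> (nat \<Rightarrow> real) topology" where
  "norm_topology X N = Metric_space.mtopology X (norm_dist N)"


subsection \<open>Function spaces\<close>

definition lip_quotients ::
    "'a set \<Rightarrow> ('a \<Rightarrow> 'a \<Rightarrow> real) \<Rightarrow> ('a \<Rightarrow> 'b::real_normed_vector) \<Rightarrow> real set" where
  "lip_quotients X D \<phi> = {norm (\<phi> x - \<phi> y) / D x y | x y. x \<in> X \<and> y \<in> X \<and> x \<noteq> y}"

definition lip_b :: "'a set \<Rightarrow> ('a \<Rightarrow> 'a \<Rightarrow> real) \<Rightarrow> ('a \<Rightarrow> 'b::real_normed_vector) set" where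
  "lip_b X D = {\<phi>. bounded (\<phi> ` X) \<and> bdd_above (lip_quotients X D \<phi>)}"

definition lip_norm ::
    "'a set \<Rightarrow> ('a \<Rightarrow> 'a \<Rightarrow> real) \<Rightarrow> ('a \<Rightarrow> 'b::real_normed_vector) \<Rightarrow> real" where
  "lip_norm X D \<phi> = (SUP x\<in>X. norm (\<phi> x)) + Sup (lip_quotients X D \<phi>)"

definition cont_b :: "'a topology \<Rightarrow> ('a \<Rightarrow> real) set" where
  "cont_b T = {\<phi>. continuous_map T euclideanreal \<phi> \<and> bounded (\<phi> ` topspace T)}"

definition variation :: "(nat \<Rightarrow> real) set \<Rightarrow> ((nat \<Rightarrow> real) \<Rightarrow> real) \<Rightarrow> nat \<Rightarrow> ennreal" where
  "variation X A n =
     (SUP (x, y) \<in> {(x, y). x \<in> X \<and> y \<in> X \<and> (\<forall>i<n. x i = y i)}. ennreal \<bar>A x - A y\<bar>)"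

definition summable_variation ::
    "(nat \<Rightarrow> real) set \<Rightarrow> ((nat \<Rightarrow> real) \<Rightarrow> real) \<Rightarrow> ((nat \<Rightarrow> real) \<Rightarrow> real) set" where
  "summable_variation X N =
     {A. continuous_map (norm_topology X N) euclideanreal A \<and>
         (\<Sum>n. variation X A (Suc n)) < \<infinity>}"


subsection \<open>Weighted shift and Ruelle operator\<close>

definition weighted_shift :: "(nat \<Rightarrow> real) \<Rightarrow> (nat \<Rightarrow> real) \<Rightarrow> nat \<Rightarrow> real" where
  "weighted_shift a x = (\<lambda>n. a n * x (Suc n))"

text \<open>\<open>weight_prod a k n\<close> is \<open>\<beta>\<^sub>k\<^sub>+\<^sub>1\<^sup>n\<close>, because weights are counted from \<open>0\<close>.\<close>

definition weight_prod :: "(nat \<Rightarrow> real) \<Rightarrow> nat \<Rightarrow> nat \<Rightarrow> real" where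
  "weight_prod a k n = (\<Prod>i<n. a (k + i))"

definition weight_inf :: "(nat \<Rightarrow> real) \<Rightarrow> nat \<Rightarrow> real" where
  "weight_inf a n = (INF k. weight_prod a k n)"

definition shift_branch :: "(nat \<Rightarrow> real) \<Rightarrow> real \<Rightarrow> (nat \<Rightarrow> real) \<Rightarrow> nat \<Rightarrow> real" where
  "shift_branch a r x = (\<lambda>n. case n of 0 \<Rightarrow> r | Suc k \<Rightarrow> x k / a k)"

text \<open>The values are allowed in any Banach space so that the same operator also acts on
  complex-valued functions.\<close>

definition ruelle ::
    "real measure \<Rightarrow> (nat \<Rightarrow> real) \<Rightarrow> ((nat \<Rightarrow> real) \<Rightarrow> real) \<Rightarrow>
     ((nat \<Rightarrow> real) \<Rightarrow> 'b::{banach, second_countable_topology}) \<Rightarrow> (nat \<Rightarrow> real) \<Rightarrow> 'b" where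
  "ruelle m a A \<phi> x = (\<integral>r. exp (A (shift_branch a r x)) *\<^sub>R \<phi> (shift_branch a r x) \<partial>m)"

definition adapted_tails :: "(nat \<Rightarrow> real) set \<Rightarrow> (nat \<Rightarrow> real) \<Rightarrow> real measure \<Rightarrow> bool" where
  "adapted_tails X a m \<longleftrightarrow>
     (\<forall>\<epsilon>>0. \<exists>\<kappa>\<in>X. (\<forall>n. 0 < \<kappa> n) \<and>
        (\<Sum>n. emeasure m (UNIV - {- (weight_prod a 0 (Suc n) * \<kappa> n)..weight_prod a 0 (Suc n) * \<kappa> n}))
          < ennreal \<epsilon>)"


subsection \<open>Spectral radius on the space of bounded Lipschitz functions\<close>

text \<open>The spectrum of an operator on the real Banach space \<open>lip_b X D\<close> is taken in its
  complexification, the complex-valued \<open>lip_b X D\<close>.  Restriction to \<open>extensional X\<close> identifies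
  functions that agree on \<open>X\<close>.\<close>

definition lip_bC :: "'a set \<Rightarrow> ('a \<Rightarrow> 'a \<Rightarrow> real) \<Rightarrow> ('a \<Rightarrow> complex) set" where
  "lip_bC X D = lip_b X D \<inter> extensional X"

definition shifted_op ::
    "'a set \<Rightarrow> (('a \<Rightarrow> complex) \<Rightarrow> 'a \<Rightarrow> complex) \<Rightarrow> complex \<Rightarrow> ('a \<Rightarrow> complex) \<Rightarrow> 'a \<Rightarrow> complex" where
  "shifted_op X T z \<phi> = (\<lambda>x\<in>X. z * \<phi> x - T \<phi> x)"

definition lip_spectrum ::
    "'a set \<Rightarrow> ('a \<Rightarrow> 'a \<Rightarrow> real) \<Rightarrow> (('a \<Rightarrow> complex) \<Rightarrow> 'a \<Rightarrow> complex) \<Rightarrow> complex set" where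
  "lip_spectrum X D T =
     {z. \<not> (bij_betw (shifted_op X T z) (lip_bC X D) (lip_bC X D) \<and>
            (\<exists>C. \<forall>\<phi>\<in>lip_bC X D. lip_norm X D \<phi> \<le> C * lip_norm X D (shifted_op X T z \<phi>)))}"

definition lip_spectral_radius ::
    "'a set \<Rightarrow> ('a \<Rightarrow> 'a \<Rightarrow> real) \<Rightarrow> (('a \<Rightarrow> complex) \<Rightarrow> 'a \<Rightarrow> complex) \<Rightarrow> ereal" where
  "lip_spectral_radius X D T = (SUP z\<in>lip_spectrum X D T. ereal (cmod z))"

definition positive_eigendata ::
    "(nat \<Rightarrow> real) set \<Rightarrow> ((nat \<Rightarrow> real) \<Rightarrow> real) \<Rightarrow> real \<Rightarrow> real measure \<Rightarrow> (nat \<Rightarrow> real) \<Rightarrow>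
     ((nat \<Rightarrow> real) \<Rightarrow> real) \<Rightarrow> real \<Rightarrow> ((nat \<Rightarrow> real) \<Rightarrow> real) \<Rightarrow> bool" where
  "positive_eigendata X N \<alpha> m a A lam \<psi> \<longleftrightarrow>
     0 < lam \<and> \<psi> \<in> lip_b X (holder_dist N \<alpha>) \<and> 0 < (INF x\<in>X. \<psi> x) \<and>
     (\<forall>x\<in>X. ruelle m a A \<psi> x = lam * \<psi> x)"

definition normalized_potential ::
    "(nat \<Rightarrow> real) \<Rightarrow> ((nat \<Rightarrow> real) \<Rightarrow> real) \<Rightarrow> real \<Rightarrow> ((nat \<Rightarrow> real) \<Rightarrow> real) \<Rightarrow>
     (nat \<Rightarrow> real) \<Rightarrow> real" where
  "normalized_potential a A lam \<psi> x = A x + ln (\<psi> x) - ln (\<psi> (weighted_shift a x)) - ln lam"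


subsection \<open>Borel measures\<close>

definition borel_of :: "'a topology \<Rightarrow> 'a measure" where
  "borel_of T = sigma (topspace T) {U. openin T U}"

definition borel_probs :: "'a topology \<Rightarrow> 'a measure set" where
  "borel_probs T = {\<mu>. prob_space \<mu> \<and> sets \<mu> = sets (borel_of T)}"

definition dual_op ::
    "'a topology \<Rightarrow> (('a \<Rightarrow> real) \<Rightarrow> 'a \<Rightarrow> real) \<Rightarrow> 'a measure \<Rightarrow> 'a measure" where
  "dual_op T S \<mu> =
     (THE \<nu>. finite_measure \<nu> \<and> sets \<nu> = sets (borel_of T) \<and>
             (\<forall>\<phi>\<in>cont_b T. (\<integral>x. \<phi> x \<partial>\<nu>) = (\<integral>x. S \<phi> x \<partial>\<mu>)))"

definition weak_star_lim :: "'a topology \<Rightarrow> (nat \<Rightarrow> 'a measure) \<Rightarrow> 'a measure \<Rightarrow> bool" where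
  "weak_star_lim T \<nu> \<mu> \<longleftrightarrow>
     (\<forall>\<phi>\<in>cont_b T. (\<lambda>n. \<integral>x. \<phi> x \<partial>\<nu> n) \<longlonglongrightarrow> (\<integral>x. \<phi> x \<partial>\<mu>))"

definition measure_support :: "'a set \<Rightarrow> ('a \<Rightarrow> 'a \<Rightarrow> real) \<Rightarrow> 'a measure \<Rightarrow> 'a set" where
  "measure_support X D \<nu> = {x\<in>X. \<forall>e>0. 0 < emeasure \<nu> (Metric_space.mball X D x e)}"


subsection \<open>Ergodic notions\<close>

definition invariant_measure :: "'a measure \<Rightarrow> ('a \<Rightarrow> 'a) \<Rightarrow> bool" where
  "invariant_measure \<mu> f \<longleftrightarrow> f \<in> measurable \<mu> \<mu> \<and> distr \<mu> \<mu> f = \<mu>"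

definition mixing :: "'a measure \<Rightarrow> ('a \<Rightarrow> 'a) \<Rightarrow> bool" where
  "mixing \<mu> f \<longleftrightarrow>
     (\<forall>B\<in>sets \<mu>. \<forall>C\<in>sets \<mu>.
        (\<lambda>n. measure \<mu> (B \<inter> ((f ^^ n) -` C \<inter> space \<mu>))) \<longlonglongrightarrow> measure \<mu> B * measure \<mu> C)"

definition ergodic :: "'a measure \<Rightarrow> ('a \<Rightarrow> 'a) \<Rightarrow> bool" where
  "ergodic \<mu> f \<longleftrightarrow>
     (\<forall>B\<in>sets \<mu>. f -` B \<inter> space \<mu> = B \<longrightarrow> emeasure \<mu> B = 0 \<or> emeasure \<mu> (space \<mu> - B) = 0)"

text \<open>Conservativity: every wandering set is null.\<close>

definition conservative :: "'a measure \<Rightarrow> ('a \<Rightarrow> 'a) \<Rightarrow> bool" where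
  "conservative \<mu> f \<longleftrightarrow>
     (\<forall>B\<in>sets \<mu>. disjoint_family (\<lambda>n. (f ^^ n) -` B \<inter> space \<mu>) \<longrightarrow> emeasure \<mu> B = 0)"

end

theory Submission
  imports Defs "HOL-Complex_Analysis.Great_Picard"
begin

text \<open>
  The \<open>n\<close>-th inverse branches contract distances by \<open>1 / d\<^sub>n\<close>, so summability of \<open>d\<^sub>n\<^sup>-\<^sup>\<alpha>\<close> bounds the
  distortion of \<open>L\<^sup>n\<close> by a multiple of \<open>\<parallel>x - y\<parallel>\<^sup>\<alpha>\<close>, while summable variation bounds it by a
  constant; both follow by induction on \<open>n\<close> for pairs \<open>x, y\<close> whose difference is a fixed shifted vector.
  The eigenfunction is a limit of the normalized series \<open>\<Sum>n. t\<^sup>n L\<^sup>n 1\<close> as \<open>t\<close> increases to the radius of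
  convergence.  It makes \<open>L\<^sup>n 1\<close> comparable to \<open>lam\<^sup>n\<close>, so that the Neumann series of the resolvent
  converges outside the disc of radius \<open>lam\<close>.

  If \<open>L 1 = 1\<close> and the tails are adapted, \<open>L\<^sup>n \<phi>\<close> converges pointwise to a constant for Hoelder \<open>\<phi>\<close>.
  Tightness makes this limit functional continuous in the sense of Daniell, hence an integral with
  respect to a measure, and uniqueness, weak convergence and mixing are read off from the
  convergence of \<open>L\<^sup>n \<phi>\<close>.
\<close>

section \<open>Solid sequence spaces\<close>

text \<open>The obstacle is the lack of compactness: closed balls of c0 and l^p are not compact, so
  neither the Arzela-Ascoli theorem on balls nor Riesz representation applies. What stays compact
  are the boxes \<open>|x i| \<le> \<kappa> i\<close> with \<open>\<kappa>\<close> in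
  \<open>X\<close>, because the tails of \<open>\<kappa>\<close> tend to 0 in norm; adapted tails
  provide such boxes that carry almost all the mass of the iterates.

  For the eigenfunction separability is enough: an equicontinuous family has a pointwise convergent
  subsequence, and the operator, being an integral, respects bounded pointwise limits. The resolvent
  series \<open>\<Psi>\<close> satisfies \<open>t L \<Psi> = \<Psi> - 1\<close>, and the error 1
  disappears after normalisation exactly because the series diverges at its radius of convergence;
  submultiplicativity of the growth of \<open>L^n 1\<close> guarantees that. Summable variation
  makes values of \<open>L^n 1\<close> comparable at any distance, which keeps the infimum of the
  eigenfunction over the unbounded space positive.

  Both distortion bounds rest on the branches being affine with a common linear part, so that the
  chosen symbols cancel from differences.\<close>

abbreviation tail :: "nat \<Rightarrow> (nat \<Rightarrow> real) \<Rightarrow> nat \<Rightarrow> real" where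
  "tail n x \<equiv> (\<lambda>i. if i < n then 0 else x i)"

text \<open>One set of axioms serves c0 and l^p. Solidity, monotonicity in the absolute values of
  the coordinates, allows weights and truncations to be compared with multiples of a single vector.
  \<open>N_tail\<close> is order continuity, which fails for bounded sequences; it is the source of
  separability and of compact boxes. \<open>N_nonneg\<close> and \<open>N_uminus\<close> range over
  all sequences because \<open>Metric_space\<close> demands nonnegativity and symmetry outside the
  carrier too.\<close>

locale seq_space =
  fixes X :: "(nat \<Rightarrow> real) set" and N :: "(nat \<Rightarrow> real) \<Rightarrow> real"
  assumes add_mem: "\<lbrakk>x \<in> X; y \<in> X\<rbrakk> \<Longrightarrow> (\<lambda>i. x i + y i) \<in> X"
    and scale_mem: "x \<in> X \<Longrightarrow> (\<lambda>i. t * x i) \<in> X"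
    and N_nonneg [simp]: "0 \<le> N x"
    and N_uminus: "N (\<lambda>i. - x i) = N x"
    and N_scale: "x \<in> X \<Longrightarrow> N (\<lambda>i. t * x i) = \<bar>t\<bar> * N x"
    and N_triangle: "\<lbrakk>x \<in> X; y \<in> X\<rbrakk> \<Longrightarrow> N (\<lambda>i. x i + y i) \<le> N x + N y"
    and solid_mem: "\<lbrakk>y \<in> X; \<And>i. \<bar>x i\<bar> \<le> \<bar>y i\<bar>\<rbrakk> \<Longrightarrow> x \<in> X"
    and solid_le: "\<lbrakk>y \<in> X; \<And>i. \<bar>x i\<bar> \<le> \<bar>y i\<bar>\<rbrakk> \<Longrightarrow> N x \<le> N y"
    and shift_mem: "x \<in> X \<Longrightarrow> case_nat 0 x \<in> X"
    and unshift_mem: "x \<in> X \<Longrightarrow> (\<lambda>i. x (Suc i)) \<in> X"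
    and N_shift: "x \<in> X \<Longrightarrow> N (case_nat 0 x) = N x"
    and coord_le: "x \<in> X \<Longrightarrow> \<bar>x i\<bar> \<le> N x"
    and single_mem: "(\<lambda>j. if j = i then t else 0) \<in> X"
    and N_single: "N (\<lambda>j. if j = i then t else 0) = \<bar>t\<bar>"
    and l1_mem: "summable (\<lambda>i. \<bar>x i\<bar>) \<Longrightarrow> x \<in> X"
    and N_tail: "x \<in> X \<Longrightarrow> (\<lambda>n. N (tail n x)) \<longlonglongrightarrow> 0"

section \<open>The space c0\<close>

lemma c0_bdd: "x \<in> c0 \<Longrightarrow> bdd_above (range (\<lambda>n. \<bar>x n\<bar>))"
  unfolding c0_def using convergent_imp_bounded[of x 0] by (auto simp: bounded_iff bdd_above_def)

lemma c0_coord_le: "x \<in> c0 \<Longrightarrow> \<bar>x i\<bar> \<le> c0_norm x"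
  unfolding c0_norm_def using c0_bdd by (auto intro: cSUP_upper)

lemma c0_norm_leI: "x \<in> c0 \<Longrightarrow> (\<And>i. \<bar>x i\<bar> \<le> B) \<Longrightarrow> c0_norm x \<le> B"
  unfolding c0_norm_def by (auto intro: cSUP_least)

lemma c0_solid: "\<lbrakk>y \<in> c0; \<And>i. \<bar>x i\<bar> \<le> \<bar>y i\<bar>\<rbrakk> \<Longrightarrow> x \<in> c0"
  unfolding c0_def mem_Collect_eq by (rule Lim_null_comparison[of _ "\<lambda>i. \<bar>y i\<bar>"]) (auto intro: tendsto_rabs_zero)

lemma c0_scale: "x \<in> c0 \<Longrightarrow> (\<lambda>i. t * x i) \<in> c0"
  unfolding c0_def by (auto intro: tendsto_mult_right_zero)

lemma c0_norm_scale_le: "x \<in> c0 \<Longrightarrow> c0_norm (\<lambda>i. t * x i) \<le> \<bar>t\<bar> * c0_norm x"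
  by (intro c0_norm_leI c0_scale) (auto simp: abs_mult intro: mult_left_mono c0_coord_le)

lemma c0_case_nat: "x \<in> c0 \<Longrightarrow> case_nat 0 x \<in> c0"
  unfolding c0_def mem_Collect_eq by (subst filterlim_sequentially_Suc[symmetric]) simp

lemma seq_space_c0: "seq_space c0 c0_norm"
proof
  fix x y :: "nat \<Rightarrow> real" and t :: real and i :: nat
  show "(\<lambda>j. if j = i then t else 0) \<in> c0"
    unfolding c0_def mem_Collect_eq
    by (rule tendsto_eventually, rule eventually_mono[OF eventually_gt_at_top[of i]]) auto
  note single = this
  show "c0_norm (\<lambda>j. if j = i then t else 0) = \<bar>t\<bar>"
    using c0_coord_le[OF single, of i] c0_norm_leI[OF single, of "\<bar>t\<bar>"] by (auto intro: antisym)
  show "0 \<le> c0_norm x"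
    using c0_coord_le[of x 0] by (cases "x \<in> c0") (auto simp: c0_norm_def)
  show "x \<in> c0" if "summable (\<lambda>i. \<bar>x i\<bar>)"
    using tendsto_rabs_zero_cancel[OF summable_LIMSEQ_zero[OF that]] by (simp add: c0_def)
  have "(\<lambda>i. - x i) \<in> c0 \<longleftrightarrow> x \<in> c0"
    unfolding c0_def using tendsto_minus_cancel_left[of x 0] by simp
  then show "c0_norm (\<lambda>i. - x i) = c0_norm x"
    by (simp add: c0_norm_def)
  assume x: "x \<in> c0"
  show "(\<lambda>i. t * x i) \<in> c0" using x by (rule c0_scale)
  show "c0_norm (\<lambda>i. t * x i) = \<bar>t\<bar> * c0_norm x"
  proof (cases "t = 0")
    case True
    then show ?thesis by (auto simp: c0_norm_def c0_def)
  next
    case False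
    have "c0_norm (\<lambda>i. inverse t * (t * x i)) \<le> \<bar>inverse t\<bar> * c0_norm (\<lambda>i. t * x i)"
      by (intro c0_norm_scale_le c0_scale x)
    with False have "\<bar>t\<bar> * c0_norm x \<le> c0_norm (\<lambda>i. t * x i)"
      by (simp add: field_simps)
    with c0_norm_scale_le[OF x, of t] show ?thesis by simp
  qed
  show "\<bar>x i\<bar> \<le> c0_norm x" using x by (rule c0_coord_le)
  show "case_nat 0 x \<in> c0" using x by (rule c0_case_nat)
  show "(\<lambda>i. x (Suc i)) \<in> c0" using x unfolding c0_def mem_Collect_eq by (subst filterlim_sequentially_Suc)
  show "c0_norm (case_nat 0 x) = c0_norm x"
  proof (rule antisym)
    show "c0_norm (case_nat 0 x) \<le> c0_norm x"
      using c0_coord_le[OF x] order_trans[OF abs_ge_zero c0_coord_le[OF x, of 0]]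
      by (intro c0_norm_leI c0_case_nat x) (auto split: nat.split)
    show "c0_norm x \<le> c0_norm (case_nat 0 x)"
    proof (intro c0_norm_leI x)
      fix i show "\<bar>x i\<bar> \<le> c0_norm (case_nat 0 x)"
        using c0_coord_le[OF c0_case_nat[OF x], of "Suc i"] by simp
    qed
  qed
  have tl: "tail n x \<in> c0" for n by (rule c0_solid[OF x]) auto
  show "(\<lambda>n. c0_norm (tail n x)) \<longlonglongrightarrow> 0"
  proof (rule LIMSEQ_I)
    fix r :: real assume r: "0 < r"
    then have "\<forall>\<^sub>F n in sequentially. \<bar>x n\<bar> < r / 2"
      using x tendstoD[of x 0 sequentially "r/2"] by (auto simp: c0_def dist_real_def)
    then obtain n0 where n0: "\<And>n. n \<ge> n0 \<Longrightarrow> \<bar>x n\<bar> < r / 2"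
      by (auto simp: eventually_sequentially)
    have "norm (c0_norm (tail n x) - 0) < r" if "n \<ge> n0" for n
    proof -
      have "c0_norm (tail n x) \<le> r / 2"
        using n0 that r by (intro c0_norm_leI tl) (auto simp: less_imp_le)
      moreover have "0 \<le> c0_norm (tail n x)"
        using c0_coord_le[OF tl[of n], of 0] by linarith
      ultimately show ?thesis using r by simp
    qed
    then show "\<exists>no. \<forall>n\<ge>no. norm (c0_norm (tail n x) - 0) < r" by blast
  qed
  assume y: "y \<in> c0"
  show xy: "(\<lambda>i. x i + y i) \<in> c0" using x y unfolding c0_def by (auto intro: tendsto_add_zero)
  show "c0_norm (\<lambda>i. x i + y i) \<le> c0_norm x + c0_norm y"
    by (intro c0_norm_leI xy order_trans[OF abs_triangle_ineq] add_mono c0_coord_le x y)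
next
  fix x y :: "nat \<Rightarrow> real"
  assume *: "y \<in> c0" "\<And>i. \<bar>x i\<bar> \<le> \<bar>y i\<bar>"
  then show "x \<in> c0" by (rule c0_solid)
  with * show "c0_norm x \<le> c0_norm y" by (meson c0_norm_leI c0_coord_le order_trans)
qed

section \<open>The spaces l^p and Minkowski's inequality\<close>

lemma powr_convex_nonneg:
  fixes s t u p :: real
  assumes "1 \<le> p" "0 \<le> s" "0 \<le> t" "0 \<le> u" "u \<le> 1"
  shows "((1 - u) * s + u * t) powr p \<le> (1 - u) * s powr p + u * t powr p"
proof -
  \<comment> \<open>If \<open>s\<close> or \<open>t\<close> is 0, the claim reduces to
    \<open>v^p \<le> v\<close> on the unit interval.\<close>
  have *: "(v * w) powr p \<le> v * w powr p" if "0 \<le> v" "v \<le> 1" "0 \<le> w" for v w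
  proof -
    have "v powr p \<le> v powr 1" using powr_mono'[of 1 p v] that assms by simp
    then show ?thesis using that by (simp add: powr_mult mult_right_mono)
  qed
  consider "s = 0" | "t = 0" | "0 < s" "0 < t" using assms by linarith
  then show ?thesis
  proof cases
    case 1 then show ?thesis using * [of u t] assms by simp
  next
    case 2 then show ?thesis using * [of "1 - u" s] assms by simp
  next
    case 3
    then show ?thesis using convex_onD[OF powr_convex[OF assms(1)], of u s t] assms by simp
  qed
qed

lemma lp_norm_nonneg: "0 \<le> lp_norm p x"
  by (simp add: lp_norm_def)

lemma lp_norm_le_iff:
  assumes "0 < p" "x \<in> lp p" "0 \<le> B"
  shows "lp_norm p x \<le> B \<longleftrightarrow> (\<Sum>n. \<bar>x n\<bar> powr p) \<le> B powr p"
proof -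
  have 0: "0 \<le> (\<Sum>n. \<bar>x n\<bar> powr p)" using assms by (intro suminf_nonneg) (auto simp: lp_def)
  have "lp_norm p x \<le> B \<longleftrightarrow> (lp_norm p x) powr p \<le> B powr p"
    using assms powr_mono2[of p "lp_norm p x" B] powr_less_mono2[of p B "lp_norm p x"] lp_norm_nonneg[of p x]
    by linarith
  also have "(lp_norm p x) powr p = (\<Sum>n. \<bar>x n\<bar> powr p)"
    using 0 assms by (simp add: lp_norm_def powr_powr)
  finally show ?thesis .
qed

lemma lp_sum_le: "0 < p \<Longrightarrow> x \<in> lp p \<Longrightarrow> 0 < B \<Longrightarrow> lp_norm p x \<le> B \<Longrightarrow> (\<Sum>n. \<bar>x n / B\<bar> powr p) \<le> 1"
  using lp_norm_le_iff[of p x B] suminf_divide[of "\<lambda>n. \<bar>x n\<bar> powr p" "B powr p"]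
  by (auto simp: powr_divide lp_def)

lemma seq_space_lp:
  assumes p: "1 \<le> p"
  shows "seq_space (lp p) (lp_norm p)"
proof
  have p0: "0 < p" using p by simp
  have solid: "x \<in> lp p" if "y \<in> lp p" "\<And>i. \<bar>x i\<bar> \<le> \<bar>y i\<bar>" for x y
    unfolding lp_def mem_Collect_eq
  proof (rule summable_comparison_test'[of "\<lambda>n. \<bar>y n\<bar> powr p" 0])
    show "summable (\<lambda>n. \<bar>y n\<bar> powr p)" using that(1) by (simp add: lp_def)
    fix n show "norm (\<bar>x n\<bar> powr p) \<le> \<bar>y n\<bar> powr p"
      using that(2)[of n] p by (simp add: powr_mono2)
  qed
  show "x \<in> lp p" if "y \<in> lp p" "\<And>i. \<bar>x i\<bar> \<le> \<bar>y i\<bar>" for x y using that by (rule solid)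
  have le: "lp_norm p x \<le> lp_norm p y" if "y \<in> lp p" "\<And>i. \<bar>x i\<bar> \<le> \<bar>y i\<bar>" for x y
  proof -
    have "x \<in> lp p" by (rule solid[OF that(1)]) (rule that(2))
    moreover have "\<bar>x i\<bar> powr p \<le> \<bar>y i\<bar> powr p" for i
      using that(2)[of i] p by (simp add: powr_mono2)
    ultimately have "(\<Sum>n. \<bar>x n\<bar> powr p) \<le> (\<Sum>n. \<bar>y n\<bar> powr p)" "0 \<le> (\<Sum>n. \<bar>x n\<bar> powr p)"
      using that(1) by (auto intro!: suminf_le suminf_nonneg simp: lp_def)
    then show ?thesis using p unfolding lp_norm_def by (intro powr_mono2) auto
  qed
  show "lp_norm p x \<le> lp_norm p y" if "y \<in> lp p" "\<And>i. \<bar>x i\<bar> \<le> \<bar>y i\<bar>" for x y using that by (rule le)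
  fix x y :: "nat \<Rightarrow> real" and t :: real and i :: nat
  have 1: "(\<lambda>j. \<bar>if j = i then t else 0\<bar> powr p) = (\<lambda>j. if j = i then \<bar>t\<bar> powr p else 0)"
    by auto
  show "(\<lambda>j. if j = i then t else 0) \<in> lp p"
    unfolding lp_def mem_Collect_eq 1 by (rule sums_summable[OF sums_single[of i "\<lambda>_. \<bar>t\<bar> powr p"]])
  show "lp_norm p (\<lambda>j. if j = i then t else 0) = \<bar>t\<bar>"
    unfolding lp_norm_def 1 sums_unique[OF sums_single[of i "\<lambda>_. \<bar>t\<bar> powr p"], symmetric]
    using p0 by (simp add: powr_powr)
  show "x \<in> lp p" if sm: "summable (\<lambda>i. \<bar>x i\<bar>)"
    unfolding lp_def mem_Collect_eq
  proof (rule summable_comparison_test_ev[OF _ sm])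
    have "\<forall>\<^sub>F i in sequentially. \<bar>x i\<bar> < 1"
      using order_tendstoD(2)[OF summable_LIMSEQ_zero[OF sm], of 1] by simp
    then show "\<forall>\<^sub>F i in sequentially. norm (\<bar>x i\<bar> powr p) \<le> \<bar>x i\<bar>"
    proof (rule eventually_mono)
      fix i assume "\<bar>x i\<bar> < 1"
      then show "norm (\<bar>x i\<bar> powr p) \<le> \<bar>x i\<bar>" using powr_mono'[of 1 p "\<bar>x i\<bar>"] p by simp
    qed
  qed
  show "0 \<le> lp_norm p x" by (simp add: lp_norm_def)
  show "lp_norm p (\<lambda>i. - x i) = lp_norm p x" by (simp add: lp_norm_def)
  assume x: "x \<in> lp p"
  then have sx: "summable (\<lambda>i. \<bar>x i\<bar> powr p)" by (simp add: lp_def)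
  show "(\<lambda>i. t * x i) \<in> lp p" using sx by (simp add: lp_def abs_mult powr_mult summable_mult)
  show "lp_norm p (\<lambda>i. t * x i) = \<bar>t\<bar> * lp_norm p x"
    using sx p0 by (simp add: lp_norm_def abs_mult powr_mult suminf_mult powr_powr suminf_nonneg)
  show "\<bar>x i\<bar> \<le> lp_norm p x"
  proof -
    have "\<bar>x i\<bar> powr p \<le> (\<Sum>n. \<bar>x n\<bar> powr p)"
      using sum_le_suminf[OF sx, of "{i}"] by simp
    then have "(\<bar>x i\<bar> powr p) powr (1/p) \<le> lp_norm p x"
      unfolding lp_norm_def using p0 by (intro powr_mono2) auto
    then show ?thesis using p0 by (simp add: powr_powr)
  qed
  have s1: "(\<lambda>n. \<bar>case_nat 0 x n\<bar> powr p) sums (\<Sum>n. \<bar>x n\<bar> powr p)"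
    using sums_Suc[of "\<lambda>n. \<bar>case_nat 0 x n\<bar> powr p" "\<Sum>n. \<bar>x n\<bar> powr p"] summable_sums[OF sx] by simp
  show "case_nat 0 x \<in> lp p" using sums_summable[OF s1] by (simp add: lp_def)
  show "(\<lambda>i. x (Suc i)) \<in> lp p" using sx summable_Suc_iff[of "\<lambda>i. \<bar>x i\<bar> powr p"] by (simp add: lp_def)
  show "lp_norm p (case_nat 0 x) = lp_norm p x" using sums_unique[OF s1] by (simp add: lp_norm_def)
  show "(\<lambda>n. lp_norm p (tail n x)) \<longlonglongrightarrow> 0"
  proof -
    have e: "(\<Sum>i. \<bar>tail n x i\<bar> powr p) = (\<Sum>i. \<bar>x (i + n)\<bar> powr p)" for n
    proof -
      have "(\<lambda>i. \<bar>tail n x (i + n)\<bar> powr p) sums (\<Sum>i. \<bar>x (i + n)\<bar> powr p)"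
        using summable_sums[OF summable_ignore_initial_segment[OF sx, of n]] by simp
      then have "(\<lambda>i. \<bar>tail n x i\<bar> powr p) sums ((\<Sum>i. \<bar>x (i + n)\<bar> powr p) + (\<Sum>i<n. \<bar>tail n x i\<bar> powr p))"
        by (subst (asm) sums_iff_shift)
      then show ?thesis using sums_unique by fastforce
    qed
    have "(\<lambda>n. (\<Sum>i. \<bar>x (i + n)\<bar> powr p)) \<longlonglongrightarrow> 0"
      by (rule suminf_exist_split2[OF sx])
    then have "(\<lambda>n. (\<Sum>i. \<bar>x (i + n)\<bar> powr p) powr (1/p)) \<longlonglongrightarrow> 0 powr (1/p)"
      using p0 by (intro tendsto_powr') (auto intro!: always_eventually suminf_nonneg summable_ignore_initial_segment[OF sx])
    then show ?thesis using p0 by (simp add: lp_norm_def e)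
  qed
  assume y: "y \<in> lp p"
  then have sy: "summable (\<lambda>i. \<bar>y i\<bar> powr p)" by (simp add: lp_def)
  \<comment> \<open>Minkowski's inequality as convexity of the unit ball:
    \<open>(x + y) / (a + b)\<close> is the mean of \<open>x / a\<close> and \<open>y / b\<close>
    with the weights \<open>a / (a + b)\<close> and \<open>b / (a + b)\<close>.\<close>
  have conv: "\<bar>(x i + y i) / (a + b)\<bar> powr p \<le> a / (a + b) * \<bar>x i / a\<bar> powr p + b / (a + b) * \<bar>y i / b\<bar> powr p"
    if "0 < a" "0 < b" for a b i
  proof -
    let ?u = "b / (a + b)"
    have u: "1 - ?u = a / (a + b)" using that by (simp add: field_simps)
    have "\<bar>(x i + y i) / (a + b)\<bar> \<le> \<bar>x i / (a + b)\<bar> + \<bar>y i / (a + b)\<bar>"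
      by (metis add_divide_distrib abs_triangle_ineq)
    also have "\<dots> = (1 - ?u) * \<bar>x i / a\<bar> + ?u * \<bar>y i / b\<bar>"
      unfolding u using that by (simp add: abs_mult)
    finally have "\<bar>(x i + y i) / (a + b)\<bar> powr p \<le> ((1 - ?u) * \<bar>x i / a\<bar> + ?u * \<bar>y i / b\<bar>) powr p"
      using p0 by (intro powr_mono2) auto
    also have "\<dots> \<le> (1 - ?u) * \<bar>x i / a\<bar> powr p + ?u * \<bar>y i / b\<bar> powr p"
      using that p by (intro powr_convex_nonneg) auto
    finally show ?thesis by (simp add: u)
  qed
  have sd: "summable (\<lambda>i. \<bar>x i / a\<bar> powr p)" "summable (\<lambda>i. \<bar>y i / a\<bar> powr p)" for a
    using summable_divide[OF sx, of "\<bar>a\<bar> powr p"] summable_divide[OF sy, of "\<bar>a\<bar> powr p"] by (simp_all add: powr_divide)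
  have sc: "summable (\<lambda>i. a / (a + b) * \<bar>x i / a\<bar> powr p + b / (a + b) * \<bar>y i / b\<bar> powr p)" for a b
    by (intro summable_add summable_mult sd)
  have xy': "(\<lambda>i. (x i + y i) / (a + b)) \<in> lp p" if "0 < a" "0 < b" for a b
    unfolding lp_def mem_Collect_eq
    by (rule summable_comparison_test'[OF sc[of a b], of 0]) (use conv[OF that] in auto)
  have eq: "\<bar>x i + y i\<bar> powr p = 2 powr p * \<bar>(x i + y i) / (1 + 1)\<bar> powr p" for i
    by (simp flip: powr_mult add: abs_mult)
  show xy: "(\<lambda>i. x i + y i) \<in> lp p"
    using xy'[of 1 1] unfolding lp_def mem_Collect_eq by (subst eq) (intro summable_mult, simp)
  show "lp_norm p (\<lambda>i. x i + y i) \<le> lp_norm p x + lp_norm p y"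
  proof (rule field_le_epsilon)
    fix e :: real assume e: "0 < e"
    \<comment> \<open>The summand \<open>e / 2\<close> keeps \<open>a\<close> and \<open>b\<close>
      positive when a norm vanishes.\<close>
    define a where "a = lp_norm p x + e / 2"
    define b where "b = lp_norm p y + e / 2"
    have ab: "0 < a" "0 < b" using e by (auto simp: a_def b_def lp_norm_def add_nonneg_pos)
    have "(\<Sum>i. \<bar>(x i + y i) / (a + b)\<bar> powr p) \<le> (\<Sum>i. a / (a + b) * \<bar>x i / a\<bar> powr p + b / (a + b) * \<bar>y i / b\<bar> powr p)"
      using xy'[OF ab] by (intro suminf_le conv ab sc) (simp add: lp_def)
    also have "\<dots> = a / (a + b) * (\<Sum>i. \<bar>x i / a\<bar> powr p) + b / (a + b) * (\<Sum>i. \<bar>y i / b\<bar> powr p)"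
      unfolding suminf_mult[OF sd(1), symmetric] suminf_mult[OF sd(2), symmetric]
      by (intro suminf_add[symmetric] summable_mult sd)
    also have "\<dots> \<le> a / (a + b) * 1 + b / (a + b) * 1"
      using ab e by (intro add_mono mult_left_mono lp_sum_le x y p0) (auto simp: a_def b_def)
    also have "\<dots> = 1" using ab by (simp flip: add_divide_distrib)
    finally have 1: "(\<Sum>i. \<bar>(x i + y i) / (a + b)\<bar> powr p) \<le> 1" .
    have "(\<Sum>i. \<bar>x i + y i\<bar> powr p) = (\<Sum>i. (a + b) powr p * \<bar>(x i + y i) / (a + b)\<bar> powr p)"
      using ab by (intro suminf_cong) (auto simp flip: powr_mult simp: abs_mult)
    also have "\<dots> = (a + b) powr p * (\<Sum>i. \<bar>(x i + y i) / (a + b)\<bar> powr p)"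
      using xy'[OF ab] by (intro suminf_mult) (simp add: lp_def)
    also have "\<dots> \<le> (a + b) powr p"
      using mult_left_mono[OF 1, of "(a+b) powr p"] by simp
    finally have "lp_norm p (\<lambda>i. x i + y i) \<le> a + b"
      using xy ab p0 by (subst lp_norm_le_iff) auto
    then show "lp_norm p (\<lambda>i. x i + y i) \<le> lp_norm p x + lp_norm p y + e"
      by (simp add: a_def b_def)
  qed
qed

section \<open>Metric, topology and Borel sets of a solid space\<close>

context seq_space
begin

lemma diff_mem: "\<lbrakk>x \<in> X; y \<in> X\<rbrakk> \<Longrightarrow> (\<lambda>i. x i - y i) \<in> X"
  using add_mem[of x "\<lambda>i. -1 * y i"] scale_mem[of y "-1"] by simp

lemma zero_mem [simp]: "(\<lambda>_. 0) \<in> X"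
  using single_mem[of 0 0] by simp

lemma N_zero [simp]: "N (\<lambda>_. 0) = 0"
  using N_single[of 0 0] by simp

lemma N_eq_0: "x \<in> X \<Longrightarrow> N x = 0 \<longleftrightarrow> x = (\<lambda>_. 0)"
  using coord_le[of x] by (auto intro!: ext)

lemma N_diff_commute: "N (\<lambda>i. x i - y i) = N (\<lambda>i. y i - x i)"
  using N_uminus[of "\<lambda>i. x i - y i"] by simp

lemma N_diff_triangle:
  "\<lbrakk>x \<in> X; y \<in> X; z \<in> X\<rbrakk> \<Longrightarrow> N (\<lambda>i. x i - z i) \<le> N (\<lambda>i. x i - y i) + N (\<lambda>i. y i - z i)"
  using N_triangle[of "\<lambda>i. x i - y i" "\<lambda>i. y i - z i"] diff_mem by simp

lemma N_diff_le: "\<lbrakk>x \<in> X; y \<in> X\<rbrakk> \<Longrightarrow> N (\<lambda>i. x i - y i) \<le> N x + N y"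
  using N_diff_triangle[of x "\<lambda>_. 0" y] N_uminus[of y] by simp

lemma N_reverse_triangle: "\<lbrakk>x \<in> X; y \<in> X\<rbrakk> \<Longrightarrow> \<bar>N x - N y\<bar> \<le> N (\<lambda>i. x i - y i)"
  using N_diff_triangle[of x y "\<lambda>_. 0"] N_diff_triangle[of y x "\<lambda>_. 0"] N_diff_commute[of x y] by simp

lemma tail_mem: "x \<in> X \<Longrightarrow> tail n x \<in> X"
  by (rule solid_mem[of x]) auto

lemma finite_support_mem: "(\<And>i. n \<le> i \<Longrightarrow> x i = 0) \<Longrightarrow> x \<in> X"
proof (induction n arbitrary: x)
  case 0
  then have "x = (\<lambda>_. 0)" by auto
  then show ?case by simp
next
  case (Suc n)
  have "(\<lambda>i. if i = n then 0 else x i) \<in> X" using Suc.prems by (intro Suc.IH) (simp add: le_Suc_eq not_less_eq_eq)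
  from add_mem[OF this single_mem[of n "x n"]] show ?case
    by (rule back_subst[where P="\<lambda>x. x \<in> X"]) auto
qed

text \<open>Norm estimates thereby reduce to finitely many coordinates and a tail that
  \<open>N_tail\<close> makes small.\<close>

lemma N_le_sum_tail: "x \<in> X \<Longrightarrow> N x \<le> (\<Sum>i<n. \<bar>x i\<bar>) + N (tail n x)"
proof (induction n)
  case (Suc n)
  have "tail n x = (\<lambda>i. (if i = n then x n else 0) + tail (Suc n) x i)" by (auto simp: fun_eq_iff dest: less_antisym)
  then have "N (tail n x) \<le> N (\<lambda>i. if i = n then x n else 0) + N (tail (Suc n) x)"
    using N_triangle[OF single_mem[of n "x n"] tail_mem[OF Suc.prems, of "Suc n"]] by simp
  then show ?case using Suc N_single[of n "x n"] by simp
qed simp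

sublocale met: Metric_space X "norm_dist N"
proof
  fix x y show "0 \<le> norm_dist N x y" by (simp add: norm_dist_def)
  show "norm_dist N x y = norm_dist N y x" unfolding norm_dist_def by (rule N_diff_commute)
next
  fix x y assume "x \<in> X" "y \<in> X"
  then show "(norm_dist N x y = 0) = (x = y)"
    unfolding norm_dist_def using N_eq_0[OF diff_mem] by (auto simp: fun_eq_iff)
next
  fix x y z assume "x \<in> X" "y \<in> X" "z \<in> X"
  then show "norm_dist N x z \<le> norm_dist N x y + norm_dist N y z"
    unfolding norm_dist_def by (rule N_diff_triangle)
qed

abbreviation "T \<equiv> norm_topology X N"

abbreviation "\<B> \<equiv> borel_of T"

lemma topspace_T [simp]: "topspace T = X"
  by (simp add: norm_topology_def)

lemma openin_T:
  "openin T U \<longleftrightarrow> U \<subseteq> X \<and> (\<forall>x\<in>U. \<exists>r>0. \<forall>y\<in>X. N (\<lambda>i. x i - y i) < r \<longrightarrow> y \<in> U)"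
proof -
  have "met.mball x r \<subseteq> U \<longleftrightarrow> (\<forall>y\<in>X. N (\<lambda>i. x i - y i) < r \<longrightarrow> y \<in> U)" if "U \<subseteq> X" "x \<in> U" for x r
    unfolding subset_iff met.in_mball norm_dist_def using that by blast
  then show ?thesis
    unfolding norm_topology_def met.openin_mtopology by (meson subsetD)
qed

lemma continuous_map_T:
  "continuous_map T euclideanreal f \<longleftrightarrow>
     (\<forall>x\<in>X. \<forall>e>0. \<exists>d>0. \<forall>y\<in>X. N (\<lambda>i. x i - y i) < d \<longrightarrow> \<bar>f x - f y\<bar> < e)"
  (is "?L \<longleftrightarrow> ?R")
proof
  assume L: ?L
  show ?R
  proof (intro ballI allI impI)
    fix x and e :: real assume x: "x \<in> X" and e: "0 < e"
    have "openin T {y \<in> topspace T. f y \<in> ball (f x) e}"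
      using L by (rule openin_continuous_map_preimage) simp
    with x e show "\<exists>d>0. \<forall>y\<in>X. N (\<lambda>i. x i - y i) < d \<longrightarrow> \<bar>f x - f y\<bar> < e"
      unfolding openin_T by (auto simp: dist_real_def)
  qed
next
  assume R: ?R
  show ?L unfolding continuous_map_def
  proof (intro conjI allI impI)
    fix U :: "real set" assume "openin euclidean U"
    then have U: "open U" by simp
    show "openin T {x \<in> topspace T. f x \<in> U}" unfolding openin_T
    proof (intro conjI ballI)
      fix x assume x: "x \<in> {x \<in> topspace T. f x \<in> U}"
      then obtain e where e: "0 < e" "ball (f x) e \<subseteq> U" using U open_contains_ball by blast
      from x have "x \<in> X" by simp
      with R e(1) obtain d where "d > 0" "\<forall>y\<in>X. N (\<lambda>i. x i - y i) < d \<longrightarrow> \<bar>f x - f y\<bar> < e" by metis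
      with e show "\<exists>r>0. \<forall>y\<in>X. N (\<lambda>i. x i - y i) < r \<longrightarrow> y \<in> {x \<in> topspace T. f x \<in> U}"
        by (intro exI[of _ d]) (auto simp: subset_iff dist_real_def)
    qed auto
  qed auto
qed

lemma space_borel [simp]: "space \<B> = X"
  by (simp add: borel_of_def space_measure_of_conv)

lemma sets_borel: "sets \<B> = sigma_sets X {U. openin T U}"
  unfolding borel_of_def using openin_subset[of T] by (subst sets_measure_of) auto

lemma openin_sets: "openin T U \<Longrightarrow> U \<in> sets \<B>"
  by (simp add: sets_borel sigma_sets.Basic)

lemma continuous_measurable: "continuous_map T euclideanreal f \<Longrightarrow> f \<in> borel_measurable \<B>"
proof (rule borel_measurableI)
  fix S :: "real set" assume f: "continuous_map T euclideanreal f" and S: "open S"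
  have "openin T {x \<in> topspace T. f x \<in> S}"
    using f S by (intro openin_continuous_map_preimage) auto
  moreover have "f -` S \<inter> space \<B> = {x \<in> topspace T. f x \<in> S}" by auto
  ultimately show "f -` S \<inter> space \<B> \<in> sets \<B>" by (simp add: openin_sets)
qed

lemma lipschitz_continuous_map:
  assumes "\<And>x y. \<lbrakk>x \<in> X; y \<in> X\<rbrakk> \<Longrightarrow> \<bar>f x - f y\<bar> \<le> C * N (\<lambda>i. x i - y i) powr s" "0 < s"
  shows "continuous_map T euclideanreal f"
  unfolding continuous_map_T
proof (intro ballI allI impI)
  fix x and e :: real assume x: "x \<in> X" and e: "0 < e"
  define d where "d = (e / (\<bar>C\<bar> + 1)) powr (1 / s)"
  have "\<bar>f x - f y\<bar> < e" if "y \<in> X" "N (\<lambda>i. x i - y i) < d" for y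
  proof -
    have "\<bar>f x - f y\<bar> \<le> (\<bar>C\<bar> + 1) * N (\<lambda>i. x i - y i) powr s"
      using assms(1)[OF x that(1)] by (rule order_trans) (intro mult_right_mono, auto)
    also have "\<dots> < (\<bar>C\<bar> + 1) * d powr s"
      using that assms(2) by (intro mult_strict_left_mono powr_less_mono2) auto
    also have "\<dots> = e" using assms(2) e by (simp add: d_def powr_powr)
    finally show ?thesis .
  qed
  moreover have "0 < d" using e by (simp add: d_def)
  ultimately show "\<exists>d>0. \<forall>y\<in>X. N (\<lambda>i. x i - y i) < d \<longrightarrow> \<bar>f x - f y\<bar> < e" by blast
qed

lemma coord_measurable [measurable]: "(\<lambda>x. x i) \<in> borel_measurable \<B>"
  by (intro continuous_measurable lipschitz_continuous_map[of _ 1 1]) (auto simp: coord_le[OF diff_mem])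

text \<open>On finitely many coordinates \<open>N\<close> is dominated by a sum of absolute values,
  hence continuous in the product topology. Measurability of norms thus follows from measurability
  of coordinates alone.\<close>

lemma N_trunc_measurable:
  assumes "\<And>i. (\<lambda>s. g s i) \<in> borel_measurable S"
  shows "(\<lambda>s. N (\<lambda>i. if i < n then g s i else 0)) \<in> borel_measurable S"
proof -
  have g: "g \<in> S \<rightarrow>\<^sub>M borel" using assms by (rule measurable_coordinatewise_then_product)
  have "continuous_on UNIV (\<lambda>y::nat \<Rightarrow> real. N (\<lambda>i. if i < n then y i else 0))"
  proof (intro continuous_at_imp_continuous_on ballI)
    fix y :: "nat \<Rightarrow> real"
    have bnd: "\<bar>N (\<lambda>i. if i < n then z i else 0) - N (\<lambda>i. if i < n then y i else 0)\<bar> \<le> (\<Sum>i<n. \<bar>z i - y i\<bar>)" for z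
    proof -
      have m: "(\<lambda>i. if i < n then w i else 0) \<in> X" for w by (rule finite_support_mem[of n]) auto
      let ?d = "\<lambda>i. (if i < n then z i else 0) - (if i < n then y i else 0)"
      have "\<bar>N (\<lambda>i. if i < n then z i else 0) - N (\<lambda>i. if i < n then y i else 0)\<bar> \<le> N ?d"
        by (intro N_reverse_triangle m)
      also have "\<dots> \<le> (\<Sum>i<n. \<bar>?d i\<bar>) + N (tail n ?d)" by (intro N_le_sum_tail diff_mem m)
      also have "tail n ?d = (\<lambda>_. 0)" by (auto simp: fun_eq_iff)
      finally show ?thesis by simp
    qed
    have "((\<lambda>z. \<Sum>i<n. \<bar>z i - y i\<bar>) \<longlongrightarrow> (\<Sum>i<n. \<bar>y i - y i\<bar>)) (at y)"
      by (intro tendsto_intros) (metis continuous_on_product_coordinates continuous_on_eq_continuous_at open_UNIV UNIV_I isCont_def)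
    then have "((\<lambda>z. \<Sum>i<n. \<bar>z i - y i\<bar>) \<longlongrightarrow> 0) (at y)" by simp
    then have "((\<lambda>z. N (\<lambda>i. if i < n then z i else 0) - N (\<lambda>i. if i < n then y i else 0)) \<longlongrightarrow> 0) (at y)"
      by (rule Lim_null_comparison[rotated]) (use bnd in simp)
    then have "((\<lambda>z. N (\<lambda>i. if i < n then z i else 0)) \<longlongrightarrow> N (\<lambda>i. if i < n then y i else 0)) (at y)"
      by (rule LIM_zero_cancel)
    then show "isCont (\<lambda>y::nat \<Rightarrow> real. N (\<lambda>i. if i < n then y i else 0)) y" by (simp add: isCont_def)
  qed
  then have "(\<lambda>y::nat \<Rightarrow> real. N (\<lambda>i. if i < n then y i else 0)) \<in> borel_measurable borel"
    by (rule borel_measurable_continuous_onI)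
  from measurable_compose[OF g this] show ?thesis .
qed

lemma N_measurable:
  assumes "\<And>i. (\<lambda>s. g s i) \<in> borel_measurable S" "\<And>s. s \<in> space S \<Longrightarrow> g s \<in> X"
  shows "(\<lambda>s. N (g s)) \<in> borel_measurable S"
proof (rule borel_measurable_LIMSEQ_real[OF _ N_trunc_measurable])
  fix s assume "s \<in> space S"
  then have s: "g s \<in> X" by (rule assms)
  let ?h = "\<lambda>n i. if i < n then g s i else 0"
  have "\<bar>N (?h n) - N (g s)\<bar> \<le> N (tail n (g s))" for n
  proof -
    have m: "?h n \<in> X" by (rule finite_support_mem[of n]) auto
    have "\<bar>N (g s) - N (?h n)\<bar> \<le> N (\<lambda>i. g s i - ?h n i)" by (intro N_reverse_triangle s m)
    also have "(\<lambda>i. g s i - ?h n i) = tail n (g s)" by (auto simp: fun_eq_iff)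
    finally show ?thesis by linarith
  qed
  then show "(\<lambda>n. N (?h n)) \<longlonglongrightarrow> N (g s)"
    by (intro LIM_zero_cancel[OF Lim_null_comparison[OF _ N_tail[OF s]]] always_eventually) auto
qed (rule assms)

lemma N_measurable' [measurable]: "N \<in> borel_measurable \<B>"
  using N_measurable[of "\<lambda>x. x" \<B>] by simp

definition rat_seqs :: "(nat \<Rightarrow> real) set" where
  "rat_seqs = range (\<lambda>(l::rat list) i. if i < length l then of_rat (l ! i) else 0)"

lemma countable_rat_seqs: "countable rat_seqs"
  unfolding rat_seqs_def by simp

lemma rat_seqs_subset: "rat_seqs \<subseteq> X"
proof
  fix q assume "q \<in> rat_seqs"
  then obtain l :: "rat list" where q: "q = (\<lambda>i. if i < length l then of_rat (l ! i) else 0)"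
    by (auto simp: rat_seqs_def)
  show "q \<in> X" unfolding q by (rule finite_support_mem[of "length l"]) simp
qed

lemma rat_seqs_dense:
  assumes x: "x \<in> X" and e: "0 < e"
  shows "\<exists>q\<in>rat_seqs. N (\<lambda>i. x i - q i) < e"
proof -
  obtain n where n: "N (tail n x) < e / 2"
    using order_tendstoD(2)[OF N_tail[OF x], of "e / 2"] e by (auto simp: eventually_sequentially)
  have "\<exists>r. \<bar>x i - of_rat r\<bar> < e / (2 * (real n + 1))" for i
  proof -
    have "0 < e / (2 * (real n + 1))" using e by simp
    then have "x i - e / (2 * (real n + 1)) < x i + e / (2 * (real n + 1))" by linarith
    then obtain r where "x i - e / (2 * (real n + 1)) < of_rat r" "of_rat r < x i + e / (2 * (real n + 1))"
      using of_rat_dense by blast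
    then show ?thesis by (intro exI[of _ r]) (simp add: abs_less_iff)
  qed
  then obtain r where r: "\<And>i. \<bar>x i - of_rat (r i)\<bar> < e / (2 * (real n + 1))" by metis
  define q :: "nat \<Rightarrow> real" where "q = (\<lambda>i. if i < n then of_rat (r i) else 0)"
  have q: "q \<in> rat_seqs" unfolding rat_seqs_def q_def
    by (rule range_eqI[of _ _ "map r [0..<n]"]) auto
  have "N (\<lambda>i. x i - q i) \<le> (\<Sum>i<n. \<bar>x i - q i\<bar>) + N (tail n (\<lambda>i. x i - q i))"
    using q rat_seqs_subset by (intro N_le_sum_tail diff_mem x) auto
  also have "tail n (\<lambda>i. x i - q i) = tail n x" by (auto simp: q_def fun_eq_iff)
  also have "(\<Sum>i<n. \<bar>x i - q i\<bar>) \<le> (\<Sum>i<n. e / (2 * (real n + 1)))"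
    using r by (intro sum_mono) (simp add: q_def less_imp_le)
  also have "\<dots> \<le> e / 2" using e by (simp add: field_simps)
  finally show ?thesis using q n by (intro bexI[of _ q]) auto
qed

text \<open>The space is separable, so its Borel sets are generated by the coordinates.\<close>

lemma measurable_into_borel:
  assumes g: "\<And>i. (\<lambda>s. g s i) \<in> borel_measurable S" and gX: "\<And>s. s \<in> space S \<Longrightarrow> g s \<in> X"
  shows "g \<in> S \<rightarrow>\<^sub>M \<B>"
  unfolding borel_of_def
proof (rule measurable_measure_of)
  show "g \<in> space S \<rightarrow> topspace T" using gX by auto
  fix U assume "U \<in> {U. openin T U}"
  then have U: "openin T U" by simp
  \<comment> \<open>Rational centres with radii whose balls lie in \<open>U\<close>: there are
    countably many such pairs, and their balls cover \<open>U\<close>.\<close>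
  define I where "I = {(q, k::nat). q \<in> rat_seqs \<and> (\<forall>y\<in>X. N (\<lambda>i. y i - q i) < 1 / real (Suc k) \<longrightarrow> y \<in> U)}"
  have "I \<subseteq> rat_seqs \<times> UNIV" by (auto simp: I_def)
  then have cI: "countable I" by (rule countable_subset) (simp add: countable_rat_seqs)
  have cover: "\<exists>p\<in>I. N (\<lambda>i. y i - fst p i) < 1 / real (Suc (snd p))" if y: "y \<in> U" for y
  proof -
    have yX: "y \<in> X" using U y by (auto simp: openin_T)
    obtain r where r: "r > 0" "\<And>z. z \<in> X \<Longrightarrow> N (\<lambda>i. y i - z i) < r \<Longrightarrow> z \<in> U"
      using U y unfolding openin_T by blast
    obtain k :: nat where k: "1 / real (Suc k) < r / 2"
      using nat_approx_posE[of "r/2"] r(1) by auto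
    obtain q where q: "q \<in> rat_seqs" "N (\<lambda>i. y i - q i) < 1 / real (Suc k)"
      using rat_seqs_dense[OF yX, of "1 / real (Suc k)"] by force
    have "z \<in> U" if z: "z \<in> X" "N (\<lambda>i. z i - q i) < 1 / real (Suc k)" for z
    proof (rule r(2)[OF z(1)])
      show "N (\<lambda>i. y i - z i) < r"
        using N_diff_triangle[OF yX subsetD[OF rat_seqs_subset q(1)] z(1)] q(2) z(2) k N_diff_commute[of z q]
        by linarith
    qed
    with q show ?thesis by (intro bexI[of _ "(q, k)"]) (auto simp: I_def)
  qed
  have "g -` U \<inter> space S = (\<Union>p\<in>I. {s \<in> space S. N (\<lambda>i. g s i - fst p i) < 1 / real (Suc (snd p))})"
  proof (intro set_eqI iffI)
    fix s assume "s \<in> g -` U \<inter> space S"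
    then show "s \<in> (\<Union>p\<in>I. {s \<in> space S. N (\<lambda>i. g s i - fst p i) < 1 / real (Suc (snd p))})"
      using cover[of "g s"] by auto
  next
    fix s assume "s \<in> (\<Union>p\<in>I. {s \<in> space S. N (\<lambda>i. g s i - fst p i) < 1 / real (Suc (snd p))})"
    then obtain p where "p \<in> I" "s \<in> space S" "N (\<lambda>i. g s i - fst p i) < 1 / real (Suc (snd p))" by blast
    then show "s \<in> g -` U \<inter> space S" using gX by (auto simp: I_def split_beta)
  qed
  also have "\<dots> \<in> sets S"
  proof (rule sets.countable_UN''[OF cI])
    fix p assume p: "p \<in> I"
    have "(\<lambda>s. N (\<lambda>i. g s i - fst p i)) \<in> borel_measurable S"
      using p rat_seqs_subset by (intro N_measurable diff_mem gX borel_measurable_diff g) (auto simp: I_def)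
    then show "{s \<in> space S. N (\<lambda>i. g s i - fst p i) < 1 / real (Suc (snd p))} \<in> sets S"
      by (rule borel_measurable_less) simp
  qed
  finally show "g -` U \<inter> space S \<in> sets S" .
qed (use openin_subset[of T] in auto)

text \<open>Dominated convergence in \<open>X\<close>: the head converges coordinate by coordinate,
  and the tail of the difference is dominated by \<open>2 * tail n \<kappa>\<close> for all
  \<open>j\<close> at once.\<close>

lemma dominated_norm_convergence:
  assumes k: "\<kappa> \<in> X" and x: "\<And>j i. \<bar>x j i\<bar> \<le> \<kappa> i" and lim: "\<And>i. (\<lambda>j. x j i) \<longlonglongrightarrow> y i"
  shows "y \<in> X" "(\<lambda>j. N (\<lambda>i. x j i - y i)) \<longlonglongrightarrow> 0"
proof -
  have k0: "0 \<le> \<kappa> i" for i using x[of 0 i] by linarith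
  have yk: "\<bar>y i\<bar> \<le> \<kappa> i" for i
    by (rule LIMSEQ_le_const2[OF tendsto_rabs[OF lim]]) (use x in auto)
  show y: "y \<in> X" using yk k0 by (intro solid_mem[OF k]) auto
  have xX: "x j \<in> X" for j using x k0 by (intro solid_mem[OF k]) auto
  show "(\<lambda>j. N (\<lambda>i. x j i - y i)) \<longlonglongrightarrow> 0"
  proof (rule LIMSEQ_I)
    fix e :: real assume e: "0 < e"
    obtain n where n: "2 * N (tail n \<kappa>) < e / 2"
      using order_tendstoD(2)[OF tendsto_mult_right_zero[OF N_tail[OF k], of 2], of "e / 2"] e
      by (auto simp: eventually_sequentially)
    have "(\<lambda>j. \<Sum>i<n. \<bar>x j i - y i\<bar>) \<longlonglongrightarrow> (\<Sum>i<n. \<bar>y i - y i\<bar>)"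
      by (intro tendsto_intros lim)
    then have "\<forall>\<^sub>F j in sequentially. (\<Sum>i<n. \<bar>x j i - y i\<bar>) < e / 2"
      using e by (intro order_tendstoD(2)) auto
    then obtain j0 where j0: "\<And>j. j \<ge> j0 \<Longrightarrow> (\<Sum>i<n. \<bar>x j i - y i\<bar>) < e / 2"
      by (auto simp: eventually_sequentially)
    have "N (\<lambda>i. x j i - y i) < e" if "j \<ge> j0" for j
    proof -
      have "N (\<lambda>i. x j i - y i) \<le> (\<Sum>i<n. \<bar>x j i - y i\<bar>) + N (tail n (\<lambda>i. x j i - y i))"
        by (intro N_le_sum_tail diff_mem xX y)
      also have "N (tail n (\<lambda>i. x j i - y i)) \<le> N (\<lambda>i. 2 * tail n \<kappa> i)"
      proof (rule solid_le[OF scale_mem[OF tail_mem[OF k]]])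
        fix i show "\<bar>tail n (\<lambda>i. x j i - y i) i\<bar> \<le> \<bar>2 * tail n \<kappa> i\<bar>"
          using x[of j i] yk[of i] k0[of i] by auto
      qed
      also have "N (\<lambda>i. 2 * tail n \<kappa> i) = 2 * N (tail n \<kappa>)" using N_scale[OF tail_mem[OF k], of 2] by simp
      finally show ?thesis using j0[OF that] n by linarith
    qed
    then show "\<exists>no. \<forall>j\<ge>no. norm (N (\<lambda>i. x j i - y i) - 0) < e" by auto
  qed
qed

text \<open>A diagonal subsequence converges in every coordinate, and domination by
  \<open>\<kappa>\<close> turns this into norm convergence. This is the compactness on which all
  later accumulation arguments rely.\<close>

lemma box_subsequence:
  assumes k: "\<kappa> \<in> X" and x: "\<And>j i. \<bar>x j i\<bar> \<le> \<kappa> i"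
  obtains r y where "strict_mono (r :: nat \<Rightarrow> nat)" "y \<in> X" "\<And>i. \<bar>y i\<bar> \<le> \<kappa> i" "(\<lambda>j. N (\<lambda>i. x (r j) i - y i)) \<longlonglongrightarrow> 0"
proof -
  have "norm (x j i) \<le> N \<kappa>" for j i using x[of j i] coord_le[OF k, of i] by (simp add: abs_le_iff)
  then obtain r where r: "strict_mono (r :: nat \<Rightarrow> nat)" "\<And>i. i \<in> UNIV \<Longrightarrow> \<exists>l. (\<lambda>j. x (r j) i) \<longlonglongrightarrow> l"
    by (rule function_convergent_subsequence[of UNIV x "N \<kappa>", OF countableI_type]) blast
  from r(2) obtain y where y: "\<And>i. (\<lambda>j. x (r j) i) \<longlonglongrightarrow> y i" by (metis UNIV_I)
  have "\<bar>y i\<bar> \<le> \<kappa> i" for i by (rule LIMSEQ_le_const2[OF tendsto_rabs[OF y]]) (use x in auto)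
  with r(1) show ?thesis using dominated_norm_convergence[of \<kappa> "\<lambda>j. x (r j)" y, OF k x y] that by blast
qed

end

section \<open>Hoelder functions and the weighted shift\<close>

locale holder_space = seq_space +
  fixes \<alpha> :: real
  assumes \<alpha>_pos: "0 < \<alpha>" and \<alpha>_le_1: "\<alpha> \<le> 1"
begin

abbreviation "D x y \<equiv> N (\<lambda>i. x i - y i) powr \<alpha>"

abbreviation Lip :: "((nat \<Rightarrow> real) \<Rightarrow> 'b::real_normed_vector) set" where
  "Lip \<equiv> lip_b X (holder_dist N \<alpha>)"

abbreviation Lip_norm :: "((nat \<Rightarrow> real) \<Rightarrow> 'b::real_normed_vector) \<Rightarrow> real" where
  "Lip_norm \<equiv> lip_norm X (holder_dist N \<alpha>)"

lemma D_commute: "D x y = D y x"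
  by (subst N_diff_commute) simp

lemma D_pos: "\<lbrakk>x \<in> X; y \<in> X; x \<noteq> y\<rbrakk> \<Longrightarrow> 0 < D x y"
  using N_eq_0[OF diff_mem, of x y] by (auto simp: fun_eq_iff order_less_le)

lemma D_self [simp]: "D x x = 0"
  by simp

lemma D_triangle: "\<lbrakk>x \<in> X; y \<in> X; z \<in> X\<rbrakk> \<Longrightarrow> D x z \<le> D x y + D y z"
proof -
  assume x: "x \<in> X" "y \<in> X" "z \<in> X"
  \<comment> \<open>The power is subadditive since \<open>w \<le> w powr \<alpha>\<close> on the
    unit interval, applied to the fractions \<open>u / (u + v)\<close> and
    \<open>v / (u + v)\<close>.\<close>
  have sub: "(u + v) powr \<alpha> \<le> u powr \<alpha> + v powr \<alpha>" if "0 \<le> u" "0 \<le> v" for u v :: real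
  proof (cases "u + v = 0")
    case False
    with that have uv: "0 < u + v" by simp
    have *: "w / (u + v) \<le> (w / (u + v)) powr \<alpha>" if "0 \<le> w" "w \<le> u + v" for w
      using powr_mono'[of \<alpha> 1 "w / (u + v)"] \<alpha>_le_1 that uv by (cases "w = 0") simp_all
    have "1 = u / (u + v) + v / (u + v)" using uv by (simp flip: add_divide_distrib)
    also have "\<dots> \<le> (u / (u + v)) powr \<alpha> + (v / (u + v)) powr \<alpha>"
      using that by (intro add_mono *) auto
    also have "\<dots> = (u powr \<alpha> + v powr \<alpha>) / (u + v) powr \<alpha>"
      using that by (simp add: powr_divide add_divide_distrib)
    finally show ?thesis using uv by (simp add: le_divide_eq)
  qed (use that in simp)
  have "D x z \<le> (N (\<lambda>i. x i - y i) + N (\<lambda>i. y i - z i)) powr \<alpha>"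
    using \<alpha>_pos by (intro powr_mono2 N_diff_triangle x) auto
  also have "\<dots> \<le> D x y + D y z" by (intro sub) auto
  finally show ?thesis .
qed

lemma LipI:
  assumes "\<And>x. x \<in> X \<Longrightarrow> norm (\<phi> x) \<le> B"
    and "\<And>x y. \<lbrakk>x \<in> X; y \<in> X\<rbrakk> \<Longrightarrow> norm (\<phi> x - \<phi> y) \<le> C * D x y"
  shows "\<phi> \<in> Lip"
  unfolding lip_b_def
proof (intro CollectI conjI)
  show "bounded (\<phi> ` X)" using assms(1) by (auto simp: bounded_iff)
  show "bdd_above (lip_quotients X (holder_dist N \<alpha>) \<phi>)"
    unfolding bdd_above_def
    by (rule exI[of _ C]) (use assms(2) D_pos in \<open>auto simp: lip_quotients_def holder_dist_def norm_dist_def divide_le_eq\<close>)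
qed

lemma Lip_quotients_nonempty: "lip_quotients X (holder_dist N \<alpha>) \<phi> \<noteq> {}"
proof -
  have "(\<lambda>j. if j = 0 then 1 else 0::real) \<noteq> (\<lambda>_. 0)" by (auto simp: fun_eq_iff)
  with single_mem[of 0 1] zero_mem show ?thesis unfolding lip_quotients_def by blast
qed

lemma Lip_norm_bounds:
  assumes "\<phi> \<in> Lip"
  shows "x \<in> X \<Longrightarrow> norm (\<phi> x) \<le> Lip_norm \<phi>"
    and "\<lbrakk>x \<in> X; y \<in> X\<rbrakk> \<Longrightarrow> norm (\<phi> x - \<phi> y) \<le> Lip_norm \<phi> * D x y"
    and "0 \<le> Lip_norm \<phi>"
proof -
  have b: "bdd_above ((\<lambda>x. norm (\<phi> x)) ` X)"
    using assms by (auto simp: lip_b_def bounded_iff bdd_above_def)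
  have q: "bdd_above (lip_quotients X (holder_dist N \<alpha>) \<phi>)" using assms by (simp add: lip_b_def)
  have "0 \<le> r" if "r \<in> lip_quotients X (holder_dist N \<alpha>) \<phi>" for r
    using that by (auto simp: lip_quotients_def holder_dist_def)
  with Lip_quotients_nonempty[of \<phi>] obtain r where "r \<in> lip_quotients X (holder_dist N \<alpha>) \<phi>" "0 \<le> r" by blast
  with q have s0: "0 \<le> Sup (lip_quotients X (holder_dist N \<alpha>) \<phi>)" by (meson cSup_upper order_trans)
  have n: "norm (\<phi> x) \<le> (SUP x\<in>X. norm (\<phi> x))" if "x \<in> X" for x using b that by (rule cSUP_upper2) simp
  then have n0: "0 \<le> (SUP x\<in>X. norm (\<phi> x))" using zero_mem norm_ge_zero order_trans by blast
  show "x \<in> X \<Longrightarrow> norm (\<phi> x) \<le> Lip_norm \<phi>" using n[of x] s0 by (simp add: lip_norm_def)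
  show "0 \<le> Lip_norm \<phi>" using n0 s0 by (simp add: lip_norm_def)
  assume xy: "x \<in> X" "y \<in> X"
  show "norm (\<phi> x - \<phi> y) \<le> Lip_norm \<phi> * D x y"
  proof (cases "x = y")
    case False
    have "norm (\<phi> x - \<phi> y) / D x y \<le> Sup (lip_quotients X (holder_dist N \<alpha>) \<phi>)"
      using xy False by (intro cSup_upper q) (auto simp: lip_quotients_def holder_dist_def norm_dist_def)
    also have "\<dots> \<le> Lip_norm \<phi>" using n0 by (simp add: lip_norm_def)
    finally show ?thesis using D_pos[OF xy False] by (simp add: divide_le_eq)
  qed simp
qed

lemma Lip_norm_le:
  assumes "\<And>x. x \<in> X \<Longrightarrow> norm (\<phi> x) \<le> B"
    and "\<And>x y. \<lbrakk>x \<in> X; y \<in> X\<rbrakk> \<Longrightarrow> norm (\<phi> x - \<phi> y) \<le> C * D x y"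
  shows "Lip_norm \<phi> \<le> B + C"
  unfolding lip_norm_def
proof (rule add_mono)
  have "X \<noteq> {}" using zero_mem by blast
  then show "(SUP x\<in>X. norm (\<phi> x)) \<le> B" using assms(1) by (intro cSUP_least) auto
  show "Sup (lip_quotients X (holder_dist N \<alpha>) \<phi>) \<le> C"
    using Lip_quotients_nonempty
    by (rule cSup_least) (use assms(2) D_pos in \<open>auto simp: lip_quotients_def holder_dist_def norm_dist_def divide_le_eq\<close>)
qed

lemma Lip_continuous: "f \<in> Lip \<Longrightarrow> continuous_map T euclideanreal f"
  using Lip_norm_bounds(2)[of f] \<alpha>_pos by (intro lipschitz_continuous_map[of f "Lip_norm f" \<alpha>]) auto

lemma Lip_seq_continuous:
  assumes f: "f \<in> Lip" and x: "\<And>j. x j \<in> X" "y \<in> X" and lim: "(\<lambda>j. N (\<lambda>i. x j i - y i)) \<longlonglongrightarrow> 0"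
  shows "(\<lambda>j. f (x j) :: real) \<longlonglongrightarrow> f y"
proof -
  have "(\<lambda>j. Lip_norm f * D (x j) y) \<longlonglongrightarrow> Lip_norm f * 0 powr \<alpha>"
    using \<alpha>_pos by (intro tendsto_mult_left tendsto_powr' lim tendsto_const) auto
  then have "(\<lambda>j. Lip_norm f * D (x j) y) \<longlonglongrightarrow> 0" by simp
  then have "(\<lambda>j. f (x j) - f y) \<longlonglongrightarrow> 0"
    by (rule Lim_null_comparison[rotated]) (use Lip_norm_bounds(2)[OF f x] in auto)
  then show ?thesis by (rule LIM_zero_cancel)
qed

text \<open>The operator preserves bounded Borel functions by measurability of parameter integrals
  alone, and unlike \<open>Lip\<close> this class contains the indicators that express
  tightness.\<close>

definition bm :: "((nat \<Rightarrow> real) \<Rightarrow> real) set" where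
  "bm = {\<phi>. \<phi> \<in> borel_measurable \<B> \<and> bounded (\<phi> ` X)}"

lemma bmI: "\<lbrakk>\<phi> \<in> borel_measurable \<B>; \<And>x. x \<in> X \<Longrightarrow> \<bar>\<phi> x\<bar> \<le> B\<rbrakk> \<Longrightarrow> \<phi> \<in> bm"
  by (auto simp: bm_def bounded_iff)

lemma bm_measurable [measurable_dest]: "\<phi> \<in> bm \<Longrightarrow> \<phi> \<in> borel_measurable \<B>"
  by (simp add: bm_def)

lemma bmE:
  assumes "\<phi> \<in> bm"
  obtains B where "0 \<le> B" "\<And>x. x \<in> X \<Longrightarrow> \<bar>\<phi> x\<bar> \<le> B"
proof -
  from assms obtain B where B: "\<And>x. x \<in> X \<Longrightarrow> \<bar>\<phi> x\<bar> \<le> B" by (auto simp: bm_def bounded_iff)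
  from B[OF zero_mem] have "0 \<le> B" by linarith
  with B that show ?thesis by blast
qed

lemma Lip_bm: "f \<in> Lip \<Longrightarrow> f \<in> bm"
  using continuous_measurable[OF Lip_continuous] by (simp add: bm_def lip_b_def)

lemma cont_b_bm: "f \<in> cont_b T \<Longrightarrow> f \<in> bm"
  using continuous_measurable by (simp add: bm_def cont_b_def)

lemma Lip_cont_b: "f \<in> Lip \<Longrightarrow> f \<in> cont_b T"
  using Lip_continuous by (simp add: cont_b_def lip_b_def)

lemma bm_const [simp, intro]: "(\<lambda>_. t) \<in> bm"
  by (rule bmI[of _ "\<bar>t\<bar>"]) auto

lemma bm_add [intro]: assumes "\<phi> \<in> bm" "\<psi> \<in> bm" shows "(\<lambda>x. \<phi> x + \<psi> x) \<in> bm"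
proof -
  from assms obtain B C where "\<And>x. x \<in> X \<Longrightarrow> \<bar>\<phi> x\<bar> \<le> B" "\<And>x. x \<in> X \<Longrightarrow> \<bar>\<psi> x\<bar> \<le> C" by (metis bmE)
  then show ?thesis using assms by (intro bmI[of _ "B + C"]) (auto simp: bm_def intro: order_trans[OF abs_triangle_ineq] add_mono)
qed

lemma bm_mult [intro]: assumes "\<phi> \<in> bm" "\<psi> \<in> bm" shows "(\<lambda>x. \<phi> x * \<psi> x) \<in> bm"
proof -
  from assms obtain B C where "0 \<le> B" "\<And>x. x \<in> X \<Longrightarrow> \<bar>\<phi> x\<bar> \<le> B" "\<And>x. x \<in> X \<Longrightarrow> \<bar>\<psi> x\<bar> \<le> C" by (metis bmE)
  then show ?thesis using assms by (intro bmI[of _ "B * C"]) (auto simp: bm_def abs_mult intro: mult_mono)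
qed

lemma bm_diff [intro]: assumes "\<phi> \<in> bm" "\<psi> \<in> bm" shows "(\<lambda>x. \<phi> x - \<psi> x) \<in> bm"
  using bm_add[OF assms(1) bm_mult[OF bm_const[of "-1"] assms(2)]] by simp

lemma bm_max [intro]: assumes "\<phi> \<in> bm" "\<psi> \<in> bm" shows "(\<lambda>x. max (\<phi> x) (\<psi> x)) \<in> bm"
proof -
  from assms obtain B C where "\<And>x. x \<in> X \<Longrightarrow> \<bar>\<phi> x\<bar> \<le> B" "\<And>x. x \<in> X \<Longrightarrow> \<bar>\<psi> x\<bar> \<le> C" by (metis bmE)
  then show ?thesis using assms by (intro bmI[of _ "max B C"]) (fastforce simp: bm_def max_def)+
qed

lemma bm_indicator [intro]: "S \<in> sets \<B> \<Longrightarrow> indicator S \<in> bm"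
  by (rule bmI[of _ 1]) (auto simp: indicator_def)

end

locale weighted_space = holder_space +
  fixes c c' :: real and a :: "nat \<Rightarrow> real"
  assumes c_pos: "0 < c" and a_bounds: "\<And>n. c < a n" "\<And>n. a n < c'"
    and summable_inf: "summable (\<lambda>n. weight_inf a (Suc n) powr (- \<alpha>))"
begin

abbreviation "br \<equiv> shift_branch a"

abbreviation "sh \<equiv> weighted_shift a"

lemma a_pos: "0 < a n"
  using a_bounds(1)[of n] c_pos by linarith

lemma br_0 [simp]: "br r x 0 = r" and br_Suc [simp]: "br r x (Suc k) = x k / a k"
  by (simp_all add: shift_branch_def)

lemma sh_br [simp]: "sh (br r x) = x"
  using a_pos by (auto simp: weighted_shift_def fun_eq_iff less_imp_neq[THEN not_sym])

lemma div_mem: "x \<in> X \<Longrightarrow> (\<lambda>k. x k / a k) \<in> X"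
proof (rule solid_mem[OF scale_mem])
  fix i
  have "\<bar>x i\<bar> / a i \<le> \<bar>x i\<bar> / c" using a_bounds(1)[of i] c_pos by (intro divide_left_mono) auto
  then show "\<bar>x i / a i\<bar> \<le> \<bar>1 / c * x i\<bar>" using a_pos[of i] c_pos by (simp add: abs_mult)
qed

lemma br_mem: assumes x: "x \<in> X" shows "br r x \<in> X"
proof -
  have "(\<lambda>i. (if i = 0 then r else 0) + case_nat 0 (\<lambda>k. x k / a k) i) \<in> X"
    by (intro add_mem single_mem shift_mem div_mem x)
  also have "(\<lambda>i. (if i = 0 then r else 0) + case_nat 0 (\<lambda>k. x k / a k) i) = br r x"
    by (auto simp: fun_eq_iff shift_branch_def split: nat.split)
  finally show ?thesis .
qed

lemma left_shift: assumes x: "x \<in> X" shows "(\<lambda>i. x (Suc i)) \<in> X" and "N (\<lambda>i. x (Suc i)) \<le> N x"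
proof -
  show 1: "(\<lambda>i. x (Suc i)) \<in> X" using x by (rule unshift_mem)
  have "N (\<lambda>i. x (Suc i)) = N (case_nat 0 (\<lambda>i. x (Suc i)))" using N_shift[OF 1] by simp
  also have "\<dots> \<le> N x" using x by (rule solid_le) (auto split: nat.split)
  finally show "N (\<lambda>i. x (Suc i)) \<le> N x" .
qed

lemma sh_mem: assumes x: "x \<in> X" shows "sh x \<in> X"
proof (rule solid_mem[OF scale_mem[OF left_shift(1)[OF x]]])
  fix i
  have "a i * \<bar>x (Suc i)\<bar> \<le> c' * \<bar>x (Suc i)\<bar>" using a_bounds(2)[of i] by (intro mult_right_mono) auto
  then show "\<bar>sh x i\<bar> \<le> \<bar>c' * x (Suc i)\<bar>"
    using a_pos[of i] a_bounds(2)[of i] by (simp add: weighted_shift_def abs_mult)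
qed

lemma N_sh: assumes x: "x \<in> X" shows "N (sh x) \<le> c' * N x"
proof -
  have c': "0 < c'" using a_pos[of 0] a_bounds(2)[of 0] by linarith
  have "N (sh x) \<le> N (\<lambda>i. c' * x (Suc i))"
  proof (rule solid_le[OF scale_mem[OF left_shift(1)[OF x]]])
    fix i
    have "a i * \<bar>x (Suc i)\<bar> \<le> c' * \<bar>x (Suc i)\<bar>" using a_bounds(2)[of i] by (intro mult_right_mono) auto
    then show "\<bar>sh x i\<bar> \<le> \<bar>c' * x (Suc i)\<bar>"
      using a_pos[of i] c' by (simp add: weighted_shift_def abs_mult)
  qed
  also have "\<dots> = c' * N (\<lambda>i. x (Suc i))" using N_scale[OF left_shift(1)[OF x], of c'] c' by simp
  also have "\<dots> \<le> c' * N x" using c' left_shift(2)[OF x] by simp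
  finally show ?thesis .
qed

lemma shn_mem: "x \<in> X \<Longrightarrow> (sh ^^ n) x \<in> X"
  by (induction n) (auto intro: sh_mem)

text \<open>The branches are affine with the common linear part \<open>br 0\<close>, so the symbol
  \<open>r\<close> disappears from differences. Iterated, the points reached from \<open>x\<close>
  and \<open>y\<close> along equal symbols differ by \<open>B n (x - y)\<close>, whatever the
  symbols.\<close>

lemma br_diff: "(\<lambda>i. br r x i - br r y i) = br 0 (\<lambda>i. x i - y i)"
  by (auto simp: fun_eq_iff shift_branch_def diff_divide_distrib split: nat.split)

section \<open>Weight products and contraction of the inverse branches\<close>

lemma weight_prod_pos: "0 < weight_prod a k n"
  unfolding weight_prod_def using a_pos by (intro prod_pos) auto

lemma weight_prod_Suc: "weight_prod a k (Suc n) = weight_prod a k n * a (k + n)"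
  by (simp add: weight_prod_def)

lemma weight_inf_le: "weight_inf a n \<le> weight_prod a k n"
  unfolding weight_inf_def
  by (rule cINF_lower) (auto intro!: bdd_belowI2[of _ 0] less_imp_le[OF weight_prod_pos])

lemma weight_inf_pos: "0 < weight_inf a n"
proof -
  have "c ^ n \<le> weight_prod a k n" for k
    unfolding weight_prod_def using prod_mono[of "{..<n}" "\<lambda>_. c" "\<lambda>i. a (k + i)"] a_bounds(1) c_pos
    by (auto intro: less_imp_le)
  then have "c ^ n \<le> weight_inf a n" unfolding weight_inf_def by (intro cINF_greatest) auto
  with c_pos show ?thesis by (meson less_le_trans zero_less_power)
qed

abbreviation "B n \<equiv> (br 0 ^^ n)"

lemma B_mem: "z \<in> X \<Longrightarrow> B n z \<in> X"
  by (induction n) (auto intro: br_mem)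

lemma B_coord: "B n z i = (if i < n then 0 else z (i - n) / weight_prod a (i - n) n)"
proof (induction n arbitrary: i)
  case (Suc n)
  show ?case
  proof (cases i)
    case (Suc k)
    show ?thesis
      unfolding Suc funpow.simps o_apply br_Suc Suc.IH by (simp add: weight_prod_Suc)
  qed simp
qed (simp add: weight_prod_def)

text \<open>Up to weights \<open>B n\<close> is the \<open>n\<close>-fold right shift, which
  preserves norms by \<open>N_shift\<close>; every weight product that occurs is at least
  \<open>weight_inf a n\<close>, and solidity transfers the bound to the norm.\<close>

lemma N_B: assumes z: "z \<in> X" shows "N (B n z) \<le> N z / weight_inf a n"
proof -
  have sh: "(case_nat 0 ^^ n) y i = (if i < n then 0 else y (i - n))" for y :: "nat \<Rightarrow> real" and i
  proof (induction n arbitrary: i)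
    case (Suc n) then show ?case by (cases i) auto
  qed simp
  have m: "(case_nat 0 ^^ n) y \<in> X" "N ((case_nat 0 ^^ n) y) = N y" if "y \<in> X" for y
    using that by (induction n) (auto simp: shift_mem N_shift)
  let ?y = "(case_nat 0 ^^ n) (\<lambda>i. 1 / weight_inf a n * z i)"
  have "N (B n z) \<le> N ?y"
  proof (rule solid_le[OF m(1)[OF scale_mem[OF z]]])
    fix i
    have "\<bar>z j\<bar> / weight_prod a j n \<le> \<bar>z j\<bar> / weight_inf a n" for j
      using weight_inf_pos weight_inf_le by (intro divide_left_mono mult_pos_pos weight_prod_pos) auto
    then show "\<bar>B n z i\<bar> \<le> \<bar>?y i\<bar>"
      using weight_inf_pos[of n] weight_prod_pos[of _ n] by (simp add: B_coord sh abs_mult less_imp_le abs_of_pos)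
  qed
  also have "N ?y = N z / weight_inf a n"
    unfolding m(2)[OF scale_mem[OF z]] N_scale[OF z] using weight_inf_pos[of n] by simp
  finally show ?thesis .
qed

text \<open>The factor by which \<open>n\<close> inverse branches contract the Hoelder distance
  \<open>D\<close>; the assumption on the weights is summability from index 1 on.\<close>

definition s :: "nat \<Rightarrow> real" where "s n = weight_inf a n powr (- \<alpha>)"

lemma s_nonneg [simp]: "0 \<le> s n"
  by (simp add: s_def)

lemma B_powr: assumes z: "z \<in> X" shows "N (B n z) powr \<alpha> \<le> s n * N z powr \<alpha>"
proof -
  have "N (B n z) powr \<alpha> \<le> (N z / weight_inf a n) powr \<alpha>"
    using \<alpha>_pos by (intro powr_mono2 N_B z) auto
  also have "\<dots> = s n * N z powr \<alpha>"
    using weight_inf_pos[of n] by (simp add: s_def powr_divide powr_minus field_simps)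
  finally show ?thesis .
qed

lemma summable_s: "summable (\<lambda>n. s (Suc n))"
  using summable_inf by (simp add: s_def)

lemma s_tendsto: "s \<longlonglongrightarrow> 0"
  using summable_LIMSEQ_zero[OF summable_s] by (simp add: filterlim_sequentially_Suc)

lemma br_measurable_pair: "(\<lambda>p. br (fst p) (snd p)) \<in> borel \<Otimes>\<^sub>M \<B> \<rightarrow>\<^sub>M \<B>"
proof (rule measurable_into_borel)
  fix i show "(\<lambda>p. br (fst p) (snd p) i) \<in> borel_measurable (borel \<Otimes>\<^sub>M \<B>)"
    by (cases i) simp_all
qed (auto simp: space_pair_measure intro: br_mem)

lemma sh_measurable [measurable]: "sh \<in> \<B> \<rightarrow>\<^sub>M \<B>"
proof (rule measurable_into_borel)
  fix i show "(\<lambda>x. sh x i) \<in> borel_measurable \<B>" by (simp add: weighted_shift_def)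
qed (simp add: sh_mem)

lemma shn_measurable [measurable]: "sh ^^ n \<in> \<B> \<rightarrow>\<^sub>M \<B>"
  by (induction n) auto

lemma shn_coord: "(sh ^^ n) z i = weight_prod a i n * z (i + n)"
  by (induction n arbitrary: i) (simp_all add: weight_prod_def weighted_shift_def prod.lessThan_Suc_shift mult_ac del: prod.lessThan_Suc)

end

section \<open>The Ruelle operator\<close>

locale ruelle_space = weighted_space + prob_space m
  for m :: "real measure" +
  fixes A :: "(nat \<Rightarrow> real) \<Rightarrow> real"
  assumes sets_m: "sets m = sets borel"
    and A_Lip: "A \<in> lip_b X (holder_dist N \<alpha>)"
begin

abbreviation L :: "((nat \<Rightarrow> real) \<Rightarrow> real) \<Rightarrow> (nat \<Rightarrow> real) \<Rightarrow> real" where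
  "L \<equiv> ruelle m a A"

definition "MA = Lip_norm A"

lemma A_le: "x \<in> X \<Longrightarrow> \<bar>A x\<bar> \<le> MA"
  and A_diff: "\<lbrakk>x \<in> X; y \<in> X\<rbrakk> \<Longrightarrow> \<bar>A x - A y\<bar> \<le> MA * D x y"
  and MA_nonneg: "0 \<le> MA"
  using Lip_norm_bounds[OF A_Lip] by (auto simp: MA_def)

lemma A_measurable [measurable]: "A \<in> borel_measurable \<B>"
  using Lip_bm[OF A_Lip] by (rule bm_measurable)

lemma space_m [simp]: "space m = UNIV"
  using sets_eq_imp_space_eq[OF sets_m] by simp

lemma br_measurable_pair_m [measurable]: "(\<lambda>p. br (fst p) (snd p)) \<in> m \<Otimes>\<^sub>M \<B> \<rightarrow>\<^sub>M \<B>"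
  using br_measurable_pair measurable_cong_sets[OF sets_pair_measure_cong[OF sets_m refl] refl] by blast

lemma br_measurable_swap [measurable]: "(\<lambda>p. br (snd p) (fst p)) \<in> \<B> \<Otimes>\<^sub>M m \<rightarrow>\<^sub>M \<B>"
  using measurable_compose[OF measurable_pair_swap' br_measurable_pair_m] by (simp add: split_beta)

lemma br_measurable [measurable]: "x \<in> X \<Longrightarrow> (\<lambda>r. br r x) \<in> m \<rightarrow>\<^sub>M \<B>"
  using measurable_compose[OF measurable_Pair1'[of x \<B> m] br_measurable_swap] by simp

lemma exp_A_le: "x \<in> X \<Longrightarrow> exp (A x) \<le> exp MA" and exp_A_ge: "x \<in> X \<Longrightarrow> exp (- MA) \<le> exp (A x)"
  using A_le[of x] by auto

lemma L_integrand_bound: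
  "\<lbrakk>\<And>y. y \<in> X \<Longrightarrow> \<bar>\<phi> y\<bar> \<le> C; x \<in> X\<rbrakk> \<Longrightarrow> \<bar>exp (A (br r x)) * \<phi> (br r x)\<bar> \<le> exp MA * C"
  unfolding abs_mult using exp_A_le[OF br_mem[of x r]] br_mem[of x r] by (intro mult_mono) auto

lemma L_integrable: assumes \<phi>: "\<phi> \<in> bm" and x: "x \<in> X"
  shows "integrable m (\<lambda>r. exp (A (br r x)) * \<phi> (br r x))"
proof -
  obtain C where C: "\<And>y. y \<in> X \<Longrightarrow> \<bar>\<phi> y\<bar> \<le> C" using \<phi> by (metis bmE)
  note bm_measurable[OF \<phi>, measurable] br_measurable[OF x, measurable]
  show ?thesis
  proof (rule integrable_const_bound)
    show "AE r in m. norm (exp (A (br r x)) * \<phi> (br r x)) \<le> exp MA * C"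
      using L_integrand_bound[OF C x] by (intro AE_I2) (simp only: real_norm_def)
  qed simp
qed

lemma L_eq: "L \<phi> x = (\<integral>r. exp (A (br r x)) * \<phi> (br r x) \<partial>m)" for \<phi> :: "(nat \<Rightarrow> real) \<Rightarrow> real"
  by (simp add: ruelle_def)

lemma L_mono: assumes "\<phi> \<in> bm" "\<psi> \<in> bm" "\<And>y. y \<in> X \<Longrightarrow> \<phi> y \<le> \<psi> y" "x \<in> X" shows "L \<phi> x \<le> L \<psi> x"
  unfolding L_eq using assms
  by (intro integral_mono L_integrable) (auto intro!: br_mem)

lemma ruelle_cong: "\<lbrakk>\<And>y. y \<in> X \<Longrightarrow> \<phi> y = \<psi> y; x \<in> X\<rbrakk> \<Longrightarrow> ruelle m a A \<phi> x = ruelle m a A \<psi> x" for \<phi> \<psi> :: "(nat \<Rightarrow> real) \<Rightarrow> 'b::{banach, second_countable_topology}"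
  unfolding ruelle_def by (intro Bochner_Integration.integral_cong) (auto simp: br_mem)

lemma L_add: "\<lbrakk>\<phi> \<in> bm; \<psi> \<in> bm; x \<in> X\<rbrakk> \<Longrightarrow> L (\<lambda>y. \<phi> y + \<psi> y) x = L \<phi> x + L \<psi> x"
  unfolding L_eq distrib_left by (intro Bochner_Integration.integral_add L_integrable)

lemma L_scale: "L (\<lambda>y. t * \<phi> y) x = t * L \<phi> x" for t :: real
  unfolding L_eq mult.left_commute[of _ t] by simp

lemma L_bm: assumes \<phi>: "\<phi> \<in> bm" shows "L \<phi> \<in> bm"
proof -
  obtain C where C: "0 \<le> C" "\<And>y. y \<in> X \<Longrightarrow> \<bar>\<phi> y\<bar> \<le> C" using \<phi> by (metis bmE)
  note bm_measurable[OF \<phi>, measurable]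
  show ?thesis
  proof (rule bmI)
    show "L \<phi> \<in> borel_measurable \<B>"
      unfolding L_eq[abs_def] by (rule borel_measurable_lebesgue_integral) (simp add: split_beta)
    fix x assume x: "x \<in> X"
    have "norm (L \<phi> x) \<le> (\<integral>r. exp MA * C \<partial>m)" unfolding L_eq
      by (rule order_trans[OF integral_norm_bound integral_mono])
         (use L_integrable[OF \<phi> x] L_integrand_bound[OF C(2) x] in auto)
    then show "\<bar>L \<phi> x\<bar> \<le> exp MA * C" using prob_space by simp
  qed
qed

lemma Ln_bm: "\<phi> \<in> bm \<Longrightarrow> (L ^^ n) \<phi> \<in> bm"
  by (induction n) (auto intro: L_bm)

lemma Ln_mono: "\<lbrakk>\<phi> \<in> bm; \<psi> \<in> bm; \<And>y. y \<in> X \<Longrightarrow> \<phi> y \<le> \<psi> y; x \<in> X\<rbrakk> \<Longrightarrow> (L ^^ n) \<phi> x \<le> (L ^^ n) \<psi> x"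
  by (induction n arbitrary: x) (auto intro: L_mono Ln_bm)

lemma Ln_cong: "\<lbrakk>\<And>y. y \<in> X \<Longrightarrow> \<phi> y = \<psi> y; x \<in> X\<rbrakk> \<Longrightarrow> (ruelle m a A ^^ n) \<phi> x = (ruelle m a A ^^ n) \<psi> x" for \<phi> \<psi> :: "(nat \<Rightarrow> real) \<Rightarrow> 'b::{banach, second_countable_topology}"
  by (induction n arbitrary: x) (auto intro: ruelle_cong)

lemma Ln_scale: "x \<in> X \<Longrightarrow> (L ^^ n) (\<lambda>y. t * \<phi> y) x = t * (L ^^ n) \<phi> x" for t :: real
proof (induction n arbitrary: x)
  case (Suc n)
  have "L ((L ^^ n) (\<lambda>y. t * \<phi> y)) x = L (\<lambda>y. t * (L ^^ n) \<phi> y) x" by (rule ruelle_cong) (use Suc in auto)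
  then show ?case by (simp add: L_scale)
qed simp

lemma Ln_add: "\<lbrakk>\<phi> \<in> bm; \<psi> \<in> bm; x \<in> X\<rbrakk> \<Longrightarrow> (L ^^ n) (\<lambda>y. \<phi> y + \<psi> y) x = (L ^^ n) \<phi> x + (L ^^ n) \<psi> x"
proof (induction n arbitrary: x)
  case (Suc n)
  have "L ((L ^^ n) (\<lambda>y. \<phi> y + \<psi> y)) x = L (\<lambda>y. (L ^^ n) \<phi> y + (L ^^ n) \<psi> y) x" by (rule ruelle_cong) (use Suc in auto)
  then show ?case using Suc.prems by (simp add: L_add Ln_bm)
qed simp

lemma Ln_diff: "\<lbrakk>\<phi> \<in> bm; \<psi> \<in> bm; x \<in> X\<rbrakk> \<Longrightarrow> (L ^^ n) (\<lambda>y. \<phi> y - \<psi> y) x = (L ^^ n) \<phi> x - (L ^^ n) \<psi> x"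
  using Ln_add[of \<phi> "\<lambda>y. -1 * \<psi> y" x n] Ln_scale[of x n "-1" \<psi>] bm_mult[OF bm_const[of "-1"]] by simp

lemma Ln_nonneg: "\<lbrakk>\<phi> \<in> bm; \<And>y. y \<in> X \<Longrightarrow> 0 \<le> \<phi> y; x \<in> X\<rbrakk> \<Longrightarrow> 0 \<le> (L ^^ n) \<phi> x"
  using Ln_mono[of "\<lambda>_. 0" \<phi> x n] Ln_scale[of x n 0 \<phi>] by simp

lemma Ln_const: "x \<in> X \<Longrightarrow> (L ^^ n) (\<lambda>_. t) x = t * (L ^^ n) (\<lambda>_. 1) x" for t :: real
  using Ln_scale[of x n t "\<lambda>_. 1"] by simp

lemma Ln_abs_le: assumes "\<phi> \<in> bm" "\<And>y. y \<in> X \<Longrightarrow> \<bar>\<phi> y\<bar> \<le> C" "x \<in> X"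
  shows "\<bar>(L ^^ n) \<phi> x\<bar> \<le> C * (L ^^ n) (\<lambda>_. 1) x"
proof -
  have "(L ^^ n) \<phi> x \<le> (L ^^ n) (\<lambda>_. C) x" "(L ^^ n) (\<lambda>_. - C) x \<le> (L ^^ n) \<phi> x"
    using assms by (auto intro!: Ln_mono simp: abs_le_iff) (smt (verit))
  then show ?thesis using Ln_const[OF assms(3), of n C] Ln_const[OF assms(3), of n "- C"] by (simp add: abs_le_iff)
qed

lemma Ln_comp: "(L ^^ (j + k)) \<phi> = (L ^^ j) ((L ^^ k) \<phi>)"
  by (simp add: funpow_add)

text \<open>Since \<open>sh\<close> undoes every branch, a factor \<open>g (sh z)\<close> is
  constant under the integral. Tightness, invariance and mixing all exploit this.\<close>

lemma L_shift: "x \<in> X \<Longrightarrow> L (\<lambda>z. \<phi> z * g (sh z)) x = g x * L \<phi> x" for g \<phi> :: "(nat \<Rightarrow> real) \<Rightarrow> real"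
  unfolding L_eq sh_br by (simp add: mult.commute mult.left_commute)

lemma Ln_shift: "x \<in> X \<Longrightarrow> (L ^^ n) (\<lambda>z. \<phi> z * g ((sh ^^ n) z)) x = g x * (L ^^ n) \<phi> x"
  for g \<phi> :: "(nat \<Rightarrow> real) \<Rightarrow> real"
proof (induction n arbitrary: x \<phi>)
  case (Suc n)
  have "(L ^^ Suc n) (\<lambda>z. \<phi> z * g ((sh ^^ Suc n) z)) x = (L ^^ n) (L (\<lambda>z. \<phi> z * (g \<circ> (sh ^^ n)) (sh z))) x"
    by (simp only: funpow_Suc_right o_apply)
  also have "\<dots> = (L ^^ n) (\<lambda>z. L \<phi> z * g ((sh ^^ n) z)) x"
    using Suc.prems by (intro Ln_cong) (simp_all only: L_shift[where g="\<lambda>w. g ((sh ^^ n) w)"] mult.commute[of "L \<phi> _"] o_apply)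
  also have "\<dots> = g x * (L ^^ n) (L \<phi>) x" using Suc by blast
  finally show ?case by (simp only: funpow_Suc_right o_apply)
qed simp

text \<open>Points reached from \<open>x\<close> and \<open>y\<close> along the same symbols differ
  by some \<open>B j z\<close>, so one constant \<open>v j\<close> bounds the change of the
  potential for all symbols. The induction needs an arbitrary starting depth \<open>i\<close>,
  because one branch raises it to \<open>Suc i\<close>. The bounds \<open>v\<close> and
  \<open>e\<close> stay abstract since the Hoelder and the summable-variation estimate are both
  instances.\<close>

lemma distortion:
  assumes v: "\<And>i x y. \<lbrakk>1 \<le> i; x \<in> X; y \<in> X; (\<lambda>j. x j - y j) = B i z\<rbrakk> \<Longrightarrow> A x \<le> A y + v i"
    and e: "\<And>i x y. \<lbrakk>x \<in> X; y \<in> X; (\<lambda>j. x j - y j) = B i z\<rbrakk> \<Longrightarrow> \<phi> x \<le> \<phi> y + e i"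
    and \<phi>: "\<phi> \<in> bm" "\<And>x. x \<in> X \<Longrightarrow> 0 \<le> \<phi> x"
    and xy: "x \<in> X" "y \<in> X" "(\<lambda>j. x j - y j) = B i z"
  shows "(L ^^ k) \<phi> x \<le> exp (\<Sum>j<k. v (i + j + 1)) * ((L ^^ k) \<phi> y + e (i + k) * (L ^^ k) (\<lambda>_. 1) y)"
  using xy
proof (induction k arbitrary: x y i)
  case 0
  then show ?case using e by simp
next
  case (Suc k)
  let ?E = "exp (\<Sum>j<Suc k. v (i + j + 1))"
  let ?G = "\<lambda>w. (L ^^ k) \<phi> w + e (i + Suc k) * (L ^^ k) (\<lambda>_. 1) w"
  have G: "?G \<in> bm" by (intro bm_add bm_mult bm_const Ln_bm \<phi>)
  have "(L ^^ Suc k) \<phi> x = (\<integral>r. exp (A (br r x)) * (L ^^ k) \<phi> (br r x) \<partial>m)" by (simp add: L_eq)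
  also have "\<dots> \<le> (\<integral>r. ?E * (exp (A (br r y)) * ?G (br r y)) \<partial>m)"
  proof (intro integral_mono L_integrable Ln_bm \<phi> Suc.prems integrable_mult_right G)
    fix r
    have b: "br r x \<in> X" "br r y \<in> X" using Suc.prems by (auto intro: br_mem)
    have d: "(\<lambda>j. br r x j - br r y j) = B (Suc i) z" unfolding br_diff Suc.prems(3) by simp
    have 1: "(L ^^ k) \<phi> (br r x) \<le> exp (\<Sum>j<k. v (Suc i + j + 1)) * ?G (br r y)"
      using Suc.IH[OF b d] by simp
    have 2: "exp (A (br r x)) \<le> exp (A (br r y)) * exp (v (Suc i))"
      using v[OF _ b d] by (simp flip: exp_add)
    have 3: "(\<Sum>j<Suc k. v (i + j + 1)) = v (Suc i) + (\<Sum>j<k. v (Suc i + j + 1))"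
      by (subst sum.lessThan_Suc_shift) simp
    have "exp (A (br r x)) * (L ^^ k) \<phi> (br r x) \<le> (exp (A (br r y)) * exp (v (Suc i))) * (exp (\<Sum>j<k. v (Suc i + j + 1)) * ?G (br r y))"
      using 1 2 Ln_nonneg[OF \<phi> b(1)] by (intro mult_mono) auto
    then show "exp (A (br r x)) * (L ^^ k) \<phi> (br r x) \<le> ?E * (exp (A (br r y)) * ?G (br r y))"
      unfolding 3 exp_add by (simp only: mult.assoc mult.left_commute mult.commute)
  qed
  also have "\<dots> = ?E * L ?G y" by (simp add: L_eq)
  also have "L ?G y = (L ^^ Suc k) \<phi> y + e (i + Suc k) * (L ^^ Suc k) (\<lambda>_. 1) y"
    using Suc.prems by (simp add: L_add L_scale Ln_bm \<phi> bm_mult)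
  finally show ?case .
qed

definition "KA = MA * (\<Sum>n. s (Suc n))"

lemma KA_nonneg: "0 \<le> KA"
  unfolding KA_def by (intro mult_nonneg_nonneg MA_nonneg suminf_nonneg summable_s) simp

text \<open>The instance \<open>v i = MA * s i * D x y\<close> of \<open>distortion\<close>. Its
  exponential factor tends to 1 as \<open>y\<close> approaches \<open>x\<close> and stays bounded on
  bounded sets, which serves both the Hoelder regularity of iterates and the spreading of values
  over balls.\<close>

lemma harnack:
  assumes \<phi>: "\<phi> \<in> bm" "\<And>x. x \<in> X \<Longrightarrow> 0 \<le> \<phi> x"
    and lip: "\<And>x y. \<lbrakk>x \<in> X; y \<in> X\<rbrakk> \<Longrightarrow> \<phi> x \<le> \<phi> y + C * D x y" and C: "0 \<le> C"
    and xy: "x \<in> X" "y \<in> X"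
  shows "(L ^^ k) \<phi> x \<le> exp (KA * D x y) * ((L ^^ k) \<phi> y + C * s k * D x y * (L ^^ k) (\<lambda>_. 1) y)"
proof -
  let ?z = "\<lambda>j. x j - y j"
  have z: "?z \<in> X" using xy by (rule diff_mem)
  have Dz: "D u w \<le> s i * D x y" if "(\<lambda>j. u j - w j) = B i ?z" for u w i
    using B_powr[OF z, of i] that by simp
  have "(L ^^ k) \<phi> x \<le> exp (\<Sum>j<k. MA * (s (0 + j + 1) * D x y)) * ((L ^^ k) \<phi> y + (C * (s (0 + k) * D x y)) * (L ^^ k) (\<lambda>_. 1) y)"
  proof (rule distortion[where z="?z" and i=0 and e="\<lambda>k. C * (s k * D x y)"])
    fix i u w assume *: "u \<in> X" "w \<in> X" "(\<lambda>j. u j - w j) = B i ?z"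
    show "A u \<le> A w + MA * (s i * D x y)"
      using A_diff[OF *(1,2)] mult_left_mono[OF Dz[OF *(3)] MA_nonneg] by linarith
    show "\<phi> u \<le> \<phi> w + C * (s i * D x y)"
      using lip[OF *(1,2)] mult_left_mono[OF Dz[OF *(3)] C] by linarith
  qed (use \<phi> xy in auto)
  also have "\<dots> \<le> exp (KA * D x y) * ((L ^^ k) \<phi> y + (C * (s (0 + k) * D x y)) * (L ^^ k) (\<lambda>_. 1) y)"
  proof (rule mult_right_mono)
    have "(\<Sum>j<k. s (Suc j)) \<le> (\<Sum>n. s (Suc n))" by (intro sum_le_suminf summable_s) auto
    then have "MA * (\<Sum>j<k. s (Suc j)) * D x y \<le> KA * D x y"
      unfolding KA_def by (intro mult_right_mono mult_left_mono MA_nonneg) auto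
    then show "exp (\<Sum>j<k. MA * (s (0 + j + 1) * D x y)) \<le> exp (KA * D x y)"
      by (simp add: sum_distrib_left sum_distrib_right mult.assoc)
    show "0 \<le> (L ^^ k) \<phi> y + (C * (s (0 + k) * D x y)) * (L ^^ k) (\<lambda>_. 1) y"
      using C by (intro add_nonneg_nonneg mult_nonneg_nonneg Ln_nonneg \<phi> xy) auto
  qed
  finally show ?thesis by (simp add: mult.assoc)
qed

text \<open>For \<open>D x y \<ge> 1\<close> the sup bound alone gives the Hoelder estimate; for \<open>D x y \<le> 1\<close> use the
  convexity bound \<open>exp u - 1 \<le> u * exp u\<close> in the distortion estimate.\<close>

definition "QA = 2 + 3 * KA * exp KA + (SUP n. s n) * exp KA"

lemma s_bdd: "bdd_above (range s)"
  using convergent_imp_Bseq[OF convergentI[OF s_tendsto]] by (auto simp: Bseq_def bdd_above_def abs_le_iff)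

lemma s_le: "s n \<le> (SUP n. s n)"
  by (intro cSUP_upper s_bdd) simp

lemma QA_ge: "2 \<le> QA"
  unfolding QA_def using KA_nonneg s_le[of 0] order_trans[OF s_nonneg s_le[of 0]] by simp

lemma Ln_Lip_bound:
  assumes C: "0 \<le> C" "\<And>x. x \<in> X \<Longrightarrow> \<bar>\<phi> x\<bar> \<le> C" "\<And>x y. \<lbrakk>x \<in> X; y \<in> X\<rbrakk> \<Longrightarrow> \<bar>\<phi> x - \<phi> y\<bar> \<le> C * D x y"
    and G: "\<And>x. x \<in> X \<Longrightarrow> (L ^^ k) (\<lambda>_. 1) x \<le> G"
    and xy: "x \<in> X" "y \<in> X"
  shows "\<bar>(L ^^ k) \<phi> x - (L ^^ k) \<phi> y\<bar> \<le> QA * C * G * D x y"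
proof -
  have \<phi>: "\<phi> \<in> bm" by (rule Lip_bm, rule LipI) (use C in auto)
  have G0: "0 \<le> G" using Ln_nonneg[OF bm_const[of 1] _ xy(1), where n=k] G[OF xy(1)] by simp
  have abs: "\<bar>(L ^^ k) \<phi> u\<bar> \<le> C * G" if "u \<in> X" for u
    using Ln_abs_le[OF \<phi> C(2) that, of k] mult_left_mono[OF G[OF that] C(1)] by linarith
  have one: "(L ^^ k) \<phi> x - (L ^^ k) \<phi> y \<le> QA * C * G * D x y" if xy: "x \<in> X" "y \<in> X" for x y
  proof (cases "1 \<le> D x y")
    case True
    have "(L ^^ k) \<phi> x - (L ^^ k) \<phi> y \<le> 2 * (C * G)" using abs[OF xy(1)] abs[OF xy(2)] by linarith
    also have "\<dots> \<le> QA * (C * G)" using QA_ge C(1) G0 by (intro mult_right_mono) auto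
    also have "\<dots> \<le> QA * (C * G) * D x y"
      using True QA_ge C(1) G0 by (intro mult_left_mono[of 1 "D x y", simplified]) auto
    finally show ?thesis by (simp add: mult.assoc)
  next
    case False
    define d where "d = D x y"
    have d: "0 \<le> d" "d \<le> 1" using False by (auto simp: d_def)
    define u where "u = KA * d"
    have u: "0 \<le> u" "u \<le> KA" using d KA_nonneg by (auto simp: u_def mult_left_le)
    \<comment> \<open>Adding \<open>C\<close> provides the nonnegativity that \<open>harnack\<close>
      requires. As \<open>L^k C\<close> need not be constant, its own variation is subtracted in
      fact \<open>4\<close>; together with the bound \<open>2 * (C * G)\<close> used in fact
      \<open>1\<close> this produces the coefficient 3 in \<open>QA\<close>.\<close>
    let ?\<psi> = "\<lambda>x. \<phi> x + C"
    have \<psi>: "?\<psi> \<in> bm" using \<phi> by auto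
    have H: "(L ^^ k) ?\<psi> x \<le> exp u * ((L ^^ k) ?\<psi> y + C * s k * d * (L ^^ k) (\<lambda>_. 1) y)"
      unfolding u_def d_def
    proof (rule harnack[OF \<psi> _ _ C(1) xy])
      show "0 \<le> ?\<psi> x" if "x \<in> X" for x using C(2)[OF that] by linarith
      show "?\<psi> x \<le> ?\<psi> y + C * D x y" if "x \<in> X" "y \<in> X" for x y using C(3)[OF that] by linarith
    qed
    have e: "(L ^^ k) ?\<psi> w = (L ^^ k) \<phi> w + C * (L ^^ k) (\<lambda>_. 1) w" if "w \<in> X" for w
      using Ln_add[OF \<phi> bm_const[of C] that, where n=k] Ln_const[OF that, where n=k and t=C] by simp
    let ?S = "SUP n. s n"
    have S: "s k \<le> ?S" "0 \<le> ?S" using s_le[of k] order_trans[OF s_nonneg s_le[of k]] by auto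
    have "1 - u \<le> exp (- u)" using exp_ge_add_one_self[of "- u"] by simp
    from mult_right_mono[OF this, of "exp u"] have "exp u - 1 \<le> u * exp u" by (simp add: algebra_simps flip: exp_add)
    also have "\<dots> \<le> u * exp KA" using u by (intro mult_left_mono) auto
    finally have E: "exp u - 1 \<le> KA * exp KA * d" by (simp add: u_def mult_ac)
    have H1: "(L ^^ k) (\<lambda>_. 1) y \<le> exp u * (L ^^ k) (\<lambda>_. 1) x"
      using harnack[OF bm_const[of 1] _ _ order_refl xy(2,1), where k=k] by (simp add: u_def d_def D_commute[of y x])
    have \<psi>0: "0 \<le> (L ^^ k) ?\<psi> y" by (rule Ln_nonneg[OF \<psi> _ xy(2)]) (use C(2) in \<open>fastforce simp: abs_le_iff\<close>)
    have "(L ^^ k) ?\<psi> y \<le> 2 * (C * G)"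
      using e[OF xy(2)] abs[OF xy(2)] mult_left_mono[OF G[OF xy(2)] C(1)] by linarith
    then have 1: "(exp u - 1) * (L ^^ k) ?\<psi> y \<le> KA * exp KA * d * (2 * (C * G))"
      using E \<psi>0 u d KA_nonneg C(1) G0 by (intro mult_mono) auto
    have 2: "(exp u - 1) * (L ^^ k) (\<lambda>_. 1) x \<le> KA * exp KA * d * G"
      using E Ln_nonneg[OF bm_const[of 1] _ xy(1), where n=k] xy(1) u d KA_nonneg G0 G[OF xy(1)] by (intro mult_mono) auto
    have "C * s k * d * (L ^^ k) (\<lambda>_. 1) y \<le> C * ?S * d * G"
      using S C(1) d G[OF xy(2)] Ln_nonneg[OF bm_const[of 1] _ xy(2), where n=k] xy(2) by (intro mult_mono) auto
    then have 3: "exp u * (C * s k * d * (L ^^ k) (\<lambda>_. 1) y) \<le> exp KA * (C * ?S * d * G)"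
      using u C(1) d Ln_nonneg[OF bm_const[of 1] _ xy(2), where n=k] xy(2) by - (rule mult_mono, auto)
    have 4: "C * ((L ^^ k) (\<lambda>_. 1) y - (L ^^ k) (\<lambda>_. 1) x) \<le> C * (KA * exp KA * d * G)"
      using H1 2 by (intro mult_left_mono C(1)) (simp add: algebra_simps)
    have 5: "(L ^^ k) ?\<psi> x - (L ^^ k) ?\<psi> y \<le> KA * exp KA * d * (2 * (C * G)) + exp KA * (C * ?S * d * G)"
      using H 1 3 by (simp add: algebra_simps)
    have "(L ^^ k) \<phi> x - (L ^^ k) \<phi> y \<le> KA * exp KA * d * (2 * (C * G)) + exp KA * (C * ?S * d * G) + C * (KA * exp KA * d * G)"
      using 4 5 e[OF xy(1)] e[OF xy(2)] by (simp add: algebra_simps)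
    also have "\<dots> = (3 * KA * exp KA + ?S * exp KA) * (C * G * d)" by (simp add: algebra_simps)
    also have "\<dots> \<le> QA * (C * G * d)"
      unfolding QA_def using C(1) G0 d by (intro mult_right_mono) auto
    finally show ?thesis by (simp add: d_def mult.assoc)
  qed
  from one[OF xy] one[OF xy(2,1)] show ?thesis by (simp add: D_commute[of y x] abs_le_iff)
qed

end

section \<open>Series, bounded limits and growth under the operator\<close>

context ruelle_space
begin

text \<open>The values lie in a Banach space because both the real series of the eigenfunction and
  the complex Neumann series use this exchange.\<close>

lemma L_suminf:
  fixes f :: "nat \<Rightarrow> (nat \<Rightarrow> real) \<Rightarrow> 'b::{banach, second_countable_topology}"
  assumes f: "\<And>n. f n \<in> borel_measurable \<B>" and b: "\<And>n y. y \<in> X \<Longrightarrow> norm (f n y) \<le> b n"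
    and sb: "summable b" and x: "x \<in> X"
  shows "ruelle m a A (\<lambda>y. \<Sum>n. f n y) x = (\<Sum>n. ruelle m a A (f n) x)"
    and "summable (\<lambda>n. ruelle m a A (f n) x)"
proof -
  note f[measurable] br_measurable[OF x, measurable]
  let ?g = "\<lambda>n r. exp (A (br r x)) *\<^sub>R f n (br r x)"
  have bnd: "norm (?g n r) \<le> exp MA * b n" for n r
    using exp_A_le[OF br_mem[OF x]] b[OF br_mem[OF x]] by (auto intro: mult_mono)
  have int: "integrable m (?g n)" for n
    by (rule integrable_const_bound[of _ "exp MA * b n"]) (simp_all only: bnd AE_I2, simp)
  have sn: "summable (\<lambda>n. norm (?g n r))" for r
    by (rule summable_comparison_test'[OF summable_mult[OF sb, of "exp MA"], of 0]) (use bnd in simp)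
  have si: "summable (\<lambda>n. \<integral>r. norm (?g n r) \<partial>m)"
  proof (rule summable_comparison_test'[OF summable_mult[OF sb, of "exp MA"], of 0])
    fix n
    have "(\<integral>r. norm (?g n r) \<partial>m) \<le> (\<integral>r. exp MA * b n \<partial>m)"
      by (rule integral_mono[OF integrable_norm[OF int]]) (use bnd in auto)
    then show "norm (\<integral>r. norm (?g n r) \<partial>m) \<le> exp MA * b n" using prob_space by simp
  qed
  have "(\<integral>r. (\<Sum>n. ?g n r) \<partial>m) = (\<Sum>n. \<integral>r. ?g n r \<partial>m)"
    by (rule integral_suminf[OF int _ si]) (use sn in simp)
  moreover have "(\<Sum>n. ?g n r) = exp (A (br r x)) *\<^sub>R (\<Sum>n. f n (br r x))" for r
    by (rule suminf_scaleR_right[symmetric])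
       (rule summable_norm_cancel, rule summable_comparison_test'[OF sb, of 0], use b[OF br_mem[OF x]] in simp)
  ultimately show "ruelle m a A (\<lambda>y. \<Sum>n. f n y) x = (\<Sum>n. ruelle m a A (f n) x)" by (simp add: ruelle_def)
  show "summable (\<lambda>n. ruelle m a A (f n) x)" unfolding ruelle_def
    by (rule summable_comparison_test'[OF si, of 0]) (rule integral_norm_bound)
qed

text \<open>Bounded pointwise convergence suffices, and this is all that the diagonal subsequence in
  the construction of the eigenfunction supplies.\<close>

lemma L_tendsto:
  fixes f :: "nat \<Rightarrow> (nat \<Rightarrow> real) \<Rightarrow> real"
  assumes f: "\<And>n. f n \<in> bm" and b: "\<And>n y. y \<in> X \<Longrightarrow> \<bar>f n y\<bar> \<le> b"
    and lim: "\<And>y. y \<in> X \<Longrightarrow> (\<lambda>n. f n y) \<longlonglongrightarrow> g y" and x: "x \<in> X"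
  shows "(\<lambda>n. L (f n) x) \<longlonglongrightarrow> L g x"
  unfolding L_eq
proof (rule integral_dominated_convergence[where w = "\<lambda>_. exp MA * b"])
  have [measurable]: "g \<in> borel_measurable \<B>"
    by (rule borel_measurable_LIMSEQ_real[of \<B> f]) (use lim f in \<open>auto intro: bm_measurable\<close>)
  note bm_measurable[OF f, measurable] br_measurable[OF x, measurable]
  show "(\<lambda>r. exp (A (br r x)) * g (br r x)) \<in> borel_measurable m"
    "\<And>i. (\<lambda>r. exp (A (br r x)) * f i (br r x)) \<in> borel_measurable m" by measurable
  show "AE r in m. (\<lambda>i. exp (A (br r x)) * f i (br r x)) \<longlonglongrightarrow> exp (A (br r x)) * g (br r x)"
    by (intro AE_I2 tendsto_mult_left lim br_mem x)
  show "\<And>i. AE r in m. norm (exp (A (br r x)) * f i (br r x)) \<le> exp MA * b"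
    using L_integrand_bound[OF b x] by (intro AE_I2) (simp only: real_norm_def)
qed simp

lemma L_one_bounds: "x \<in> X \<Longrightarrow> exp (- MA) \<le> L (\<lambda>_. 1) x" "x \<in> X \<Longrightarrow> L (\<lambda>_. 1) x \<le> exp MA"
proof -
  assume x: "x \<in> X"
  have i: "integrable m (\<lambda>r. exp (A (br r x)) * 1)" by (rule L_integrable[OF bm_const x])
  have "(\<integral>r. exp (- MA) \<partial>m) \<le> (\<integral>r. exp (A (br r x)) * 1 \<partial>m)"
    by (rule integral_mono[OF _ i]) (use exp_A_ge[OF br_mem[OF x]] in auto)
  then show "exp (- MA) \<le> L (\<lambda>_. 1) x" using prob_space by (simp add: L_eq)
  have "(\<integral>r. exp (A (br r x)) * 1 \<partial>m) \<le> (\<integral>r. exp MA \<partial>m)"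
    by (rule integral_mono[OF i]) (use exp_A_le[OF br_mem[OF x]] in auto)
  then show "L (\<lambda>_. 1) x \<le> exp MA" using prob_space by (simp add: L_eq)
qed

lemma Ln_one_bounds: "x \<in> X \<Longrightarrow> exp (- MA) ^ n \<le> (L ^^ n) (\<lambda>_. 1) x" "x \<in> X \<Longrightarrow> (L ^^ n) (\<lambda>_. 1) x \<le> exp MA ^ n"
proof (induction n arbitrary: x)
  case (Suc n)
  {
    case 1
    have "exp (- MA) ^ Suc n \<le> exp (- MA) ^ n * L (\<lambda>_. 1) x"
      using L_one_bounds(1)[OF 1] by (simp add: mult.commute)
    also have "\<dots> = L (\<lambda>_. exp (- MA) ^ n * 1) x" by (simp only: L_scale)
    also have "\<dots> \<le> (L ^^ Suc n) (\<lambda>_. 1) x"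
      using 1 Suc.IH(1) by (auto intro!: L_mono Ln_bm)
    finally show ?case .
  next
    case 2
    have "(L ^^ Suc n) (\<lambda>_. 1) x \<le> L (\<lambda>_. exp MA ^ n * 1) x"
      using 2 Suc.IH(2) by (auto intro!: L_mono Ln_bm)
    also have "\<dots> = exp MA ^ n * L (\<lambda>_. 1) x" by (simp only: L_scale)
    also have "\<dots> \<le> exp MA ^ Suc n"
      using L_one_bounds(2)[OF 2] by (simp add: mult.commute)
    finally show ?case .
  }
qed auto

lemma Ln_one_pos: "x \<in> X \<Longrightarrow> 0 < (L ^^ n) (\<lambda>_. 1) x"
  using Ln_one_bounds(1)[of x n] by (meson exp_gt_zero less_le_trans zero_less_power)

end

section \<open>Existence of the eigenfunction\<close>

locale ruelle_sv = ruelle_space +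
  assumes A_SV: "A \<in> summable_variation X N"
begin

definition "v n = enn2real (variation X A n)"

definition "V = (\<Sum>n. v (Suc n))"

lemma variation_finite: "variation X A (Suc n) < \<infinity>"
  using A_SV ennreal_suminf_lessD[of "\<lambda>n. variation X A (Suc n)" \<infinity>] by (simp add: summable_variation_def)

lemma v_nonneg [simp]: "0 \<le> v n"
  by (simp add: v_def)

lemma summable_v: "summable (\<lambda>n. v (Suc n))"
proof (rule summable_suminf_not_top)
  have "(\<Sum>n. ennreal (v (Suc n))) = (\<Sum>n. variation X A (Suc n))"
    unfolding v_def using variation_finite by (intro suminf_cong) (simp add: less_top)
  then show "(\<Sum>n. ennreal (v (Suc n))) \<noteq> top"
    using A_SV by (auto simp: summable_variation_def less_top)
qed simp

lemma V_nonneg: "0 \<le> V"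
  unfolding V_def by (intro suminf_nonneg summable_v) simp

lemma A_diff_v: assumes "x \<in> X" "y \<in> X" "\<And>i. i < Suc n \<Longrightarrow> x i = y i" shows "\<bar>A x - A y\<bar> \<le> v (Suc n)"
proof -
  have "ennreal \<bar>A x - A y\<bar> \<le> variation X A (Suc n)"
    unfolding variation_def using assms by (intro SUP_upper2[of "(x, y)"]) auto
  then have "enn2real (ennreal \<bar>A x - A y\<bar>) \<le> v (Suc n)"
    unfolding v_def using variation_finite by (intro enn2real_mono) auto
  then show ?thesis by simp
qed

text \<open>The vector \<open>B i z\<close> vanishes in the first \<open>i\<close> coordinates, so
  for \<open>i \<ge> 1\<close> the \<open>i\<close>-th variation of \<open>A\<close> bounds the
  change of the potential. The factor \<open>exp V\<close> does not depend on the distance of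
  \<open>x\<close> and \<open>y\<close>; only the error term does, and it carries
  \<open>s k\<close>, which tends to 0.\<close>

lemma sv_distortion:
  assumes \<phi>: "\<phi> \<in> bm" "\<And>x. x \<in> X \<Longrightarrow> 0 \<le> \<phi> x"
    and lip: "\<And>x y. \<lbrakk>x \<in> X; y \<in> X\<rbrakk> \<Longrightarrow> \<phi> x \<le> \<phi> y + C * D x y" and C: "0 \<le> C"
    and xy: "x \<in> X" "y \<in> X"
  shows "(L ^^ k) \<phi> x \<le> exp V * ((L ^^ k) \<phi> y + C * s k * D x y * (L ^^ k) (\<lambda>_. 1) y)"
proof -
  let ?z = "\<lambda>j. x j - y j"
  have z: "?z \<in> X" using xy by (rule diff_mem)
  have Dz: "D u w \<le> s i * D x y" if "(\<lambda>j. u j - w j) = B i ?z" for u w i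
    using B_powr[OF z, of i] that by simp
  have "(L ^^ k) \<phi> x \<le> exp (\<Sum>j<k. v (0 + j + 1)) * ((L ^^ k) \<phi> y + (C * (s (0 + k) * D x y)) * (L ^^ k) (\<lambda>_. 1) y)"
  proof (rule distortion[where z="?z" and i=0 and e="\<lambda>k. C * (s k * D x y)"])
    fix i u w assume *: "u \<in> X" "w \<in> X" "(\<lambda>j. u j - w j) = B i ?z"
    show "\<phi> u \<le> \<phi> w + C * (s i * D x y)"
      using lip[OF *(1,2)] mult_left_mono[OF Dz[OF *(3)] C] by linarith
    assume i: "1 \<le> i"
    have "u j = w j" if "j < i" for j
      using fun_cong[OF *(3), of j] that by (simp add: B_coord)
    then show "A u \<le> A w + v i"
      using A_diff_v[OF *(1,2), of "i - 1"] i by (auto simp: abs_le_iff)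
  qed (use \<phi> xy in auto)
  also have "\<dots> \<le> exp V * ((L ^^ k) \<phi> y + (C * (s (0 + k) * D x y)) * (L ^^ k) (\<lambda>_. 1) y)"
  proof (rule mult_right_mono)
    have "(\<Sum>j<k. v (Suc j)) \<le> V" unfolding V_def by (intro sum_le_suminf summable_v) auto
    then show "exp (\<Sum>j<k. v (0 + j + 1)) \<le> exp V" by simp
    show "0 \<le> (L ^^ k) \<phi> y + (C * (s (0 + k) * D x y)) * (L ^^ k) (\<lambda>_. 1) y"
      using C by (intro add_nonneg_nonneg mult_nonneg_nonneg Ln_nonneg \<phi> xy) auto
  qed
  finally show ?thesis by (simp add: mult.assoc)
qed

section \<open>Growth of the iterates of 1 and the radius of convergence\<close>

definition "u n = (L ^^ n) (\<lambda>_. 1) (\<lambda>_. 0 :: real)"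

text \<open>The factor \<open>exp V\<close> turns the value at 0 into an upper bound of the
  \<open>n\<close>-th iterate of 1 on all of \<open>X\<close>, and thereby makes \<open>w\<close>
  submultiplicative.\<close>

definition "w n = exp V * u n"

lemma one_compare: "\<lbrakk>x \<in> X; y \<in> X\<rbrakk> \<Longrightarrow> (L ^^ n) (\<lambda>_. 1) x \<le> exp V * (L ^^ n) (\<lambda>_. 1) y"
  using sv_distortion[OF bm_const[of 1] _ _ order_refl, where k=n and x=x and y=y] by simp

lemma Ln_one_le_w: "x \<in> X \<Longrightarrow> (L ^^ n) (\<lambda>_. 1) x \<le> w n"
  unfolding w_def u_def by (rule one_compare) auto

lemma u_pos: "0 < u n"
  unfolding u_def by (rule Ln_one_pos) simp

lemma u_le_w: "u n \<le> w n"
  unfolding w_def using V_nonneg u_pos[of n] mult_right_mono[of 1 "exp V" "u n"] by simp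

lemma w_pos: "0 < w n"
  using u_pos[of n] u_le_w[of n] by linarith

lemma w_submult: "w (n + k) \<le> w n * w k"
proof -
  have "u (n + k) = (L ^^ n) ((L ^^ k) (\<lambda>_. 1)) (\<lambda>_. 0)" by (simp add: u_def Ln_comp)
  also have "\<dots> \<le> (L ^^ n) (\<lambda>_. w k) (\<lambda>_. 0)"
    by (intro Ln_mono Ln_bm Ln_one_le_w) auto
  also have "\<dots> = w k * u n" unfolding u_def by (rule Ln_const) simp
  finally show ?thesis unfolding w_def by (simp add: mult_ac)
qed

text \<open>The supremum of \<open>S\<close> is the radius of convergence of the power series with
  coefficients \<open>w n\<close>.\<close>

definition "S = {t::real. 0 \<le> t \<and> (\<exists>C. \<forall>n. t ^ n * w n \<le> C)}"

definition "ts = Sup S"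

lemma exp_MA_S: "exp (- MA) \<in> S"
  unfolding S_def
proof (intro CollectI conjI exI[of _ "exp V"] allI)
  fix n
  have "exp (- MA) ^ n * u n \<le> exp (- MA) ^ n * exp MA ^ n"
    unfolding u_def by (intro mult_left_mono Ln_one_bounds) auto
  also have "\<dots> = 1" by (simp flip: power_mult_distrib exp_add)
  finally show "exp (- MA) ^ n * w n \<le> exp V" by (simp add: w_def mult.left_commute)
qed simp

lemma S_bdd: "bdd_above S"
proof (rule bdd_aboveI)
  fix t assume "t \<in> S"
  then obtain C where t: "0 \<le> t" "\<And>n. t ^ n * w n \<le> C" by (auto simp: S_def)
  show "t \<le> exp MA"
  proof (rule ccontr)
    assume "\<not> t \<le> exp MA"
    then have q: "1 < t * exp (- MA)" by (simp add: exp_minus field_simps)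
    obtain n where n: "C < (t * exp (- MA)) ^ n" using real_arch_pow[OF q] by blast
    have "exp (- MA) ^ n \<le> w n" using Ln_one_bounds(1)[of "\<lambda>_. 0" n] u_le_w[of n] by (simp add: u_def)
    then have "(t * exp (- MA)) ^ n \<le> t ^ n * w n"
      unfolding power_mult_distrib using t(1) by (intro mult_left_mono) auto
    with t(2)[of n] n show False by linarith
  qed
qed

lemma ts_pos: "0 < ts"
  using cSup_upper[OF exp_MA_S S_bdd] unfolding ts_def by (meson exp_gt_zero less_le_trans)

text \<open>If a term at the radius were below 1, submultiplicativity would keep
  \<open>t ^ k * w k\<close> bounded for the larger number \<open>t\<close> with
  \<open>t ^ n = 1 / w n\<close>, against the choice of \<open>ts\<close> as a supremum. So the
  terms at \<open>ts\<close> do not decay, which forces divergence there.\<close>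

lemma w_ts_ge: "1 \<le> w n * ts ^ n"
proof (rule ccontr)
  assume "\<not> 1 \<le> w n * ts ^ n"
  then have lt: "w n * ts ^ n < 1" by simp
  have "1 \<le> w 0" using V_nonneg by (simp add: w_def u_def)
  with lt have n: "0 < n" by (cases n) auto
  define t where "t = root n (1 / w n)"
  have tn: "t ^ n = 1 / w n" unfolding t_def using n w_pos[of n] by (intro real_root_pow_pos2) auto
  have t0: "0 \<le> t" using w_pos[of n] n by (simp add: t_def less_imp_le)
  define C where "C = Max ((\<lambda>k. t ^ k * w k) ` {..<n})"
  have "t ^ k * w k \<le> C" for k
  proof (induction k rule: less_induct)
    case (less k)
    show ?case
    proof (cases "k < n")
      case True
      then show ?thesis unfolding C_def by (intro Max_ge) auto
    next
      case False
      have "t ^ k * w k \<le> t ^ k * (w n * w (k - n))"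
        using w_submult[of n "k - n"] False t0 by (intro mult_left_mono) auto
      also have "\<dots> = (t ^ n * w n) * (t ^ (k - n) * w (k - n))"
        using False by (simp add: mult_ac flip: power_add)
      also have "t ^ n * w n = 1" using tn w_pos[of n] by simp
      finally show ?thesis using less[of "k - n"] False n by simp
    qed
  qed
  with t0 have "t \<in> S" by (auto simp: S_def)
  then have "t \<le> ts" unfolding ts_def by (rule cSup_upper[OF _ S_bdd])
  then have "t ^ n \<le> ts ^ n" using t0 by (intro power_mono)
  then have "1 \<le> w n * ts ^ n" unfolding tn using w_pos[of n] by (simp add: divide_le_eq mult.commute)
  with lt show False by simp
qed

lemma summable_below_ts:
  assumes t: "0 \<le> t" "t < ts"
  shows "summable (\<lambda>n. t ^ n * w n)"
proof -
  obtain t' where t': "t' \<in> S" "t < t'" using t exp_MA_S less_cSup_iff[OF _ S_bdd, of t] unfolding ts_def by blast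
  then obtain C where C: "\<And>n. t' ^ n * w n \<le> C" by (auto simp: S_def)
  have t'0: "0 < t'" using t t' by linarith
  have sm: "summable (\<lambda>n. C * (t / t') ^ n)" using t t' t'0 by (intro summable_mult summable_geometric) auto
  show ?thesis
  proof (rule summable_comparison_test'[OF sm, of 0])
    fix n
    have "t ^ n * w n = (t / t') ^ n * (t' ^ n * w n)" using t'0 by (simp add: power_divide)
    also have "\<dots> \<le> (t / t') ^ n * C" using t t'0 C by (intro mult_left_mono) auto
    finally show "norm (t ^ n * w n) \<le> C * (t / t') ^ n" using t w_pos[of n] by (simp add: mult.commute)
  qed
qed

text \<open>As \<open>t\<close> increases to the radius of convergence \<open>ts\<close>, the normalised resolvents applied to
  \<open>1\<close> become almost invariant, and they are equicontinuous.\<close>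

definition "tj j = ts * (real j + 1) / (real j + 2)"

definition "\<Psi> j x = (\<Sum>n. tj j ^ n * (L ^^ n) (\<lambda>_. 1) x)"

definition "G j = \<Psi> j (\<lambda>_. 0)"

definition "h j x = \<Psi> j x / G j"

lemma tj: "0 < tj j" "tj j < ts"
  using ts_pos by (auto simp: tj_def divide_less_eq)

lemma tj_tendsto: "tj \<longlonglongrightarrow> ts"
proof -
  have "(\<lambda>j. ts * ((real j + 1) / (real j + 2))) \<longlonglongrightarrow> ts * 1"
    by (intro tendsto_mult_left) real_asymp
  then show ?thesis by (simp add: tj_def[abs_def])
qed

lemma summable_\<Psi>: "x \<in> X \<Longrightarrow> summable (\<lambda>n. tj j ^ n * (L ^^ n) (\<lambda>_. 1) x)"
  by (rule summable_comparison_test'[OF summable_below_ts[of "tj j"], of 0])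
     (use tj[of j] Ln_one_le_w Ln_one_pos in \<open>auto simp: abs_mult less_imp_le abs_of_pos\<close>)

text \<open>By \<open>w_ts_ge\<close> the terms dominate \<open>exp (- V) * (tj j / ts) ^ n\<close>,
  and \<open>tj\<close> is chosen such that this geometric series has the sum
  \<open>exp (- V) * (j + 2)\<close>.\<close>

lemma G_ge: "exp (- V) * (real j + 2) \<le> G j"
proof -
  have q: "0 < tj j / ts" "tj j / ts < 1" using tj[of j] ts_pos by auto
  have sg: "summable (\<lambda>n. exp (- V) * (tj j / ts) ^ n)" using q by (intro summable_mult summable_geometric) auto
  have "exp (- V) * (tj j / ts) ^ n \<le> tj j ^ n * u n" for n
  proof -
    have "exp (- V) \<le> u n * ts ^ n"
      using mult_left_mono[OF w_ts_ge[of n], of "exp (- V)"] by (simp add: w_def exp_minus field_simps)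
    then have "exp (- V) * (tj j / ts) ^ n \<le> (u n * ts ^ n) * (tj j / ts) ^ n"
      using q by (intro mult_right_mono) auto
    also have "\<dots> = tj j ^ n * u n" using ts_pos by (simp add: power_divide)
    finally show ?thesis .
  qed
  then have "(\<Sum>n. exp (- V) * (tj j / ts) ^ n) \<le> G j"
    unfolding G_def \<Psi>_def u_def by (intro suminf_le sg summable_\<Psi>) auto
  moreover have "(\<Sum>n. exp (- V) * (tj j / ts) ^ n) = exp (- V) * (1 / (1 - tj j / ts))"
    using q by (simp add: suminf_mult summable_geometric suminf_geometric)
  moreover have "1 / (1 - tj j / ts) = real j + 2"
  proof -
    have "tj j / ts = (real j + 1) / (real j + 2)" using ts_pos by (simp add: tj_def)
    then have "1 - tj j / ts = 1 / (real j + 2)" by (simp add: field_simps)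
    then show ?thesis by simp
  qed
  ultimately show ?thesis by simp
qed

lemma G_pos: "0 < G j"
  using G_ge[of j] by (rule less_le_trans[rotated]) simp

lemma inverse_G: "(\<lambda>j. 1 / G j) \<longlonglongrightarrow> 0"
proof (rule Lim_null_comparison)
  show "\<forall>\<^sub>F j in sequentially. norm (1 / G j) \<le> exp V * (1 / (real j + 2))"
  proof (intro always_eventually allI)
    fix j
    have "1 / G j \<le> 1 / (exp (- V) * (real j + 2))" using G_ge[of j] by (intro divide_left_mono mult_pos_pos G_pos) auto
    then show "norm (1 / G j) \<le> exp V * (1 / (real j + 2))" using G_pos[of j] by (simp add: exp_minus field_simps)
  qed
  show "(\<lambda>j. exp V * (1 / (real j + 2))) \<longlonglongrightarrow> 0" by (intro tendsto_mult_right_zero) real_asymp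
qed

lemma \<Psi>_compare: assumes "x \<in> X" "y \<in> X" shows "\<Psi> j x \<le> exp V * \<Psi> j y"
proof -
  have "\<Psi> j x \<le> (\<Sum>n. exp V * (tj j ^ n * (L ^^ n) (\<lambda>_. 1) y))"
    unfolding \<Psi>_def
  proof (intro suminf_le summable_mult summable_\<Psi> assms)
    fix n
    have "tj j ^ n * (L ^^ n) (\<lambda>_. 1) x \<le> tj j ^ n * (exp V * (L ^^ n) (\<lambda>_. 1) y)"
      using one_compare[OF assms] tj[of j] by (intro mult_left_mono) auto
    then show "tj j ^ n * (L ^^ n) (\<lambda>_. 1) x \<le> exp V * (tj j ^ n * (L ^^ n) (\<lambda>_. 1) y)" by (simp add: mult_ac)
  qed
  then show ?thesis unfolding \<Psi>_def by (simp add: suminf_mult summable_\<Psi> assms)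
qed

lemma h_le: "x \<in> X \<Longrightarrow> h j x \<le> exp V" and h_ge: "x \<in> X \<Longrightarrow> exp (- V) \<le> h j x"
  using \<Psi>_compare[of x "\<lambda>_. 0" j] \<Psi>_compare[of "\<lambda>_. 0" x j] G_pos[of j]
  by (simp_all add: h_def G_def[symmetric] divide_le_eq le_divide_eq exp_minus field_simps)

text \<open>The Hoelder constant of the \<open>n\<close>-th iterate of 1 is at most
  \<open>QA * w n\<close>, and \<open>w n = exp V * u n\<close> sums back to
  \<open>exp V * G j\<close>; division by \<open>G j\<close> leaves a constant independent of
  \<open>j\<close>.\<close>

lemma h_Lip: assumes xy: "x \<in> X" "y \<in> X" shows "\<bar>h j x - h j y\<bar> \<le> QA * exp V * D x y"
proof -
  have sw: "summable (\<lambda>n. QA * D x y * (tj j ^ n * w n))"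
    using tj[of j] by (intro summable_mult summable_below_ts) auto
  have sd: "summable (\<lambda>n. tj j ^ n * (L ^^ n) (\<lambda>_. 1) x - tj j ^ n * (L ^^ n) (\<lambda>_. 1) y)"
    by (intro summable_diff summable_\<Psi> xy)
  have "norm (\<Psi> j x - \<Psi> j y) \<le> (\<Sum>n. QA * D x y * (tj j ^ n * w n))"
    unfolding \<Psi>_def suminf_diff[OF summable_\<Psi> summable_\<Psi>, OF xy]
  proof (rule norm_suminf_le[OF _ sw])
    fix n
    have "\<bar>(L ^^ n) (\<lambda>_. 1) x - (L ^^ n) (\<lambda>_. 1) y\<bar> \<le> QA * 1 * w n * D x y"
      by (rule Ln_Lip_bound) (use xy Ln_one_le_w in auto)
    then have "tj j ^ n * \<bar>(L ^^ n) (\<lambda>_. 1) x - (L ^^ n) (\<lambda>_. 1) y\<bar> \<le> tj j ^ n * (QA * 1 * w n * D x y)"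
      using tj[of j] by (intro mult_left_mono) auto
    then show "norm (tj j ^ n * (L ^^ n) (\<lambda>_. 1) x - tj j ^ n * (L ^^ n) (\<lambda>_. 1) y) \<le> QA * D x y * (tj j ^ n * w n)"
      using tj[of j] by (simp add: abs_mult mult_ac flip: right_diff_distrib)
  qed
  also have "\<dots> = QA * D x y * (exp V * (\<Sum>n. tj j ^ n * u n))"
    unfolding w_def mult.left_commute[of _ "exp V"] u_def
    by (simp only: suminf_mult summable_mult summable_\<Psi> zero_mem)
  also have "\<dots> = QA * exp V * D x y * G j" by (simp add: G_def \<Psi>_def u_def mult_ac)
  finally show ?thesis using G_pos[of j] by (simp add: h_def divide_le_eq flip: diff_divide_distrib)
qed

lemma h_mem: "h j \<in> Lip"
proof (rule LipI)
  fix x assume "x \<in> X"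
  then show "norm (h j x) \<le> exp V"
    using h_le[of x j] h_ge[of x j] exp_gt_zero[of "- V"] unfolding real_norm_def abs_le_iff by linarith
qed (use h_Lip in simp)

text \<open>Applying \<open>tj j * L\<close> shifts the series by one place and loses only its first
  term 1, which becomes \<open>1 / G j\<close> after normalisation.\<close>

lemma L_h: assumes x: "x \<in> X" shows "L (h j) x = (h j x - 1 / G j) / tj j"
proof -
  let ?f = "\<lambda>n y. tj j ^ n * (L ^^ n) (\<lambda>_. 1) y"
  have Lf: "L (?f n) x = (1 / tj j) * ?f (Suc n) x" for n
    using tj[of j] by (simp add: L_scale)
  have "L (\<Psi> j) x = (\<Sum>n. L (?f n) x)"
    unfolding \<Psi>_def[abs_def]
  proof (rule L_suminf(1)[OF _ _ summable_below_ts[of "tj j"] x])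
    show "?f n \<in> borel_measurable \<B>" for n by (rule bm_measurable) (intro bm_mult bm_const Ln_bm)
    show "norm (?f n y) \<le> tj j ^ n * w n" if "y \<in> X" for n y
      using that tj[of j] Ln_one_le_w[OF that, of n] Ln_one_pos[OF that, of n] by (simp add: abs_mult)
  qed (use tj[of j] in auto)
  also have "\<dots> = (1 / tj j) * (\<Sum>n. ?f (Suc n) x)"
    unfolding Lf by (rule suminf_mult) (subst summable_Suc_iff, rule summable_\<Psi>[OF x])
  also have "(\<Sum>n. ?f (Suc n) x) = \<Psi> j x - 1"
    unfolding \<Psi>_def using suminf_split_head[OF summable_\<Psi>[OF x, of j]] by simp
  finally have "L (\<Psi> j) x = (\<Psi> j x - 1) / tj j" by simp
  moreover have "h j = (\<lambda>y. 1 / G j * \<Psi> j y)" by (simp add: h_def fun_eq_iff)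
  then have "L (h j) x = 1 / G j * L (\<Psi> j) x" by (simp only: L_scale)
  ultimately show ?thesis using G_pos[of j] by (simp add: h_def diff_divide_distrib right_diff_distrib mult.commute)
qed

text \<open>A diagonal subsequence converges on the countable dense set \<open>rat_seqs\<close>, the
  common Hoelder constant extends the convergence to \<open>X\<close>, and \<open>L_tendsto\<close>
  passes the approximate eigenvalue equation \<open>L_h\<close> to the limit. The eigenvalue is
  \<open>1 / ts\<close>.\<close>

lemma eigenfunction_exists: "\<exists>lam \<psi>. positive_eigendata X N \<alpha> m a A lam \<psi>"
proof -
  have hb: "norm (h j x) \<le> exp V" if "x \<in> X" for j x
    using h_le[OF that, of j] h_ge[OF that, of j] exp_gt_zero[of "- V"] unfolding real_norm_def abs_le_iff by linarith
  obtain k where k: "strict_mono (k :: nat \<Rightarrow> nat)" "\<And>q. q \<in> rat_seqs \<Longrightarrow> \<exists>l. (\<lambda>j. h (k j) q) \<longlonglongrightarrow> l"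
    by (rule function_convergent_subsequence[OF countable_rat_seqs, of h "exp V"]) (use hb rat_seqs_subset in blast)+
  let ?C = "QA * exp V"
  have C0: "0 < ?C" and Q0: "QA \<noteq> 0" using QA_ge by auto
  have conv: "\<exists>l. (\<lambda>j. h (k j) x) \<longlonglongrightarrow> l" if x: "x \<in> X" for x
  proof -
    have "Cauchy (\<lambda>j. h (k j) x)"
    proof (rule metric_CauchyI)
      fix e :: real assume e: "0 < e"
      \<comment> \<open>Chosen such that \<open>?C * r powr \<alpha> = e / 3\<close>.\<close>
      define r where "r = (e / (3 * ?C)) powr (1 / \<alpha>)"
      have r: "0 < r" using e C0 Q0 by (simp add: r_def)
      obtain q where q: "q \<in> rat_seqs" "N (\<lambda>i. x i - q i) < r" using rat_seqs_dense[OF x r] by blast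
      have qX: "q \<in> X" using q rat_seqs_subset by blast
      have "D x q < r powr \<alpha>" using q \<alpha>_pos by (intro powr_less_mono2) auto
      also have "\<dots> = e / (3 * ?C)" using \<alpha>_pos e C0 Q0 by (simp add: r_def powr_powr)
      finally have "?C * D x q < ?C * (e / (3 * ?C))" using C0 by (rule mult_strict_left_mono)
      also have "\<dots> = e / 3" using Q0 by simp
      finally have "?C * D x q < e / 3" .
      then have near: "\<bar>h j x - h j q\<bar> < e / 3" for j using h_Lip[OF x qX, of j] by linarith
      have "Cauchy (\<lambda>j. h (k j) q)" using k(2)[OF q(1)] LIMSEQ_imp_Cauchy by blast
      then obtain M where M: "\<And>i j. i \<ge> M \<Longrightarrow> j \<ge> M \<Longrightarrow> dist (h (k i) q) (h (k j) q) < e / 3"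
        using e metric_CauchyD[of "\<lambda>j. h (k j) q" "e/3"] by auto
      have "dist (h (k i) x) (h (k j) x) < e" if "i \<ge> M" "j \<ge> M" for i j
        using M[OF that] near[of "k i"] near[of "k j"] unfolding dist_real_def by linarith
      then show "\<exists>M. \<forall>i\<ge>M. \<forall>j\<ge>M. dist (h (k i) x) (h (k j) x) < e" by blast
    qed
    then show ?thesis using Cauchy_convergent_iff convergent_def by blast
  qed
  define \<psi> where "\<psi> x = lim (\<lambda>j. h (k j) x)" for x
  have lim: "(\<lambda>j. h (k j) x) \<longlonglongrightarrow> \<psi> x" if "x \<in> X" for x
    using conv[OF that] unfolding \<psi>_def by (simp add: convergent_LIMSEQ_iff[symmetric] convergent_def)
  have le: "\<psi> x \<le> exp V" and ge: "exp (- V) \<le> \<psi> x" if "x \<in> X" for x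
    by (rule LIMSEQ_le_const2[OF lim[OF that]], use h_le[OF that] in blast)
       (rule LIMSEQ_le_const[OF lim[OF that]], use h_ge[OF that] in blast)
  have lip: "\<bar>\<psi> x - \<psi> y\<bar> \<le> ?C * D x y" if xy: "x \<in> X" "y \<in> X" for x y
    by (rule LIMSEQ_le_const2[OF tendsto_rabs[OF tendsto_diff[OF lim[OF xy(1)] lim[OF xy(2)]]]])
       (use h_Lip[OF xy] in blast)
  have mem: "\<psi> \<in> Lip"
  proof (rule LipI)
    fix x assume "x \<in> X"
    then show "norm (\<psi> x) \<le> exp V"
      using le[of x] ge[of x] exp_gt_zero[of "- V"] unfolding real_norm_def abs_le_iff by linarith
  qed (use lip in simp)
  have inf: "0 < (INF x\<in>X. \<psi> x)"
  proof -
    have "X \<noteq> {}" using zero_mem by blast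
    then have "exp (- V) \<le> (INF x\<in>X. \<psi> x)" using ge by (intro cINF_greatest) auto
    then show ?thesis by (meson exp_gt_zero less_le_trans)
  qed
  have eig: "L \<psi> x = (1 / ts) * \<psi> x" if x: "x \<in> X" for x
  proof (rule LIMSEQ_unique)
    show "(\<lambda>j. L (h (k j)) x) \<longlonglongrightarrow> L \<psi> x"
      by (rule L_tendsto[OF Lip_bm[OF h_mem] _ lim x]) (use hb in auto)
    have kk: "filterlim k at_top sequentially" using k(1) by (rule filterlim_subseq)
    have "(\<lambda>j. (h (k j) x - 1 / G (k j)) / tj (k j)) \<longlonglongrightarrow> (\<psi> x - 0) / ts"
      using ts_pos by (intro tendsto_intros lim[OF x] filterlim_compose[OF inverse_G kk] filterlim_compose[OF tj_tendsto kk]) auto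
    then show "(\<lambda>j. L (h (k j)) x) \<longlonglongrightarrow> (1 / ts) * \<psi> x" by (simp add: L_h[OF x])
  qed
  show ?thesis
    by (rule exI[of _ "1 / ts"], rule exI[of _ \<psi>]) (use ts_pos mem inf eig in \<open>auto simp: positive_eigendata_def\<close>)
qed

end

text \<open>The eigendata are arbitrary, not the pair just constructed, because the statements about
  the normalized potential quantify over all such pairs.\<close>

locale ruelle_eigen = ruelle_space +
  fixes lam :: real and \<psi> :: "(nat \<Rightarrow> real) \<Rightarrow> real"
  assumes eig: "positive_eigendata X N \<alpha> m a A lam \<psi>"
begin

definition "low = (INF x\<in>X. \<psi> x)"

definition "up = Lip_norm \<psi>"

lemma lam_pos: "0 < lam" and \<psi>_Lip: "\<psi> \<in> Lip" and low_pos: "0 < low"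
  and L_\<psi>: "x \<in> X \<Longrightarrow> L \<psi> x = lam * \<psi> x"
  using eig by (auto simp: positive_eigendata_def low_def)

lemma \<psi>_bm: "\<psi> \<in> bm"
  by (rule Lip_bm[OF \<psi>_Lip])

lemma \<psi>_le: "x \<in> X \<Longrightarrow> \<psi> x \<le> up"
  and \<psi>_diff: "\<lbrakk>x \<in> X; y \<in> X\<rbrakk> \<Longrightarrow> \<bar>\<psi> x - \<psi> y\<bar> \<le> up * D x y"
  and up_nonneg: "0 \<le> up"
  using Lip_norm_bounds[OF \<psi>_Lip] by (auto simp: up_def abs_le_iff)

lemma \<psi>_ge: "x \<in> X \<Longrightarrow> low \<le> \<psi> x"
  unfolding low_def
proof (rule cINF_lower)
  show "bdd_below (\<psi> ` X)"
  proof (rule bdd_belowI2)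
    fix x assume "x \<in> X"
    then show "- up \<le> \<psi> x"
      using Lip_norm_bounds(1)[OF \<psi>_Lip, of x] unfolding up_def real_norm_def by linarith
  qed
qed

lemma \<psi>_pos: "x \<in> X \<Longrightarrow> 0 < \<psi> x"
  using \<psi>_ge low_pos by fastforce

lemma Ln_\<psi>: "x \<in> X \<Longrightarrow> (L ^^ n) \<psi> x = lam ^ n * \<psi> x"
proof (induction n arbitrary: x)
  case (Suc n)
  have "(L ^^ Suc n) \<psi> x = L (\<lambda>y. lam ^ n * \<psi> y) x" using Suc by (auto intro: ruelle_cong)
  then show ?case using Suc.prems by (simp add: L_scale L_\<psi>)
qed simp

definition "CE = up / low"

lemma CE_nonneg: "0 \<le> CE"
  using up_nonneg low_pos by (simp add: CE_def)

text \<open>From \<open>1 \<le> \<psi> / low\<close> and \<open>\<psi> \<le> up\<close>: up to the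
  factor \<open>CE\<close> the iterates of 1 grow no faster than those of the eigenfunction.\<close>

lemma Ln_one_le: assumes x: "x \<in> X" shows "(L ^^ n) (\<lambda>_. 1) x \<le> CE * lam ^ n"
proof -
  have "(L ^^ n) (\<lambda>_. 1) x \<le> (L ^^ n) (\<lambda>y. (1 / low) * \<psi> y) x"
    using \<psi>_ge low_pos by (intro Ln_mono bm_mult bm_const \<psi>_bm x) (auto simp: le_divide_eq)
  also have "\<dots> = (1 / low) * (lam ^ n * \<psi> x)" by (simp only: Ln_scale[OF x] Ln_\<psi>[OF x])
  also have "\<dots> \<le> (1 / low) * (lam ^ n * up)"
    using \<psi>_le[OF x] lam_pos low_pos by (intro mult_left_mono) auto
  finally show ?thesis by (simp add: CE_def mult_ac)
qed

section \<open>The spectral radius\<close>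

abbreviation LC :: "((nat \<Rightarrow> real) \<Rightarrow> complex) \<Rightarrow> (nat \<Rightarrow> real) \<Rightarrow> complex" where
  "LC \<equiv> ruelle m a A"

definition bmC :: "((nat \<Rightarrow> real) \<Rightarrow> complex) set" where
  "bmC = {\<phi>. (\<lambda>x. Re (\<phi> x)) \<in> bm \<and> (\<lambda>x. Im (\<phi> x)) \<in> bm}"

lemma bmC_measurable: "\<phi> \<in> bmC \<Longrightarrow> \<phi> \<in> borel_measurable \<B>"
  unfolding bmC_def by (subst borel_measurable_complex_iff) (auto intro: bm_measurable)

lemma LC_integrable: assumes "\<phi> \<in> bmC" "x \<in> X"
  shows "integrable m (\<lambda>r. exp (A (br r x)) *\<^sub>R \<phi> (br r x))"
proof -
  have "integrable m (\<lambda>r. of_real (exp (A (br r x)) * Re (\<phi> (br r x))) + \<i> * of_real (exp (A (br r x)) * Im (\<phi> (br r x))))"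
    using assms by (intro Bochner_Integration.integrable_add integrable_mult_right integrable_of_real L_integrable[of "\<lambda>y. Re (\<phi> y)"] L_integrable[of "\<lambda>y. Im (\<phi> y)"]) (auto simp: bmC_def)
  also have "(\<lambda>r. of_real (exp (A (br r x)) * Re (\<phi> (br r x))) + \<i> * of_real (exp (A (br r x)) * Im (\<phi> (br r x)))) = (\<lambda>r. exp (A (br r x)) *\<^sub>R \<phi> (br r x))"
    by (simp add: fun_eq_iff complex_eq_iff)
  finally show ?thesis .
qed

lemma LC_Re_Im: assumes "\<phi> \<in> bmC" "x \<in> X"
  shows "Re (LC \<phi> x) = L (\<lambda>y. Re (\<phi> y)) x" "Im (LC \<phi> x) = L (\<lambda>y. Im (\<phi> y)) x"
  unfolding ruelle_def using LC_integrable[OF assms] by (simp_all flip: integral_Re integral_Im)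

lemma bm_cong: "\<lbrakk>\<phi> \<in> bm; \<And>x. x \<in> X \<Longrightarrow> \<phi> x = \<eta> x\<rbrakk> \<Longrightarrow> \<eta> \<in> bm"
  unfolding bm_def using measurable_cong[of \<B> \<phi> \<eta> borel] by (simp cong: image_cong_simp)

lemma LC_bmC: "\<phi> \<in> bmC \<Longrightarrow> LC \<phi> \<in> bmC"
  using LC_Re_Im[of \<phi>] unfolding bmC_def
  by (auto intro: bm_cong[OF L_bm[of "\<lambda>y. Re (\<phi> y)"]] bm_cong[OF L_bm[of "\<lambda>y. Im (\<phi> y)"]])

lemma LCn_bmC: "\<phi> \<in> bmC \<Longrightarrow> (LC ^^ n) \<phi> \<in> bmC"
  by (induction n) (auto intro: LC_bmC)

lemma LCn_Re_Im: assumes \<phi>: "\<phi> \<in> bmC"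
  shows "x \<in> X \<Longrightarrow> Re ((LC ^^ n) \<phi> x) = (L ^^ n) (\<lambda>y. Re (\<phi> y)) x"
    "x \<in> X \<Longrightarrow> Im ((LC ^^ n) \<phi> x) = (L ^^ n) (\<lambda>y. Im (\<phi> y)) x"
proof (induction n arbitrary: x)
  case (Suc n)
  { case 1 then show ?case using Suc.IH(1) by (simp add: LC_Re_Im[OF LCn_bmC[OF \<phi>]]) (rule ruelle_cong, auto)
  next
    case 2 then show ?case using Suc.IH(2) by (simp add: LC_Re_Im[OF LCn_bmC[OF \<phi>]]) (rule ruelle_cong, auto) }
qed auto

lemma Lip_Re_Im: assumes "\<phi> \<in> Lip"
  shows "(\<lambda>x. Re (\<phi> x)) \<in> Lip" "(\<lambda>x. Im (\<phi> x)) \<in> Lip" "\<phi> \<in> bmC"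
proof -
  show *: "(\<lambda>x. Re (\<phi> x)) \<in> Lip" "(\<lambda>x. Im (\<phi> x)) \<in> Lip"
    by (rule LipI[of _ "Lip_norm \<phi>" "Lip_norm \<phi>"],
        use Lip_norm_bounds[OF assms] in \<open>auto simp flip: minus_complex.sel intro: order_trans[OF abs_Re_le_cmod] order_trans[OF abs_Im_le_cmod]\<close>)+
  then show "\<phi> \<in> bmC" by (simp add: bmC_def Lip_bm)
qed

definition "QC = 2 * QA * CE"

text \<open>The real estimates apply to the real and the imaginary part, whence the factor 2 in
  \<open>QC\<close>. The sup bound alone would give \<open>2 * CE\<close>; it is enlarged by
  \<open>QA\<close> so that both bounds share one constant.\<close>

lemma LCn_bounds:
  assumes \<phi>: "\<phi> \<in> Lip"
  shows "x \<in> X \<Longrightarrow> norm ((LC ^^ n) \<phi> x) \<le> QC * Lip_norm \<phi> * lam ^ n"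
    and "\<lbrakk>x \<in> X; y \<in> X\<rbrakk> \<Longrightarrow> norm ((LC ^^ n) \<phi> x - (LC ^^ n) \<phi> y) \<le> QC * Lip_norm \<phi> * lam ^ n * D x y"
proof -
  let ?C = "Lip_norm \<phi>"
  note C = Lip_norm_bounds[OF \<phi>] and RI = LCn_Re_Im[OF Lip_Re_Im(3)[OF \<phi>]]
  have Re: "\<bar>Re (\<phi> x)\<bar> \<le> ?C" "\<bar>Im (\<phi> x)\<bar> \<le> ?C" if "x \<in> X" for x
    using C(1)[OF that] abs_Re_le_cmod[of "\<phi> x"] abs_Im_le_cmod[of "\<phi> x"] by linarith+
  have Red: "\<bar>Re (\<phi> x) - Re (\<phi> y)\<bar> \<le> ?C * D x y" "\<bar>Im (\<phi> x) - Im (\<phi> y)\<bar> \<le> ?C * D x y" if "x \<in> X" "y \<in> X" for x y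
    using C(2)[OF that] abs_Re_le_cmod[of "\<phi> x - \<phi> y"] abs_Im_le_cmod[of "\<phi> x - \<phi> y"] by simp_all
  show "norm ((LC ^^ n) \<phi> x) \<le> QC * ?C * lam ^ n" if x: "x \<in> X"
  proof -
    have "cmod ((LC ^^ n) \<phi> x) \<le> \<bar>Re ((LC ^^ n) \<phi> x)\<bar> + \<bar>Im ((LC ^^ n) \<phi> x)\<bar>" by (rule cmod_le)
    also have "\<dots> \<le> ?C * (L ^^ n) (\<lambda>_. 1) x + ?C * (L ^^ n) (\<lambda>_. 1) x"
      unfolding RI[OF x] using \<phi> Re x by (intro add_mono Ln_abs_le Lip_bm Lip_Re_Im) auto
    also have "\<dots> \<le> 2 * ?C * (CE * lam ^ n)"
      using mult_left_mono[OF Ln_one_le[OF x, of n] C(3)] by simp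
    also have "\<dots> \<le> QA * (2 * ?C * (CE * lam ^ n))"
      using QA_ge C(3) CE_nonneg lam_pos by (intro mult_right_mono[of 1 QA, simplified]) auto
    finally show ?thesis by (simp add: QC_def mult_ac)
  qed
  assume xy: "x \<in> X" "y \<in> X"
  have "cmod ((LC ^^ n) \<phi> x - (LC ^^ n) \<phi> y) \<le> \<bar>Re ((LC ^^ n) \<phi> x - (LC ^^ n) \<phi> y)\<bar> + \<bar>Im ((LC ^^ n) \<phi> x - (LC ^^ n) \<phi> y)\<bar>"
    by (rule cmod_le)
  also have "\<dots> \<le> QA * ?C * (CE * lam ^ n) * D x y + QA * ?C * (CE * lam ^ n) * D x y"
    unfolding minus_complex.sel RI[OF xy(1)] RI[OF xy(2)]
    using Re Red xy C(3) Ln_one_le by (intro add_mono Ln_Lip_bound) auto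
  finally show "norm ((LC ^^ n) \<phi> x - (LC ^^ n) \<phi> y) \<le> QC * ?C * lam ^ n * D x y"
    by (simp add: QC_def mult_ac)
qed

lemma LC_scale: "LC (\<lambda>y. t * \<phi> y) x = t * LC \<phi> x"
proof -
  have "(\<lambda>r. exp (A (br r x)) *\<^sub>R (t * \<phi> (br r x))) = (\<lambda>r. t * (exp (A (br r x)) *\<^sub>R \<phi> (br r x)))"
    by (simp add: fun_eq_iff)
  then show ?thesis unfolding ruelle_def by (simp only: integral_mult_right_zero)
qed

lemma LC_diff: "\<lbrakk>\<phi> \<in> bmC; \<eta> \<in> bmC; x \<in> X\<rbrakk> \<Longrightarrow> LC (\<lambda>y. \<phi> y - \<eta> y) x = LC \<phi> x - LC \<eta> x"
  unfolding ruelle_def using LC_integrable by (simp add: scaleR_diff_right)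

definition resolvent :: "complex \<Rightarrow> ((nat \<Rightarrow> real) \<Rightarrow> complex) \<Rightarrow> (nat \<Rightarrow> real) \<Rightarrow> complex" where
  "resolvent z \<phi> = (\<lambda>x\<in>X. \<Sum>n. inverse z ^ Suc n * (LC ^^ n) \<phi> x)"

context
  fixes z :: complex
  assumes z: "lam < cmod z"
begin

lemma z_nz: "z \<noteq> 0"
  using z lam_pos by auto

definition "neumann_bound n = QC * (lam ^ n / cmod z ^ Suc n)"

lemma summable_bb: "summable neumann_bound"
proof -
  have "summable (\<lambda>n. QC / cmod z * (lam / cmod z) ^ n)"
    using z lam_pos by (intro summable_mult summable_geometric) (auto simp: divide_less_eq)
  also have "(\<lambda>n. QC / cmod z * (lam / cmod z) ^ n) = neumann_bound" by (simp add: neumann_bound_def fun_eq_iff power_divide)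
  finally show ?thesis .
qed

lemma term_bounds:
  assumes \<phi>: "\<phi> \<in> Lip"
  shows "x \<in> X \<Longrightarrow> norm (inverse z ^ Suc n * (LC ^^ n) \<phi> x) \<le> Lip_norm \<phi> * neumann_bound n"
    and "\<lbrakk>x \<in> X; y \<in> X\<rbrakk> \<Longrightarrow> norm (inverse z ^ Suc n * (LC ^^ n) \<phi> x - inverse z ^ Suc n * (LC ^^ n) \<phi> y) \<le> Lip_norm \<phi> * D x y * neumann_bound n"
proof -
  have i: "norm (inverse z ^ Suc n) = 1 / cmod z ^ Suc n" by (simp add: norm_mult norm_power norm_inverse divide_inverse power_inverse)
  show "norm (inverse z ^ Suc n * (LC ^^ n) \<phi> x) \<le> Lip_norm \<phi> * neumann_bound n" if "x \<in> X"
    unfolding norm_mult i neumann_bound_def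
    using mult_left_mono[OF LCn_bounds(1)[OF \<phi> that, of n], of "1 / cmod z ^ Suc n"]
    by (simp add: mult_ac del: power_Suc)
  show "norm (inverse z ^ Suc n * (LC ^^ n) \<phi> x - inverse z ^ Suc n * (LC ^^ n) \<phi> y) \<le> Lip_norm \<phi> * D x y * neumann_bound n" if "x \<in> X" "y \<in> X"
    unfolding right_diff_distrib[symmetric] norm_mult i neumann_bound_def
    using mult_left_mono[OF LCn_bounds(2)[OF \<phi> that, of n], of "1 / cmod z ^ Suc n"]
    by (simp add: mult_ac del: power_Suc)
qed

lemma summable_resolvent: "\<lbrakk>\<phi> \<in> Lip; x \<in> X\<rbrakk> \<Longrightarrow> summable (\<lambda>n. inverse z ^ Suc n * (LC ^^ n) \<phi> x)"
  by (rule summable_comparison_test'[OF summable_mult[OF summable_bb], of 0]) (rule term_bounds)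

lemma resolvent_bounds:
  assumes \<phi>: "\<phi> \<in> Lip"
  shows "x \<in> X \<Longrightarrow> norm (resolvent z \<phi> x) \<le> Lip_norm \<phi> * suminf neumann_bound"
    and "\<lbrakk>x \<in> X; y \<in> X\<rbrakk> \<Longrightarrow> norm (resolvent z \<phi> x - resolvent z \<phi> y) \<le> Lip_norm \<phi> * suminf neumann_bound * D x y"
proof -
  show "norm (resolvent z \<phi> x) \<le> Lip_norm \<phi> * suminf neumann_bound" if x: "x \<in> X"
  proof -
    have "norm (\<Sum>n. inverse z ^ Suc n * (LC ^^ n) \<phi> x) \<le> (\<Sum>n. Lip_norm \<phi> * neumann_bound n)"
      by (rule norm_suminf_le[OF term_bounds(1)[OF \<phi> x] summable_mult[OF summable_bb]])
    then show ?thesis using x by (simp only: resolvent_def restrict_apply' suminf_mult[OF summable_bb])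
  qed
  assume xy: "x \<in> X" "y \<in> X"
  have "norm (\<Sum>n. inverse z ^ Suc n * (LC ^^ n) \<phi> x - inverse z ^ Suc n * (LC ^^ n) \<phi> y) \<le> (\<Sum>n. Lip_norm \<phi> * D x y * neumann_bound n)"
    by (rule norm_suminf_le[OF term_bounds(2)[OF \<phi> xy] summable_mult[OF summable_bb]])
  then show "norm (resolvent z \<phi> x - resolvent z \<phi> y) \<le> Lip_norm \<phi> * suminf neumann_bound * D x y"
    using xy unfolding suminf_mult[OF summable_bb] suminf_diff[OF summable_resolvent[OF \<phi> xy(1)] summable_resolvent[OF \<phi> xy(2)], symmetric]
    by (simp only: resolvent_def restrict_apply' mult.assoc mult.commute[of "D x y"])
qed

lemma resolvent_mem: "\<phi> \<in> Lip \<Longrightarrow> resolvent z \<phi> \<in> lip_bC X (holder_dist N \<alpha>)"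
  using LipI[of "resolvent z \<phi>", OF resolvent_bounds(1)[of \<phi>] resolvent_bounds(2)[of \<phi>]]
  by (simp only: lip_bC_def Int_iff resolvent_def restrict_extensional simp_thms)

lemma shifted_resolvent: assumes \<phi>: "\<phi> \<in> Lip" and x: "x \<in> X"
  shows "z * resolvent z \<phi> x - LC (resolvent z \<phi>) x = \<phi> x"
proof -
  let ?f = "\<lambda>n y. inverse z ^ Suc n * (LC ^^ n) \<phi> y"
  have "LC (resolvent z \<phi>) x = LC (\<lambda>y. \<Sum>n. ?f n y) x"
    by (rule ruelle_cong[OF _ x]) (simp add: resolvent_def)
  also have "\<dots> = (\<Sum>n. LC (?f n) x)"
  proof (rule L_suminf(1)[OF _ _ summable_mult[OF summable_bb] x])
    show "?f n \<in> borel_measurable \<B>" for n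
      using bmC_measurable[OF LCn_bmC[OF Lip_Re_Im(3)[OF \<phi>], of n]] by simp
    show "norm (?f n y) \<le> Lip_norm \<phi> * neumann_bound n" if "y \<in> X" for n y by (rule term_bounds(1)[OF \<phi> that])
  qed
  also have "\<dots> = (\<Sum>n. z * ?f (Suc n) x)"
    by (rule suminf_cong) (use z_nz in \<open>simp add: LC_scale\<close>)
  also have "\<dots> = z * (\<Sum>n. ?f (Suc n) x)"
    by (rule suminf_mult, subst summable_Suc_iff) (rule summable_resolvent[OF \<phi> x])
  also have "(\<Sum>n. ?f (Suc n) x) = (\<Sum>n. ?f n x) - ?f 0 x"
    by (rule suminf_split_head[OF summable_resolvent[OF \<phi> x]])
  finally have "LC (resolvent z \<phi>) x = z * ((\<Sum>n. ?f n x) - ?f 0 x)" .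
  moreover have "resolvent z \<phi> x = (\<Sum>n. ?f n x)" using x by (simp only: resolvent_def restrict_apply')
  moreover have "z * ?f 0 x = \<phi> x" using z_nz by simp
  ultimately show ?thesis by (simp only: right_diff_distrib diff_diff_eq2 add_diff_cancel_left')
qed

text \<open>A kernel element satisfies \<open>(LC ^^ n) \<phi> = z ^ n * \<phi>\<close>, which
  unless it vanishes grows faster than the bound of order \<open>lam ^ n\<close> allows.\<close>

lemma kernel_zero: assumes \<phi>: "\<phi> \<in> Lip" and k: "\<And>x. x \<in> X \<Longrightarrow> z * \<phi> x = LC \<phi> x" and x: "x \<in> X"
  shows "\<phi> x = 0"
proof -
  have LCn: "(LC ^^ n) \<phi> x = z ^ n * \<phi> x" if "x \<in> X" for n x
    using that
  proof (induction n arbitrary: x)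
    case (Suc n)
    have "(LC ^^ Suc n) \<phi> x = LC (\<lambda>y. z ^ n * \<phi> y) x" using Suc by (auto intro: ruelle_cong)
    then show ?case using k[OF Suc.prems] by (simp add: LC_scale)
  qed simp
  have le: "norm (\<phi> x) \<le> QC * Lip_norm \<phi> * (lam / cmod z) ^ n" for n
  proof -
    have "cmod z ^ n * norm (\<phi> x) \<le> QC * Lip_norm \<phi> * lam ^ n"
      using LCn_bounds(1)[OF \<phi> x, of n] by (simp add: LCn[OF x] norm_mult norm_power)
    then show ?thesis using z_nz by (simp add: power_divide le_divide_eq mult.commute)
  qed
  have "(\<lambda>n. QC * Lip_norm \<phi> * (lam / cmod z) ^ n) \<longlonglongrightarrow> 0"
    using z lam_pos by (intro tendsto_mult_right_zero LIMSEQ_power_zero) (auto simp: divide_less_eq)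
  then have "norm (\<phi> x) \<le> 0" by (rule LIMSEQ_le_const) (use le in blast)
  then show ?thesis by simp
qed

lemma not_in_spectrum: "z \<notin> lip_spectrum X (holder_dist N \<alpha>) LC"
proof -
  let ?E = "lip_bC X (holder_dist N \<alpha>)"
  have shifted_mem: "shifted_op X LC z \<phi> \<in> ?E" if "\<phi> \<in> ?E" for \<phi>
  proof -
    from that have \<phi>: "\<phi> \<in> Lip" by (simp add: lip_bC_def)
    have "shifted_op X LC z \<phi> \<in> Lip"
    proof (rule LipI)
      fix x assume x: "x \<in> X"
      show "norm (shifted_op X LC z \<phi> x) \<le> cmod z * Lip_norm \<phi> + QC * Lip_norm \<phi> * lam ^ 1"
        using x norm_triangle_ineq4[of "z * \<phi> x" "LC \<phi> x"] mult_left_mono[OF Lip_norm_bounds(1)[OF \<phi> x], of "cmod z"] LCn_bounds(1)[OF \<phi> x, of 1]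
        by (simp add: shifted_op_def norm_mult)
    next
      fix x y assume xy: "x \<in> X" "y \<in> X"
      have "shifted_op X LC z \<phi> x - shifted_op X LC z \<phi> y = z * (\<phi> x - \<phi> y) - (LC \<phi> x - LC \<phi> y)"
        using xy by (simp add: shifted_op_def algebra_simps)
      then show "norm (shifted_op X LC z \<phi> x - shifted_op X LC z \<phi> y) \<le> (cmod z * Lip_norm \<phi> + QC * Lip_norm \<phi> * lam ^ 1) * D x y"
        using norm_triangle_ineq4[of "z * (\<phi> x - \<phi> y)" "LC \<phi> x - LC \<phi> y"] mult_left_mono[OF Lip_norm_bounds(2)[OF \<phi> xy], of "cmod z"] LCn_bounds(2)[OF \<phi> xy, of 1]
        by (simp add: norm_mult distrib_right mult.assoc)
    qed
    then show ?thesis by (simp add: lip_bC_def shifted_op_def)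
  qed
  have inj: "inj_on (shifted_op X LC z) ?E"
  proof (rule inj_onI)
    fix \<phi> \<eta> assume E: "\<phi> \<in> ?E" "\<eta> \<in> ?E" and eq: "shifted_op X LC z \<phi> = shifted_op X LC z \<eta>"
    then have l: "\<phi> \<in> Lip" "\<eta> \<in> Lip" and ext: "\<phi> \<in> extensional X" "\<eta> \<in> extensional X" by (auto simp: lip_bC_def)
    have d: "(\<lambda>x. \<phi> x - \<eta> x) \<in> Lip"
    proof (rule LipI)
      fix x assume x: "x \<in> X"
      show "norm (\<phi> x - \<eta> x) \<le> Lip_norm \<phi> + Lip_norm \<eta>"
        using norm_triangle_ineq4[of "\<phi> x" "\<eta> x"] Lip_norm_bounds(1)[OF l(1) x] Lip_norm_bounds(1)[OF l(2) x] by linarith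
    next
      fix x y assume xy: "x \<in> X" "y \<in> X"
      have e: "\<phi> x - \<eta> x - (\<phi> y - \<eta> y) = (\<phi> x - \<phi> y) - (\<eta> x - \<eta> y)" by simp
      show "norm (\<phi> x - \<eta> x - (\<phi> y - \<eta> y)) \<le> (Lip_norm \<phi> + Lip_norm \<eta>) * D x y"
        unfolding e distrib_right
        using norm_triangle_ineq4[of "\<phi> x - \<phi> y" "\<eta> x - \<eta> y"] Lip_norm_bounds(2)[OF l(1) xy] Lip_norm_bounds(2)[OF l(2) xy] by linarith
    qed
    have "\<phi> x - \<eta> x = 0" if "x \<in> X" for x
    proof (rule kernel_zero[OF d _ that])
      fix x assume x: "x \<in> X"
      have "z * \<phi> x - LC \<phi> x = z * \<eta> x - LC \<eta> x" using fun_cong[OF eq, of x] x by (simp add: shifted_op_def)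
      then show "z * (\<phi> x - \<eta> x) = LC (\<lambda>x. \<phi> x - \<eta> x) x"
        unfolding LC_diff[OF Lip_Re_Im(3)[OF l(1)] Lip_Re_Im(3)[OF l(2)] x] by (simp add: algebra_simps)
    qed
    then show "\<phi> = \<eta>" using ext by (intro extensionalityI[of _ X]) auto
  qed
  have right: "shifted_op X LC z (resolvent z \<phi>) = \<phi>" if "\<phi> \<in> ?E" for \<phi>
    using that shifted_resolvent[of \<phi>] by (intro extensionalityI[of _ X]) (auto simp: lip_bC_def shifted_op_def)
  have bij: "bij_betw (shifted_op X LC z) ?E ?E"
    unfolding bij_betw_def
  proof (intro conjI inj equalityI subsetI)
    fix \<phi> assume "\<phi> \<in> shifted_op X LC z ` ?E" then show "\<phi> \<in> ?E" using shifted_mem by blast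
  next
    fix \<phi> assume E: "\<phi> \<in> ?E"
    then have "resolvent z \<phi> \<in> ?E" by (intro resolvent_mem) (simp add: lip_bC_def)
    with right[OF E] show "\<phi> \<in> shifted_op X LC z ` ?E" by (metis image_eqI)
  qed
  have "Lip_norm \<phi> \<le> 2 * suminf neumann_bound * Lip_norm (shifted_op X LC z \<phi>)" if E: "\<phi> \<in> ?E" for \<phi>
  proof -
    let ?\<eta> = "shifted_op X LC z \<phi>"
    have \<eta>: "?\<eta> \<in> ?E" "?\<eta> \<in> Lip" using shifted_mem[OF E] by (auto simp: lip_bC_def)
    \<comment> \<open>Injectivity turns the right inverse into a left inverse, so the bounds for the
      resolvent become a norm bound for the inverse operator.\<close>
    have "resolvent z ?\<eta> = \<phi>"
      using inj_onD[OF inj right[OF \<eta>(1)] resolvent_mem[OF \<eta>(2)] E] .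
    then have "Lip_norm \<phi> \<le> Lip_norm ?\<eta> * suminf neumann_bound + Lip_norm ?\<eta> * suminf neumann_bound"
      using resolvent_bounds[OF \<eta>(2)] by (intro Lip_norm_le) auto
    then show ?thesis by (simp add: mult_ac)
  qed
  with bij show ?thesis unfolding lip_spectrum_def by blast
qed

end

text \<open>The restriction of \<open>\<psi>\<close> to \<open>X\<close> is a nonzero element of the
  kernel, so injectivity fails.\<close>

lemma lam_in_spectrum: "complex_of_real lam \<in> lip_spectrum X (holder_dist N \<alpha>) LC"
proof -
  let ?E = "lip_bC X (holder_dist N \<alpha>)" and ?z = "complex_of_real lam"
  define f where "f = (\<lambda>x\<in>X. complex_of_real (\<psi> x))"
  define g where "g = (\<lambda>x\<in>X. 0 :: complex)"
  have "f \<in> Lip" by (rule LipI[of _ up up])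
    (use \<psi>_le \<psi>_pos \<psi>_diff in \<open>auto simp: f_def less_imp_le simp flip: of_real_diff\<close>)
  then have f: "f \<in> ?E" by (simp add: lip_bC_def f_def)
  have "g \<in> Lip" by (rule LipI[of _ 0 0]) (auto simp: g_def)
  then have g: "g \<in> ?E" by (simp add: lip_bC_def g_def)
  have "LC f x = ?z * f x" if x: "x \<in> X" for x
  proof -
    have "LC f x = LC (\<lambda>x. complex_of_real (\<psi> x)) x" by (rule ruelle_cong[OF _ x]) (simp add: f_def)
    also have "\<dots> = complex_of_real (L \<psi> x)"
      unfolding ruelle_def by (simp add: scaleR_conv_of_real flip: of_real_mult integral_complex_of_real)
    finally show ?thesis using x by (simp add: L_\<psi> f_def)
  qed
  then have "shifted_op X LC ?z f = g" by (auto simp: shifted_op_def g_def fun_eq_iff restrict_def)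
  moreover have "LC g x = 0" if x: "x \<in> X" for x
  proof -
    have "LC g x = LC (\<lambda>x. 0 * 0) x" by (rule ruelle_cong[OF _ x]) (simp add: g_def)
    then show ?thesis using LC_scale[of 0 "\<lambda>_. 0" x] by simp
  qed
  then have "shifted_op X LC ?z g = g" by (auto simp: shifted_op_def g_def fun_eq_iff restrict_def)
  moreover have "f (\<lambda>_. 0) \<noteq> g (\<lambda>_. 0)" using \<psi>_pos[OF zero_mem] by (simp add: f_def g_def)
  then have "f \<noteq> g" by metis
  ultimately have "\<not> inj_on (shifted_op X LC ?z) ?E" using f g by (metis inj_onD)
  then show ?thesis unfolding lip_spectrum_def bij_betw_def by blast
qed

lemma spectral_radius: "lip_spectral_radius X (holder_dist N \<alpha>) LC = ereal lam"
  unfolding lip_spectral_radius_def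
proof (rule antisym)
  show "(SUP z\<in>lip_spectrum X (holder_dist N \<alpha>) LC. ereal (cmod z)) \<le> ereal lam"
    using not_in_spectrum by (intro SUP_least) (auto simp: not_less[symmetric])
  show "ereal lam \<le> (SUP z\<in>lip_spectrum X (holder_dist N \<alpha>) LC. ereal (cmod z))"
    using lam_pos by (intro SUP_upper2[OF lam_in_spectrum]) simp
qed

section \<open>The normalized potential\<close>

abbreviation "A' \<equiv> normalized_potential a A lam \<psi>"

text \<open>At \<open>br r x\<close> the term with the shift has the value \<open>\<psi> x\<close>,
  which is independent of \<open>r\<close>. The operator of the normalized potential is therefore
  \<open>L\<close> conjugated by \<open>\<psi>\<close> and divided by \<open>lam\<close>.\<close>

lemma exp_normalized: assumes x: "x \<in> X" shows "exp (A' (br r x)) = exp (A (br r x)) * \<psi> (br r x) / (lam * \<psi> x)"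
  using \<psi>_pos[OF br_mem[OF x, of r]] \<psi>_pos[OF x] lam_pos
  by (simp add: normalized_potential_def exp_add exp_diff)

lemma normalized: assumes x: "x \<in> X" shows "ruelle m a A' (\<lambda>_. 1 :: real) x = 1"
proof -
  have "ruelle m a A' (\<lambda>_. 1 :: real) x = (\<integral>r. exp (A (br r x)) * \<psi> (br r x) / (lam * \<psi> x) \<partial>m)"
    by (simp add: ruelle_def exp_normalized[OF x])
  also have "\<dots> = L \<psi> x / (lam * \<psi> x)" by (simp add: L_eq)
  finally show ?thesis using L_\<psi>[OF x] lam_pos \<psi>_pos[OF x] by simp
qed

lemma ln_\<psi>_diff: assumes "x \<in> X" "y \<in> X" shows "\<bar>ln (\<psi> x) - ln (\<psi> y)\<bar> \<le> up / low * D x y"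
proof -
  have one: "ln (\<psi> x) - ln (\<psi> y) \<le> up / low * D x y" if "x \<in> X" "y \<in> X" for x y
  proof -
    have "ln (\<psi> x) - ln (\<psi> y) \<le> (\<psi> x - \<psi> y) / \<psi> y"
      using ln_diff_le[OF \<psi>_pos \<psi>_pos] that by blast
    also have "\<dots> \<le> up * D x y / \<psi> y"
      using \<psi>_diff[OF that] \<psi>_pos[OF that(2)] by (intro divide_right_mono) auto
    also have "\<dots> \<le> up * D x y / low"
      using \<psi>_ge[OF that(2)] low_pos \<psi>_pos[OF that(2)] up_nonneg by (intro divide_left_mono mult_nonneg_nonneg mult_pos_pos) auto
    finally show ?thesis by simp
  qed
  from one[OF assms] one[OF assms(2,1)] show ?thesis by (simp add: D_commute[of y x] abs_le_iff)
qed

text \<open>The logarithm is Lipschitz on values at least \<open>low\<close>, and \<open>sh\<close>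
  is linear with norm at most \<open>c'\<close>, so composition with the shift keeps Hoelder
  continuity.\<close>

lemma normalized_Lip: "A' \<in> Lip"
proof -
  define M where "M = max \<bar>ln low\<bar> \<bar>ln up\<bar>"
  have lnb: "\<bar>ln (\<psi> x)\<bar> \<le> M" if "x \<in> X" for x
  proof -
    have "ln low \<le> ln (\<psi> x)" "ln (\<psi> x) \<le> ln up"
      using \<psi>_ge[OF that] \<psi>_le[OF that] \<psi>_pos[OF that] low_pos by auto
    then show ?thesis unfolding M_def by linarith
  qed
  have c': "0 < c'" using a_pos[of 0] a_bounds(2)[of 0] by linarith
  show ?thesis
  proof (rule LipI)
    fix x assume x: "x \<in> X"
    show "norm (A' x) \<le> MA + 2 * M + \<bar>ln lam\<bar>"
      using A_le[OF x] lnb[OF x] lnb[OF sh_mem[OF x]] by (simp add: normalized_potential_def)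
  next
    fix x y assume xy: "x \<in> X" "y \<in> X"
    have "(\<lambda>i. sh x i - sh y i) = sh (\<lambda>i. x i - y i)" by (simp add: weighted_shift_def fun_eq_iff right_diff_distrib)
    then have "N (\<lambda>i. sh x i - sh y i) \<le> c' * N (\<lambda>i. x i - y i)" using N_sh[OF diff_mem[OF xy]] by simp
    then have "D (sh x) (sh y) \<le> (c' * N (\<lambda>i. x i - y i)) powr \<alpha>" using \<alpha>_pos by (intro powr_mono2) auto
    also have "\<dots> = c' powr \<alpha> * D x y" using c' by (simp add: powr_mult)
    finally have "up / low * D (sh x) (sh y) \<le> up / low * (c' powr \<alpha> * D x y)"
      using up_nonneg low_pos by (intro mult_left_mono) auto
    then have "\<bar>ln (\<psi> (sh x)) - ln (\<psi> (sh y))\<bar> \<le> up / low * (c' powr \<alpha> * D x y)"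
      using ln_\<psi>_diff[OF sh_mem[OF xy(1)] sh_mem[OF xy(2)]] by linarith
    then have "\<bar>A' x - A' y\<bar> \<le> MA * D x y + up / low * D x y + up / low * (c' powr \<alpha> * D x y)"
      using A_diff[OF xy] ln_\<psi>_diff[OF xy] unfolding normalized_potential_def by linarith
    then show "norm (A' x - A' y) \<le> (MA + up / low + up / low * c' powr \<alpha>) * D x y"
      by (simp add: distrib_right mult.assoc)
  qed
qed

end

section \<open>Tails of \<open>m\<close> and boxes given by the weights\<close>

context ruelle_space
begin

lemma m_tails: "(\<lambda>n. measure m {r. real n < \<bar>r\<bar>}) \<longlonglongrightarrow> 0"
proof -
  have "(\<lambda>n. measure m {r. real n < \<bar>r\<bar>}) \<longlonglongrightarrow> measure m (\<Inter>n. {r. real n < \<bar>r\<bar>})"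
  proof (rule finite_Lim_measure_decseq)
    show "range (\<lambda>n. {r. real n < \<bar>r\<bar>}) \<subseteq> sets m" unfolding sets_m by auto
    show "decseq (\<lambda>n. {r. real n < \<bar>r\<bar>})" by (rule decseq_SucI) auto
  qed
  also have "(\<Inter>n. {r. real n < \<bar>r\<bar>}) = {}"
  proof -
    have "\<exists>n. \<not> real n < \<bar>r\<bar>" for r by (meson reals_Archimedean2 less_asym)
    then show ?thesis by auto
  qed
  finally show ?thesis by simp
qed

lemma Ln_sum: "\<lbrakk>finite I; \<And>i. i \<in> I \<Longrightarrow> f i \<in> bm; x \<in> X\<rbrakk> \<Longrightarrow> (\<lambda>y. \<Sum>i\<in>I. f i y) \<in> bm \<and> (L ^^ n) (\<lambda>y. \<Sum>i\<in>I. f i y) x = (\<Sum>i\<in>I. (L ^^ n) (f i) x)"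
proof (induction I rule: finite_induct)
  case empty
  then show ?case using Ln_scale[of x n 0 "\<lambda>_. 0"] by simp
next
  case (insert j I)
  then show ?case by (auto simp: Ln_add intro: bm_add)
qed

text \<open>Summability forces \<open>d_i \<ge> 1\<close> eventually, and then
  \<open>1 / \<beta>_1^i \<le> 1 / d_i \<le> d_i^(-\<alpha>)\<close> by
  \<open>\<alpha> \<le> 1\<close>, so the sequence is absolutely summable. Boxes of this shape are
  mapped into themselves by the branches whose symbol is at most \<open>R\<close> in absolute
  value.\<close>

lemma weight_seq_mem: "(\<lambda>i. R / weight_prod a 0 i) \<in> X"
proof (rule l1_mem)
  have ev: "\<forall>\<^sub>F i in sequentially. 1 \<le> weight_inf a i"
  proof -
    have "\<forall>\<^sub>F i in sequentially. s i < 1" using order_tendstoD(2)[OF s_tendsto, of 1] by simp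
    then show ?thesis
    proof (rule eventually_mono)
      fix i assume *: "s i < 1"
      show "1 \<le> weight_inf a i"
      proof (rule ccontr)
        assume "\<not> 1 \<le> weight_inf a i"
        then have "1 powr - \<alpha> \<le> weight_inf a i powr - \<alpha>" using weight_inf_pos[of i] \<alpha>_pos by (intro powr_mono2') auto
        with * show False by (simp add: s_def)
      qed
    qed
  qed
  have sm: "summable (\<lambda>i. \<bar>R\<bar> * s i)" using summable_s by (subst (asm) summable_Suc_iff) (rule summable_mult)
  show "summable (\<lambda>i. \<bar>R / weight_prod a 0 i\<bar>)"
  proof (rule summable_comparison_test_ev[OF _ sm])
    show "\<forall>\<^sub>F i in sequentially. norm \<bar>R / weight_prod a 0 i\<bar> \<le> \<bar>R\<bar> * s i"
      using ev
    proof (rule eventually_mono)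
      fix i assume i: "1 \<le> weight_inf a i"
      have "1 / weight_prod a 0 i \<le> 1 / weight_inf a i"
        using weight_inf_le weight_inf_pos weight_prod_pos by (intro divide_left_mono mult_pos_pos) auto
      also have "\<dots> = weight_inf a i powr - 1" using weight_inf_pos[of i] by (simp add: powr_minus_divide)
      also have "\<dots> \<le> s i" unfolding s_def using i \<alpha>_le_1 by (intro powr_mono) auto
      finally have "\<bar>R\<bar> * (1 / weight_prod a 0 i) \<le> \<bar>R\<bar> * s i" by (rule mult_left_mono) simp
      then show "norm \<bar>R / weight_prod a 0 i\<bar> \<le> \<bar>R\<bar> * s i" using weight_prod_pos[of 0 i] by simp
    qed
  qed
qed

end

section \<open>Uniqueness of the eigenfunction\<close>

locale ruelle_sv_eigen = ruelle_sv + ruelle_eigen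
begin

text \<open>Points of the box with values tending to 0 would accumulate, by compactness, at a zero
  of \<open>\<phi>\<close>.\<close>

lemma positive_on_box:
  assumes \<phi>: "\<phi> \<in> Lip" "\<And>x. x \<in> X \<Longrightarrow> 0 < \<phi> x" and k: "\<kappa> \<in> X"
  shows "\<exists>e>0. \<forall>x. (\<forall>i. \<bar>x i\<bar> \<le> \<kappa> i) \<longrightarrow> e \<le> (\<phi> x :: real)"
proof (rule ccontr)
  assume neg: "\<not> ?thesis"
  have "\<exists>x. (\<forall>i. \<bar>x i\<bar> \<le> \<kappa> i) \<and> \<phi> x < 1 / real (Suc j)" for j
  proof -
    have "0 < 1 / real (Suc j)" by simp
    with neg show ?thesis by (meson not_less)
  qed
  then obtain x where x: "\<And>j i. \<bar>x j i\<bar> \<le> \<kappa> i" "\<And>j. \<phi> (x j) < 1 / real (Suc j)" by metis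
  have k0: "0 \<le> \<kappa> i" for i using x(1)[of 0 i] by linarith
  have xX: "x j \<in> X" for j using x(1) k0 by (intro solid_mem[OF k]) auto
  obtain r y where r: "strict_mono (r :: nat \<Rightarrow> nat)" "y \<in> X" "\<And>i. \<bar>y i\<bar> \<le> \<kappa> i" "(\<lambda>j. N (\<lambda>i. x (r j) i - y i)) \<longlonglongrightarrow> 0"
    by (rule box_subsequence[of \<kappa> x, OF k x(1)]) (rule that)
  have l1: "(\<lambda>j. \<phi> (x (r j))) \<longlonglongrightarrow> \<phi> y"
    by (rule Lip_seq_continuous[of \<phi> "\<lambda>j. x (r j)", OF \<phi>(1) xX r(2) r(4)])
  have l2: "(\<lambda>j. 1 / real (Suc (r j))) \<longlonglongrightarrow> 0"
    using LIMSEQ_subseq_LIMSEQ[OF LIMSEQ_inverse_real_of_nat r(1)] by (simp add: o_def inverse_eq_divide)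
  have "\<phi> y \<le> 0" by (rule LIMSEQ_le[OF l1 l2]) (use x(2) less_imp_le in blast)
  with \<phi>(2)[OF r(2)] show False by simp
qed

text \<open>An eigenvalue above \<open>lam\<close> would make the iterates of \<open>\<phi>\<close>
  outgrow \<open>Lip_norm \<phi> * L^n 1\<close>, which is of order \<open>lam ^ n\<close>.\<close>

lemma eigenvalue_le:
  assumes \<phi>: "\<phi> \<in> Lip" "\<And>x. x \<in> X \<Longrightarrow> 0 < \<phi> x" and \<rho>: "\<And>x. x \<in> X \<Longrightarrow> L \<phi> x = \<rho> * \<phi> x"
  shows "0 \<le> \<rho>" "\<And>x n. x \<in> X \<Longrightarrow> (L ^^ n) \<phi> x = \<rho> ^ n * \<phi> x" "\<rho> \<le> lam"
proof -
  have "0 \<le> \<rho> * \<phi> (\<lambda>_. 0)" using Ln_nonneg[OF Lip_bm[OF \<phi>(1)] less_imp_le[OF \<phi>(2)] zero_mem, of 1] \<rho>[OF zero_mem] by simp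
  then show 0: "0 \<le> \<rho>" using \<phi>(2)[OF zero_mem] by (simp add: zero_le_mult_iff)
  show it: "(L ^^ n) \<phi> x = \<rho> ^ n * \<phi> x" if "x \<in> X" for x n
    using that
  proof (induction n arbitrary: x)
    case (Suc n)
    have "(L ^^ Suc n) \<phi> x = L (\<lambda>y. \<rho> ^ n * \<phi> y) x" using Suc by (auto intro: ruelle_cong)
    then show ?case using Suc.prems by (simp add: L_scale \<rho>)
  qed simp
  show "\<rho> \<le> lam"
  proof (rule ccontr)
    assume "\<not> \<rho> \<le> lam"
    then have q: "1 < \<rho> / lam" using lam_pos by simp
    let ?z = "\<lambda>_. 0 :: real"
    obtain n where n: "Lip_norm \<phi> * CE / \<phi> ?z < (\<rho> / lam) ^ n" using real_arch_pow[OF q] by blast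
    have "\<rho> ^ n * \<phi> ?z \<le> Lip_norm \<phi> * (L ^^ n) (\<lambda>_. 1) ?z"
      using Ln_abs_le[OF Lip_bm[OF \<phi>(1)] _ zero_mem, of "Lip_norm \<phi>" n] Lip_norm_bounds(1)[OF \<phi>(1)] it[OF zero_mem, of n] by fastforce
    also have "\<dots> \<le> Lip_norm \<phi> * (CE * lam ^ n)"
      by (intro mult_left_mono Ln_one_le zero_mem Lip_norm_bounds(3)[OF \<phi>(1)])
    finally have "(\<rho> / lam) ^ n \<le> Lip_norm \<phi> * CE / \<phi> ?z"
      using \<phi>(2)[OF zero_mem] lam_pos by (simp add: power_divide le_divide_eq divide_le_eq mult_ac)
    with n show False by simp
  qed
qed

text \<open>On the compact boxes \<open>|x\<^sub>i| \<le> R / \<beta>\<^sup>i\<close>, which only the branches with \<open>|r| > R\<close> leave, the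
  infimum of \<open>\<phi> / \<psi>\<close> is positive.\<close>

lemma eigenvalue_ge:
  assumes \<phi>: "\<phi> \<in> Lip" "\<And>x. x \<in> X \<Longrightarrow> 0 < \<phi> x" and \<rho>: "\<And>x. x \<in> X \<Longrightarrow> L \<phi> x = \<rho> * \<phi> x" and R: "0 \<le> R"
  shows "lam - exp MA * up * measure m {r. R < \<bar>r\<bar>} / low \<le> \<rho>"
proof -
  define \<kappa> where "\<kappa> = (\<lambda>i. R / weight_prod a 0 i)"
  have k: "\<kappa> \<in> X" unfolding \<kappa>_def by (rule weight_seq_mem)
  have k0: "0 \<le> \<kappa> i" for i using R weight_prod_pos[of 0 i] by (simp add: \<kappa>_def)
  define K where "K = {x. \<forall>i. \<bar>x i\<bar> \<le> \<kappa> i}"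
  have KX: "x \<in> X" if "x \<in> K" for x using that k0 by (intro solid_mem[OF k]) (auto simp: K_def)
  have Kz: "(\<lambda>_. 0) \<in> K" using k0 by (simp add: K_def)
  \<comment> \<open>The box satisfies \<open>\<kappa> 0 = R\<close> and
    \<open>\<kappa> (Suc j) = \<kappa> j / a j\<close>, the same recursion that a branch applies to
    coordinates.\<close>
  have Kbr: "br r x \<in> K" if "x \<in> K" "\<bar>r\<bar> \<le> R" for x r
  proof -
    have "\<bar>br r x i\<bar> \<le> \<kappa> i" for i
    proof (cases i)
      case 0
      then show ?thesis using that(2) by (simp add: \<kappa>_def weight_prod_def)
    next
      case (Suc j)
      have "\<bar>x j\<bar> / a j \<le> \<kappa> j / a j" using that(1) a_pos[of j] by (intro divide_right_mono) (auto simp: K_def)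
      then show ?thesis using a_pos[of j] by (simp add: Suc \<kappa>_def weight_prod_Suc)
    qed
    then show ?thesis by (simp add: K_def)
  qed
  obtain e where e: "0 < e" "\<And>x. x \<in> K \<Longrightarrow> e \<le> \<phi> x"
    using positive_on_box[OF \<phi> k] by (auto simp: K_def)
  define \<iota> where "\<iota> = (INF x\<in>K. \<phi> x / \<psi> x)"
  have q0: "0 \<le> \<phi> x / \<psi> x" if "x \<in> K" for x using \<phi>(2)[OF KX[OF that]] \<psi>_pos[OF KX[OF that]] by simp
  have \<iota>_le: "\<iota> \<le> \<phi> x / \<psi> x" if "x \<in> K" for x
    unfolding \<iota>_def using that q0 by (intro cINF_lower) (auto intro!: bdd_belowI2[of _ 0])
  have up: "0 < up" using \<psi>_le[OF zero_mem] \<psi>_pos[OF zero_mem] by linarith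
  have "e / up \<le> \<iota>"
    unfolding \<iota>_def
  proof (rule cINF_greatest)
    show "K \<noteq> {}" using Kz by blast
    fix x assume x: "x \<in> K"
    show "e / up \<le> \<phi> x / \<psi> x"
      using e(2)[OF x] e(1) \<psi>_le[OF KX[OF x]] \<psi>_pos[OF KX[OF x]] up by (intro frac_le) auto
  qed
  then have \<iota>: "0 < \<iota>" using e(1) up by (meson divide_pos_pos less_le_trans)
  define \<mu> where "\<mu> = measure m {r. R < \<bar>r\<bar>}"
  have st: "{r. R < \<bar>r\<bar>} \<in> sets m" unfolding sets_m by auto
  \<comment> \<open>In the eigenvalue equation for \<open>\<psi>\<close> the branches with
    \<open>R < |r|\<close> contribute at most \<open>exp MA * up * \<mu>\<close>; the others stay in
    \<open>K\<close>, where \<open>\<phi> \<ge> \<iota> * \<psi>\<close>.\<close>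
  have main: "\<iota> * (lam - exp MA * up * \<mu> / low) \<le> \<rho> * (\<phi> x / \<psi> x)" if x: "x \<in> K" for x
  proof -
    note xX = KX[OF x]
    have int: "integrable m (\<lambda>r. \<iota> * (exp (A (br r x)) * \<psi> (br r x)) - \<iota> * (exp MA * up) * indicator {r. R < \<bar>r\<bar>} r)"
      using st by (intro Bochner_Integration.integrable_diff integrable_mult_right L_integrable \<psi>_bm xX integrable_real_indicator) (auto simp: emeasure_eq_measure)
    have "\<iota> * (lam * \<psi> x) - \<iota> * (exp MA * up) * \<mu> = (\<integral>r. \<iota> * (exp (A (br r x)) * \<psi> (br r x)) - \<iota> * (exp MA * up) * indicator {r. R < \<bar>r\<bar>} r \<partial>m)"
      using st L_integrable[OF \<psi>_bm xX] by (subst Bochner_Integration.integral_diff)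
        (auto simp: L_eq[symmetric] L_\<psi>[OF xX] \<mu>_def emeasure_eq_measure)
    also have "\<dots> \<le> (\<integral>r. exp (A (br r x)) * \<phi> (br r x) \<partial>m)"
    proof (rule integral_mono[OF int L_integrable[OF Lip_bm[OF \<phi>(1)] xX]])
      fix r
      have b: "br r x \<in> X" using xX by (rule br_mem)
      show "\<iota> * (exp (A (br r x)) * \<psi> (br r x)) - \<iota> * (exp MA * up) * indicator {r. R < \<bar>r\<bar>} r \<le> exp (A (br r x)) * \<phi> (br r x)"
      proof (cases "R < \<bar>r\<bar>")
        case True
        have "exp (A (br r x)) * \<psi> (br r x) \<le> exp MA * up"
          using exp_A_le[OF b] \<psi>_le[OF b] \<psi>_pos[OF b] by (intro mult_mono) auto
        then have "\<iota> * (exp (A (br r x)) * \<psi> (br r x)) \<le> \<iota> * (exp MA * up)" using \<iota> by (intro mult_left_mono) auto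
        moreover have "0 \<le> exp (A (br r x)) * \<phi> (br r x)" using \<phi>(2)[OF b] by simp
        ultimately show ?thesis using True by simp
      next
        case False
        then have "\<iota> * \<psi> (br r x) \<le> \<phi> (br r x)"
          using \<iota>_le[OF Kbr[OF x, of r]] \<psi>_pos[OF b] by (simp add: le_divide_eq)
        then have "exp (A (br r x)) * (\<iota> * \<psi> (br r x)) \<le> exp (A (br r x)) * \<phi> (br r x)" by (rule mult_left_mono) simp
        then show ?thesis using False by (simp add: mult_ac)
      qed
    qed
    also have "\<dots> = \<rho> * \<phi> x" using \<rho>[OF xX] by (simp add: L_eq)
    finally have 1: "\<iota> * (lam * \<psi> x) - \<iota> * (exp MA * up) * \<mu> \<le> \<rho> * \<phi> x" .
    have "\<iota> * (exp MA * up) * \<mu> / \<psi> x \<le> \<iota> * (exp MA * up) * \<mu> / low"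
      using \<iota> up low_pos \<psi>_ge[OF xX] \<psi>_pos[OF xX] by (intro divide_left_mono mult_nonneg_nonneg mult_pos_pos) (auto simp: \<mu>_def)
    moreover have "\<iota> * lam - \<iota> * (exp MA * up) * \<mu> / \<psi> x \<le> \<rho> * (\<phi> x / \<psi> x)"
      using divide_right_mono[OF 1, of "\<psi> x"] \<psi>_pos[OF xX] by (simp add: diff_divide_distrib)
    ultimately show ?thesis by (simp add: algebra_simps)
  qed
  note \<rho>0 = eigenvalue_le(1)[OF \<phi> \<rho>]
  have "\<iota> * (lam - exp MA * up * \<mu> / low) \<le> \<rho> * \<iota>"
  \<comment> \<open>Passing to the infimum over \<open>K\<close> in \<open>main\<close> needs
    division by \<open>\<rho>\<close>; for \<open>\<rho> = 0\<close> the claim is already an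
    instance of \<open>main\<close>.\<close>
  proof (cases "\<rho> = 0")
    case True
    then show ?thesis using main[OF Kz] by simp
  next
    case False
    with \<rho>0 have r: "0 < \<rho>" by simp
    have "\<iota> * (lam - exp MA * up * \<mu> / low) / \<rho> \<le> \<iota>"
      unfolding \<iota>_def
    proof (rule cINF_greatest)
      show "K \<noteq> {}" using Kz by blast
      fix x assume "x \<in> K"
      from main[OF this] show "(INF x\<in>K. \<phi> x / \<psi> x) * (lam - exp MA * up * \<mu> / low) / \<rho> \<le> \<phi> x / \<psi> x"
        unfolding \<iota>_def using r by (simp add: pos_divide_le_eq mult.commute)
    qed
    then show ?thesis using r by (simp add: divide_le_eq mult.commute)
  qed
  then have "lam - exp MA * up * \<mu> / low \<le> \<rho>" using \<iota> by (simp add: mult.commute)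
  then show ?thesis by (simp add: \<mu>_def)
qed

text \<open>Letting \<open>R\<close> tend to infinity in \<open>eigenvalue_ge\<close> yields the
  eigenvalue \<open>lam\<close>. For the supremum \<open>t\<close> of \<open>\<phi> / \<psi>\<close>
  the function \<open>\<eta> = t \<psi> - \<phi>\<close> is a nonnegative eigenfunction with infimum
  0. The Hoelder error in \<open>sv_distortion\<close> vanishes for large \<open>n\<close>, so any
  two values of \<open>\<eta>\<close> are comparable up to \<open>exp V\<close>, and
  \<open>\<eta>\<close> is 0. The supremum need not be attained, hence the argument with
  \<open>e\<close> at the end.\<close>

lemma eigenfunction_unique:
  assumes \<phi>: "\<phi> \<in> Lip" "\<And>x. x \<in> X \<Longrightarrow> 0 < \<phi> x" and \<rho>: "\<And>x. x \<in> X \<Longrightarrow> L \<phi> x = \<rho> * \<phi> x"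
  shows "\<exists>t. \<forall>x\<in>X. \<phi> x = t * \<psi> x"
proof -
  have "(\<lambda>n. lam - exp MA * up * measure m {r. real n < \<bar>r\<bar>} / low) \<longlonglongrightarrow> lam - exp MA * up * 0 / low"
    by (intro tendsto_intros m_tails) (use low_pos in auto)
  then have "lam \<le> \<rho>"
    using eigenvalue_ge[OF \<phi> \<rho>] by (intro LIMSEQ_le_const2[where X="\<lambda>n. lam - exp MA * up * measure m {r. real n < \<bar>r\<bar>} / low"]) auto
  with eigenvalue_le(3)[OF \<phi> \<rho>] have \<rho>eq: "\<rho> = lam" by simp
  define t where "t = (SUP x\<in>X. \<phi> x / \<psi> x)"
  have qb: "\<phi> x / \<psi> x \<le> Lip_norm \<phi> / low" if "x \<in> X" for x
    using Lip_norm_bounds(1)[OF \<phi>(1) that] \<phi>(2)[OF that] \<psi>_ge[OF that] low_pos by (intro frac_le) auto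
  have t: "\<phi> x / \<psi> x \<le> t" if "x \<in> X" for x
    unfolding t_def using that qb by (intro cSUP_upper) (auto intro!: bdd_aboveI2)
  define \<eta> where "\<eta> x = t * \<psi> x - \<phi> x" for x
  have \<eta>0: "0 \<le> \<eta> x" if "x \<in> X" for x
    using t[OF that] \<psi>_pos[OF that] by (simp add: \<eta>_def divide_le_eq)
  have \<eta>b: "\<eta> \<in> bm" unfolding \<eta>_def by (intro bm_diff bm_mult bm_const \<psi>_bm Lip_bm[OF \<phi>(1)])
  define C where "C = \<bar>t\<bar> * up + Lip_norm \<phi>"
  have C: "0 \<le> C" using up_nonneg Lip_norm_bounds(3)[OF \<phi>(1)] by (simp add: C_def)
  have \<eta>l: "\<eta> x \<le> \<eta> y + C * D x y" if xy: "x \<in> X" "y \<in> X" for x y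
  proof -
    have "t * (\<psi> x - \<psi> y) \<le> \<bar>t\<bar> * \<bar>\<psi> x - \<psi> y\<bar>" by (metis abs_ge_self abs_mult)
    also have "\<dots> \<le> \<bar>t\<bar> * (up * D x y)" using \<psi>_diff[OF xy] by (intro mult_left_mono) auto
    finally show ?thesis using Lip_norm_bounds(2)[OF \<phi>(1) xy] unfolding \<eta>_def C_def real_norm_def by (simp add: algebra_simps)
  qed
  have \<eta>n: "(L ^^ n) \<eta> x = lam ^ n * \<eta> x" if x: "x \<in> X" for n x
  proof -
    have "(L ^^ n) \<eta> x = (L ^^ n) (\<lambda>y. t * \<psi> y) x - (L ^^ n) \<phi> x"
      unfolding \<eta>_def using x by (intro Ln_diff bm_mult bm_const \<psi>_bm Lip_bm[OF \<phi>(1)])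
    then show ?thesis using x eigenvalue_le(2)[OF \<phi> \<rho> x, of n] by (simp add: Ln_scale Ln_\<psi> \<rho>eq \<eta>_def algebra_simps)
  qed
  have cmp: "\<eta> x \<le> exp V * \<eta> y" if xy: "x \<in> X" "y \<in> X" for x y
  proof -
    have "\<eta> x \<le> exp V * (\<eta> y + C * s n * D x y * CE)" for n
    proof -
      have "lam ^ n * \<eta> x \<le> exp V * (lam ^ n * \<eta> y + C * s n * D x y * (L ^^ n) (\<lambda>_. 1) y)"
        using sv_distortion[OF \<eta>b \<eta>0 \<eta>l C xy, of n] unfolding \<eta>n[OF xy(1)] \<eta>n[OF xy(2)] .
      also have "\<dots> \<le> exp V * (lam ^ n * \<eta> y + C * s n * D x y * (CE * lam ^ n))"
        using C by (intro mult_left_mono add_left_mono Ln_one_le xy) auto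
      also have "\<dots> = lam ^ n * (exp V * (\<eta> y + C * s n * D x y * CE))" by (simp add: algebra_simps)
      finally show ?thesis using lam_pos by simp
    qed
    moreover have "(\<lambda>n. exp V * (\<eta> y + C * s n * D x y * CE)) \<longlonglongrightarrow> exp V * (\<eta> y + C * 0 * D x y * CE)"
      by (intro tendsto_intros s_tendsto)
    ultimately show ?thesis by (intro LIMSEQ_le_const[where X="\<lambda>n. exp V * (\<eta> y + C * s n * D x y * CE)"]) auto
  qed
  have "\<eta> x \<le> 0" if x: "x \<in> X" for x
  proof (rule field_le_epsilon)
    fix e :: real assume e: "0 < e"
    have up: "0 < up" using \<psi>_le[OF zero_mem] \<psi>_pos[OF zero_mem] by linarith
    have "t - e / (exp V * up) < t" using e up by simp
    moreover have "X \<noteq> {}" using x by blast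
    moreover have "bdd_above ((\<lambda>x. \<phi> x / \<psi> x) ` X)" by (rule bdd_aboveI2) (rule qb)
    ultimately obtain y where y: "y \<in> X" "t - e / (exp V * up) < \<phi> y / \<psi> y"
      unfolding t_def using less_cSUP_iff[of X "\<lambda>x. \<phi> x / \<psi> x"] by blast
    have "\<eta> y = (t - \<phi> y / \<psi> y) * \<psi> y" using \<psi>_pos[OF y(1)] by (simp add: \<eta>_def field_simps)
    also have "\<dots> \<le> e / (exp V * up) * up"
      using y \<psi>_le[OF y(1)] \<psi>_pos[OF y(1)] e up by (intro mult_mono) auto
    finally have "exp V * \<eta> y \<le> e" using up by (simp add: field_simps)
    then show "\<eta> x \<le> 0 + e" using cmp[OF x y(1)] by simp
  qed
  then show ?thesis using \<eta>0 by (intro exI[of _ t]) (fastforce simp: \<eta>_def)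
qed

end

section \<open>Convergence of the iterates\<close>

locale ruelle_normal = ruelle_space +
  assumes tails: "adapted_tails X a m" and L_one: "\<And>x. x \<in> X \<Longrightarrow> L (\<lambda>_. 1) x = 1"
begin

lemma Ln_one: "x \<in> X \<Longrightarrow> (L ^^ n) (\<lambda>_. 1) x = 1"
proof (induction n arbitrary: x)
  case (Suc n)
  have "(L ^^ Suc n) (\<lambda>_. 1) x = L (\<lambda>_. 1) x" using Suc by (auto intro: ruelle_cong)
  then show ?case using L_one[OF Suc.prems] by simp
qed simp

lemma Ln_const1: "x \<in> X \<Longrightarrow> (L ^^ n) (\<lambda>_. t) x = t"
  using Ln_const[of x n t] Ln_one[of x n] by simp

lemma Ln_abs: "\<lbrakk>\<phi> \<in> bm; \<And>y. y \<in> X \<Longrightarrow> \<bar>\<phi> y\<bar> \<le> C; x \<in> X\<rbrakk> \<Longrightarrow> \<bar>(L ^^ n) \<phi> x\<bar> \<le> C"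
  using Ln_abs_le[of \<phi> C x n] Ln_one[of x n] by simp

lemma Ln_coshift: "x \<in> X \<Longrightarrow> (L ^^ n) (\<lambda>z. g ((sh ^^ n) z)) x = g x" for g :: "(nat \<Rightarrow> real) \<Rightarrow> real"
  using Ln_shift[of x n "\<lambda>_. 1" g] Ln_one[of x n] by simp

section \<open>Tightness of the iterates\<close>

lemma coord_set: "{z \<in> X. t < \<bar>z i\<bar>} \<in> sets \<B>"
proof -
  have "{z \<in> space \<B>. t < \<bar>z i\<bar>} \<in> sets \<B>" by measurable
  then show ?thesis by simp
qed

text \<open>For \<open>i < k\<close> coordinate \<open>i\<close> stems from a single symbol, scaled
  by \<open>1 / \<beta>_1^i\<close>. Shifting \<open>i\<close> times moves it to coordinate 0, one
  application of \<open>L\<close> integrates it against a density of at most \<open>exp MA\<close>,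
  and the remaining iterates preserve constants.\<close>

lemma coordinate_tail:
  assumes i: "i < k" and x: "x \<in> X"
  shows "(L ^^ k) (indicator {z \<in> X. t < \<bar>z i\<bar>}) x \<le> exp MA * measure m {r. weight_prod a 0 i * t < \<bar>r\<bar>}"
proof -
  define g :: "(nat \<Rightarrow> real) \<Rightarrow> real" where "g = indicator {y \<in> X. weight_prod a 0 i * t < \<bar>y 0\<bar>}"
  define \<mu> where "\<mu> = measure m {r. weight_prod a 0 i * t < \<bar>r\<bar>}"
  have g: "g \<in> bm" unfolding g_def by (intro bm_indicator coord_set)
  have Lg: "L g y \<le> exp MA * \<mu>" if y: "y \<in> X" for y
  proof -
    have st: "{r. weight_prod a 0 i * t < \<bar>r\<bar>} \<in> sets m" unfolding sets_m by auto
    have "L g y \<le> (\<integral>r. exp MA * indicator {r. weight_prod a 0 i * t < \<bar>r\<bar>} r \<partial>m)"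
      unfolding L_eq
    proof (intro integral_mono L_integrable g y integrable_mult_right integrable_real_indicator st)
      fix r
      show "exp (A (br r y)) * g (br r y) \<le> exp MA * indicator {r. weight_prod a 0 i * t < \<bar>r\<bar>} r"
        unfolding g_def using exp_A_le[OF br_mem[OF y, of r]] br_mem[OF y, of r] by (simp add: indicator_def)
    qed (simp add: emeasure_eq_measure)
    then show ?thesis using st by (simp add: \<mu>_def)
  qed
  have eq: "indicator {z \<in> X. t < \<bar>z i\<bar>} z = g ((sh ^^ i) z)" if "z \<in> X" for z
  proof -
    have "t < \<bar>z i\<bar> \<longleftrightarrow> weight_prod a 0 i * t < \<bar>(sh ^^ i) z 0\<bar>"
      using weight_prod_pos[of 0 i] by (simp add: shn_coord abs_mult)
    then show ?thesis using that shn_mem[OF that] by (simp add: g_def indicator_def)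
  qed
  have k: "k = (k - 1 - i) + (1 + i)" using i by simp
  have "(L ^^ k) (indicator {z \<in> X. t < \<bar>z i\<bar>}) x = (L ^^ k) (\<lambda>z. g ((sh ^^ i) z)) x"
    by (rule Ln_cong[OF eq x])
  also have "\<dots> = (L ^^ (k - 1 - i)) ((L ^^ (1 + i)) (\<lambda>z. g ((sh ^^ i) z))) x"
    by (subst k) (simp only: Ln_comp)
  also have "\<dots> = (L ^^ (k - 1 - i)) (L g) x"
    by (rule Ln_cong[OF _ x]) (auto intro!: ruelle_cong Ln_coshift)
  also have "\<dots> \<le> (L ^^ (k - 1 - i)) (\<lambda>_. exp MA * \<mu>) x"
    by (intro Ln_mono L_bm g bm_const Lg x)
  also have "\<dots> = exp MA * \<mu>" by (rule Ln_const1[OF x])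
  finally show ?thesis by (simp add: \<mu>_def)
qed

lemma box_set: "{z \<in> X. \<exists>i<k. \<kappa> i < \<bar>z i\<bar>} \<in> sets \<B>"
proof -
  have "{z \<in> X. \<exists>i<k. \<kappa> i < \<bar>z i\<bar>} = (\<Union>i\<in>{..<k}. {z \<in> X. \<kappa> i < \<bar>z i\<bar>})" by auto
  also have "\<dots> \<in> sets \<B>" by (intro sets.finite_UN coord_set) auto
  finally show ?thesis .
qed

lemma box_tightness:
  assumes e: "0 < e"
  shows "\<exists>\<kappa>\<in>X. (\<forall>i. 0 < \<kappa> i) \<and> (\<forall>k. \<forall>x\<in>X. (L ^^ k) (indicator {z \<in> X. \<exists>i<k. \<kappa> i < \<bar>z i\<bar>}) x \<le> e)"
proof -
  \<comment> \<open>One half of \<open>e\<close> is spent on coordinate 0, the other half on all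
    further coordinates.\<close>
  define \<epsilon> where "\<epsilon> = e / (2 * exp MA)"
  have \<epsilon>: "0 < \<epsilon>" using e by (simp add: \<epsilon>_def)
  obtain \<kappa>0 where \<kappa>0: "\<kappa>0 \<in> X" "\<And>n. 0 < \<kappa>0 n"
    "(\<Sum>n. emeasure m (UNIV - {- (weight_prod a 0 (Suc n) * \<kappa>0 n)..weight_prod a 0 (Suc n) * \<kappa>0 n})) < ennreal \<epsilon>"
    using tails \<epsilon> unfolding adapted_tails_def by meson
  obtain R where R: "measure m {r. real R < \<bar>r\<bar>} < \<epsilon>"
    using order_tendstoD(2)[OF m_tails \<epsilon>] by (auto simp: eventually_sequentially)
  \<comment> \<open>Adapted tails pair \<open>\<kappa>0 n\<close> with a product of
    \<open>n + 1\<close> weights, while coordinate \<open>i\<close> needs a product of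
    \<open>i\<close> weights. So \<open>\<kappa>0\<close> moves up by one place, and coordinate 0,
    with the empty product, gets its bound from tightness of \<open>m\<close>.\<close>
  define \<kappa> where "\<kappa> = case_nat (real R + 1) \<kappa>0"
  have "(\<lambda>i. (if i = 0 then real R + 1 else 0) + case_nat 0 \<kappa>0 i) \<in> X" by (intro add_mem single_mem shift_mem \<kappa>0)
  also have "(\<lambda>i. (if i = 0 then real R + 1 else 0) + case_nat 0 \<kappa>0 i) = \<kappa>" by (auto simp: fun_eq_iff \<kappa>_def split: nat.split)
  finally have \<kappa>X: "\<kappa> \<in> X" .
  define t where "t i = measure m {r. weight_prod a 0 i * \<kappa> i < \<bar>r\<bar>}" for i
  have t0: "t 0 \<le> \<epsilon>"
  proof -
    have "t 0 \<le> measure m {r. real R < \<bar>r\<bar>}" unfolding t_def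
      by (rule finite_measure_mono) (auto simp: \<kappa>_def weight_prod_def sets_m)
    with R show ?thesis by simp
  qed
  have "(\<Sum>i<k. t (Suc i)) \<le> \<epsilon>" for k
  proof -
    have e: "{r. weight_prod a 0 (Suc i) * \<kappa> (Suc i) < \<bar>r\<bar>} = UNIV - {- (weight_prod a 0 (Suc i) * \<kappa>0 i)..weight_prod a 0 (Suc i) * \<kappa>0 i}" for i
      by (auto simp: \<kappa>_def)
    have "ennreal (\<Sum>i<k. t (Suc i)) = (\<Sum>i<k. emeasure m (UNIV - {- (weight_prod a 0 (Suc i) * \<kappa>0 i)..weight_prod a 0 (Suc i) * \<kappa>0 i}))"
      unfolding t_def e emeasure_eq_measure by (subst sum_ennreal) auto
    also have "\<dots> \<le> (\<Sum>n. emeasure m (UNIV - {- (weight_prod a 0 (Suc n) * \<kappa>0 n)..weight_prod a 0 (Suc n) * \<kappa>0 n}))"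
      by (rule sum_le_suminf) auto
    also note \<kappa>0(3)
    finally show ?thesis using \<epsilon> by (simp add: ennreal_less_iff t_def sum_nonneg)
  qed
  note ts = this
  have sum_t: "(\<Sum>i<k. t i) \<le> 2 * \<epsilon>" for k
  proof (cases k)
    case (Suc j)
    then show ?thesis unfolding Suc sum.lessThan_Suc_shift using t0 ts[of j] by simp
  qed (use \<epsilon> in simp)
  show ?thesis
  proof (intro bexI[OF _ \<kappa>X] conjI allI ballI)
    fix i show "0 < \<kappa> i" using \<kappa>0(2) by (auto simp: \<kappa>_def split: nat.split)
  next
    fix k x assume x: "x \<in> X"
    let ?I = "\<lambda>i. indicator {z \<in> X. \<kappa> i < \<bar>z i\<bar>} :: (nat \<Rightarrow> real) \<Rightarrow> real"
    have I: "?I i \<in> bm" for i by (intro bm_indicator coord_set)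
    note S = Ln_sum[of "{..<k}" ?I x k, OF _ I x]
    have "(L ^^ k) (indicator {z \<in> X. \<exists>i<k. \<kappa> i < \<bar>z i\<bar>}) x \<le> (L ^^ k) (\<lambda>y. \<Sum>i<k. ?I i y) x"
    proof (intro Ln_mono bm_indicator box_set x)
      show "(\<lambda>y. \<Sum>i<k. ?I i y) \<in> bm" using S by simp
      fix y assume y: "y \<in> X"
      show "indicator {z \<in> X. \<exists>i<k. \<kappa> i < \<bar>z i\<bar>} y \<le> (\<Sum>i<k. ?I i y)"
      proof (cases "\<exists>i<k. \<kappa> i < \<bar>y i\<bar>")
        case True
        then obtain i where i: "i < k" "\<kappa> i < \<bar>y i\<bar>" by blast
        have "?I i y \<le> (\<Sum>i<k. ?I i y)" by (rule member_le_sum) (use i in auto)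
        then show ?thesis using i y by (simp add: indicator_def split: if_splits)
      qed (simp add: sum_nonneg)
    qed
    also have "\<dots> = (\<Sum>i<k. (L ^^ k) (?I i) x)" using S by simp
    also have "\<dots> \<le> (\<Sum>i<k. exp MA * t i)"
      unfolding t_def by (intro sum_mono coordinate_tail x) auto
    also have "\<dots> \<le> exp MA * (2 * \<epsilon>)" unfolding sum_distrib_left[symmetric] by (intro mult_left_mono sum_t) simp
    also have "\<dots> = e" by (simp add: \<epsilon>_def)
    finally show "(L ^^ k) (indicator {z \<in> X. \<exists>i<k. \<kappa> i < \<bar>z i\<bar>}) x \<le> e" .
  qed
qed

definition "far R = {z \<in> X. R < N z}"

lemma far_sets: "far R \<in> sets \<B>"
proof -
  have "{z \<in> space \<B>. R < N z} \<in> sets \<B>" by measurable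
  then show ?thesis by (simp add: far_def)
qed

lemma far_bm: "indicator (far R) \<in> bm"
  by (rule bm_indicator[OF far_sets])

text \<open>The radius \<open>R\<close> does not depend on \<open>R'\<close>: most of the mass
  started anywhere in a ball eventually enters one fixed ball. A point reached from \<open>x\<close>
  after \<open>k\<close> steps splits into its first \<open>k\<close> coordinates, controlled by a
  box, and \<open>B k x\<close>, whose norm is at most 1 for large \<open>k\<close>.\<close>

lemma ball_tightness:
  assumes e: "0 < e"
  shows "\<exists>R\<ge>0. \<forall>R'. \<exists>k0. \<forall>k\<ge>k0. \<forall>x\<in>X. N x \<le> R' \<longrightarrow> (L ^^ k) (indicator (far R)) x \<le> e"
proof -
  obtain \<kappa> where \<kappa>: "\<kappa> \<in> X" "\<And>i. 0 < \<kappa> i"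
    "\<And>k x. x \<in> X \<Longrightarrow> (L ^^ k) (indicator {z \<in> X. \<exists>i<k. \<kappa> i < \<bar>z i\<bar>}) x \<le> e"
    using box_tightness[OF e] by blast
  show ?thesis
  proof (intro exI[of _ "N \<kappa> + 1"] conjI allI)
    fix R' :: real
    have "(\<lambda>k. s k * \<bar>R'\<bar> powr \<alpha>) \<longlonglongrightarrow> 0" by (rule tendsto_mult_left_zero[OF s_tendsto])
    then have "\<forall>\<^sub>F k in sequentially. s k * \<bar>R'\<bar> powr \<alpha> < 1" by (rule order_tendstoD) simp
    then obtain k0 where k0: "\<And>k. k \<ge> k0 \<Longrightarrow> s k * \<bar>R'\<bar> powr \<alpha> < 1" by (auto simp: eventually_sequentially)
    show "\<exists>k0. \<forall>k\<ge>k0. \<forall>x\<in>X. N x \<le> R' \<longrightarrow> (L ^^ k) (indicator (far (N \<kappa> + 1))) x \<le> e"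
    proof (intro exI[of _ k0] allI impI ballI)
      fix k x assume k: "k0 \<le> k" and x: "x \<in> X" and xR: "N x \<le> R'"
      let ?U = "{z \<in> X. \<exists>i<k. \<kappa> i < \<bar>z i\<bar>}"
      let ?g = "indicator (far R') :: (nat \<Rightarrow> real) \<Rightarrow> real"
      have incl: "N z \<le> N \<kappa> + 1" if z: "z \<in> X" "\<And>i. i < k \<Longrightarrow> \<bar>z i\<bar> \<le> \<kappa> i" "N ((sh ^^ k) z) \<le> R'" for z
      proof -
        let ?y = "(sh ^^ k) z"
        let ?h = "\<lambda>i. if i < k then z i else 0"
        have y: "?y \<in> X" using z(1) by (rule shn_mem)
        have h: "?h \<in> X" "N ?h \<le> N \<kappa>"
          using z(2) \<kappa>(2) by (auto intro!: solid_mem[OF \<kappa>(1)] solid_le[OF \<kappa>(1)] simp: abs_of_pos less_imp_le)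
        have "z = (\<lambda>i. ?h i + B k ?y i)"
          using weight_prod_pos[of _ k] by (auto simp: fun_eq_iff B_coord shn_coord less_imp_neq[THEN not_sym])
        then have "N z \<le> N ?h + N (B k ?y)" using N_triangle[OF h(1) B_mem[OF y, of k]] by simp
        moreover have "N (B k ?y) \<le> 1"
        proof (rule ccontr)
          assume "\<not> N (B k ?y) \<le> 1"
          then have "1 powr \<alpha> < N (B k ?y) powr \<alpha>" using \<alpha>_pos by (intro powr_less_mono2) auto
          also have "\<dots> \<le> s k * N ?y powr \<alpha>" by (rule B_powr[OF y])
          also have "\<dots> \<le> s k * \<bar>R'\<bar> powr \<alpha>" using z(3) \<alpha>_pos by (intro mult_left_mono powr_mono2) auto
          also have "\<dots> < 1" by (rule k0[OF k])
          finally show False by simp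
        qed
        ultimately show ?thesis using h(2) by linarith
      qed
      have gs: "(\<lambda>z. ?g ((sh ^^ k) z)) \<in> bm"
        by (rule bmI[of _ 1]) (use measurable_compose[OF shn_measurable bm_measurable[OF far_bm]] in \<open>auto simp: indicator_def\<close>)
      have "(L ^^ k) (indicator (far (N \<kappa> + 1))) x \<le> (L ^^ k) (\<lambda>z. indicator ?U z + ?g ((sh ^^ k) z)) x"
      proof (intro Ln_mono far_bm bm_add bm_indicator box_set gs x)
        fix z assume z: "z \<in> X"
        show "indicator (far (N \<kappa> + 1)) z \<le> indicator ?U z + ?g ((sh ^^ k) z)"
        proof (cases "z \<in> ?U \<or> (sh ^^ k) z \<in> far R'")
          case True
          then show ?thesis by (auto simp: indicator_def split: split_of_bool)
        next
          case False
          have "N z \<le> N \<kappa> + 1"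
          proof (rule incl[OF z])
            show "\<bar>z i\<bar> \<le> \<kappa> i" if "i < k" for i by (rule leI) (use False z that in blast)
            show "N ((sh ^^ k) z) \<le> R'" using False shn_mem[OF z, of k] by (auto simp: far_def not_less)
          qed
          then have "z \<notin> far (N \<kappa> + 1)" by (simp add: far_def)
          then show ?thesis by simp
        qed
      qed
      also have "\<dots> = (L ^^ k) (indicator ?U) x + ?g x"
        using Ln_add[OF bm_indicator[OF box_set] gs x] Ln_coshift[OF x, of k ?g] by simp
      \<comment> \<open>Seen through \<open>sh ^^ k\<close> the iterate is concentrated at the
        starting point, so this indicator contributes only its value at \<open>x\<close>.\<close>
      also have "?g x = 0" using xR by (simp add: far_def)
      finally show "(L ^^ k) (indicator (far (N \<kappa> + 1))) x \<le> e" using \<kappa>(3)[OF x, of k] by simp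
    qed
  qed simp
qed

text \<open>As the iterates of 1 are 1, a single Hoelder constant serves all iterates of a given
  function.\<close>

lemma Ln_Lip: assumes "\<phi> \<in> Lip" shows "(L ^^ n) \<phi> \<in> Lip"
    and "\<lbrakk>x \<in> X; y \<in> X\<rbrakk> \<Longrightarrow> \<bar>(L ^^ n) \<phi> x - (L ^^ n) \<phi> y\<bar> \<le> QA * Lip_norm \<phi> * D x y"
proof -
  note b = Lip_norm_bounds[OF assms]
  show 1: "\<bar>(L ^^ n) \<phi> x - (L ^^ n) \<phi> y\<bar> \<le> QA * Lip_norm \<phi> * D x y" if "x \<in> X" "y \<in> X" for x y
    using Ln_Lip_bound[of "Lip_norm \<phi>" \<phi> n 1 x y] b that Ln_one by simp
  show "(L ^^ n) \<phi> \<in> Lip"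
  proof (rule LipI)
    show "norm ((L ^^ n) \<phi> x) \<le> Lip_norm \<phi>" if "x \<in> X" for x
      using Ln_abs[OF Lip_bm[OF assms] _ that, of "Lip_norm \<phi>" n] b(1) by simp
  qed (use 1 in simp)
qed

text \<open>The constant to which \<open>L\<^sup>n \<phi>\<close> converges is the infimum of its eventual upper bounds on
  bounded sets: a point where \<open>L\<^sup>n \<phi>\<close> is almost maximal forces, by tightness, such a point in a
  fixed ball, the Harnack inequality spreads it over a larger ball, and tightness carries it to
  all later times.\<close>

lemma Ln_converges_const:
  assumes \<phi>: "\<phi> \<in> Lip"
  shows "\<exists>l. \<forall>x\<in>X. (\<lambda>n. (L ^^ n) \<phi> x) \<longlonglongrightarrow> l"
proof -
  define F where "F = Lip_norm \<phi>"
  define f where "f n = (L ^^ n) \<phi>" for n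
  have F0: "0 \<le> F" using Lip_norm_bounds(3)[OF \<phi>] by (simp add: F_def)
  have fb: "\<bar>f n x\<bar> \<le> F" if "x \<in> X" for n x
    using Ln_abs[OF Lip_bm[OF \<phi>] _ that, of F n] Lip_norm_bounds(1)[OF \<phi>] by (simp add: f_def F_def)
  have fbm: "f n \<in> bm" for n unfolding f_def by (intro Ln_bm Lip_bm \<phi>)
  have fL: "(L ^^ k) (f n) = f (k + n)" for k n by (simp add: f_def Ln_comp)
  define lc where "lc = QA * F"
  have lc: "0 \<le> lc" using QA_ge F0 by (simp add: lc_def)
  have fl: "\<bar>f n x - f n y\<bar> \<le> lc * D x y" if "x \<in> X" "y \<in> X" for n x y
    unfolding f_def lc_def F_def by (rule Ln_Lip(2)[OF \<phi> that])
  \<comment> \<open>Bounds that hold on each ball from some time on, where the time may depend on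
    the ball. Their infimum \<open>Ms\<close> is the candidate limit and an upper bound in this
    sense up to any \<open>d\<close>; the work lies in the lower bound \<open>key\<close>.\<close>
  define U where "U = {t. \<forall>R. \<exists>n0. \<forall>n\<ge>n0. \<forall>x\<in>X. N x \<le> R \<longrightarrow> f n x \<le> t}"
  have FU: "F \<in> U" unfolding U_def using fb by (fastforce simp: abs_le_iff)
  have Ulow: "- F \<le> t" if "t \<in> U" for t
  proof -
    from that obtain n0 where "\<forall>n\<ge>n0. \<forall>x\<in>X. N x \<le> 0 \<longrightarrow> f n x \<le> t" unfolding U_def by blast
    then have "f n0 (\<lambda>_. 0) \<le> t" by simp
    then show ?thesis using fb[OF zero_mem, of n0] by linarith
  qed
  define Ms where "Ms = Inf U"
  have Ms: "- F \<le> Ms" "Ms \<le> F"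
    unfolding Ms_def using FU Ulow by (auto intro!: cInf_greatest cInf_lower bdd_belowI)
  have upper: "\<exists>n0. \<forall>n\<ge>n0. \<forall>x\<in>X. N x \<le> R \<longrightarrow> f n x \<le> Ms + d" if d: "0 < d" for d R
  proof -
    obtain t where t: "t \<in> U" "t < Ms + d"
      using cInf_lessD[of U "Ms + d"] FU d unfolding Ms_def by auto
    from t(1) obtain n0 where "\<And>n x. n \<ge> n0 \<Longrightarrow> x \<in> X \<Longrightarrow> N x \<le> R \<Longrightarrow> f n x \<le> t" unfolding U_def by blast
    with t(2) show ?thesis by (intro exI[of _ n0]) fastforce
  qed
  have lower: "\<exists>R. \<forall>n0. \<exists>n\<ge>n0. \<exists>x\<in>X. N x \<le> R \<and> Ms - d < f n x" if d: "0 < d" for d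
  proof -
    have "bdd_below U" using Ulow by (rule bdd_belowI)
    then have "Ms - d \<notin> U" using cInf_lower[of "Ms - d" U] d unfolding Ms_def by auto
    then show ?thesis unfolding U_def by (auto simp: not_le)
  qed
  have key: "\<exists>n1. \<forall>n\<ge>n1. \<forall>x\<in>X. N x \<le> R' \<longrightarrow> Ms - e \<le> f n x" if e: "0 < e" for e R'
  proof -
    \<comment> \<open>The losses in the final estimate add up to
      \<open>(2 * F + 2) * e1\<close>.\<close>
    define e1 where "e1 = e / (2 * F + 2)"
    have e1: "0 < e1" using e F0 by (simp add: e1_def)
    obtain R where R: "0 \<le> R" "\<And>R'. \<exists>k0. \<forall>k\<ge>k0. \<forall>x\<in>X. N x \<le> R' \<longrightarrow> (L ^^ k) (indicator (far R)) x \<le> e1"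
      using ball_tightness[OF e1] by blast
    obtain R2 where R2: "0 \<le> R2" "\<And>R'. \<exists>k0. \<forall>k\<ge>k0. \<forall>x\<in>X. N x \<le> R' \<longrightarrow> (L ^^ k) (indicator (far R2)) x \<le> 1 / 2"
      using ball_tightness[of "1/2"] by auto
    \<comment> \<open>\<open>C'\<close> balances the averaging below: half of \<open>C' * d\<close>
      is lost to the mass outside radius \<open>R2\<close> and \<open>2 * F * d\<close> to that
      outside \<open>R1\<close>, and \<open>Ms - d\<close> must come out. \<open>CR\<close> collects
      the cost of the Harnack inequality between the balls of radius \<open>R2\<close> and
      \<open>R\<close>. Hence \<open>d\<close> is fixed after these radii, and \<open>R1\<close>
      after \<open>d\<close>.\<close>
    define C' where "C' = 4 + 4 * F"
    define W where "W = (R + R2) powr \<alpha>"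
    define CR where "CR = exp (KA * W) * (C' + 2 * F + 1)"
    have CR: "0 < CR" using F0 by (simp add: CR_def C'_def)
    define d where "d = min 1 (e1 / CR)"
    have d: "0 < d" "d \<le> 1" "CR * d \<le> e1" using e1 CR by (auto simp: d_def min_def field_simps)
    obtain R1 where R1: "0 \<le> R1" "\<And>R'. \<exists>k0. \<forall>k\<ge>k0. \<forall>x\<in>X. N x \<le> R' \<longrightarrow> (L ^^ k) (indicator (far R1)) x \<le> d"
      using ball_tightness[OF d(1)] by blast
    obtain n1 where n1: "\<And>n x. n \<ge> n1 \<Longrightarrow> x \<in> X \<Longrightarrow> N x \<le> R1 \<Longrightarrow> f n x \<le> Ms + d"
      using upper[OF d(1), of R1] by blast
    have above: "f n z \<le> Ms + d + 2 * F * indicator (far R1) z" if "n \<ge> n1" "z \<in> X" for n z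
      using n1[OF that] fb[OF that(2), of n] Ms d F0 that(2) by (cases "N z \<le> R1") (auto simp: far_def abs_le_iff)
    obtain Rd where Rd: "\<And>n0. \<exists>n\<ge>n0. \<exists>x\<in>X. N x \<le> Rd \<and> Ms - d < f n x"
      using lower[OF d(1)] by blast
    obtain k1a where k1a: "\<And>k x. k \<ge> k1a \<Longrightarrow> x \<in> X \<Longrightarrow> N x \<le> Rd \<Longrightarrow> (L ^^ k) (indicator (far R2)) x \<le> 1 / 2"
      using R2(2)[of Rd] by blast
    obtain k1b where k1b: "\<And>k x. k \<ge> k1b \<Longrightarrow> x \<in> X \<Longrightarrow> N x \<le> Rd \<Longrightarrow> (L ^^ k) (indicator (far R1)) x \<le> d"
      using R1(2)[of Rd] by blast
    define k1 where "k1 = max k1a k1b"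
    obtain k2a where k2a: "\<And>k x. k \<ge> k2a \<Longrightarrow> x \<in> X \<Longrightarrow> N x \<le> R2 \<Longrightarrow> (L ^^ k) (indicator (far R1)) x \<le> d"
      using R1(2)[of R2] by blast
    \<comment> \<open>Makes the Hoelder error term of \<open>harnack\<close> smaller than
      \<open>d\<close> once \<open>k2\<close> is large.\<close>
    have "(\<lambda>k. lc * s k * W) \<longlonglongrightarrow> lc * 0 * W" by (intro tendsto_intros s_tendsto)
    then have "\<forall>\<^sub>F k in sequentially. lc * s k * W < d" using d(1) by (intro order_tendstoD(2)[of _ "lc * 0 * W"]) auto
    then obtain k2b where k2b: "\<And>k. k \<ge> k2b \<Longrightarrow> lc * s k * W < d" by (auto simp: eventually_sequentially)
    define k2 where "k2 = max k2a k2b"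
    obtain n x where n: "n \<ge> n1 + k1 + k2" and x: "x \<in> X" "N x \<le> Rd" "Ms - d < f n x" using Rd by blast
    define n' where "n' = n - k1"
    define n'' where "n'' = n' - k2"
    have nn: "n = k1 + n'" "n' = k2 + n''" "n' \<ge> n1" "n'' \<ge> n1" using n by (auto simp: n'_def n''_def)
    \<comment> \<open>If \<open>f n'\<close> stayed below \<open>Ms + d - C' * d\<close> on the
      whole ball of radius \<open>R2\<close>, averaging over \<open>k1\<close> steps would push
      \<open>f n x\<close> down to \<open>Ms - d\<close>.\<close>
    have "\<exists>y\<in>X. N y \<le> R2 \<and> Ms + d - f n' y \<le> C' * d"
    proof (rule ccontr)
      assume "\<not> ?thesis"
      then have neg: "C' * d < Ms + d - f n' y" if "y \<in> X" "N y \<le> R2" for y using that by fastforce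
      have "f n x = (L ^^ k1) (f n') x" by (simp add: fL nn(1))
      also have "\<dots> \<le> (L ^^ k1) (\<lambda>z. (Ms + d - C' * d) + (C' * d * indicator (far R2) z + 2 * F * indicator (far R1) z)) x"
      proof (intro Ln_mono fbm bm_add bm_mult bm_const far_bm x)
        fix z assume z: "z \<in> X"
        show "f n' z \<le> Ms + d - C' * d + (C' * d * indicator (far R2) z + 2 * F * indicator (far R1) z)"
        proof (cases "N z \<le> R2")
          case True
          have "0 \<le> 2 * F * indicator (far R1) z" using F0 by (intro mult_nonneg_nonneg) auto
          with True show ?thesis using neg[OF z True] z by (simp add: far_def)
        next
          case False
          then show ?thesis using above[OF nn(3) z] z by (simp add: far_def)
        qed
      qed
      also have "\<dots> = (Ms + d - C' * d) + (C' * d * (L ^^ k1) (indicator (far R2)) x + 2 * F * (L ^^ k1) (indicator (far R1)) x)"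
        using x(1) by (simp add: Ln_add Ln_scale Ln_const1 far_bm bm_mult bm_add)
      also have "\<dots> \<le> (Ms + d - C' * d) + (C' * d * (1 / 2) + 2 * F * d)"
        using k1a[of k1 x] k1b[of k1 x] x F0 d by (intro add_left_mono add_mono mult_left_mono) (auto simp: k1_def C'_def)
      also have "\<dots> = Ms - d" by (simp add: C'_def algebra_simps)
      finally show False using x(3) by simp
    qed
    then obtain y where y: "y \<in> X" "N y \<le> R2" "Ms + d - f n' y \<le> C' * d" by blast
    \<comment> \<open>The deficit of \<open>f n''\<close> below \<open>Ms + d\<close> can be
      negative only outside radius \<open>R1\<close>. Its positive part is what the Harnack
      inequality accepts, and replacing the deficit by it costs at most \<open>2 * F * d\<close> at
      \<open>y\<close>.\<close>
    define g where "g z = max 0 (Ms + d - f n'' z)" for z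
    have gbm: "g \<in> bm" unfolding g_def by (intro bm_max bm_const bm_diff fbm)
    have gl: "g u \<le> g w + lc * D u w" if "u \<in> X" "w \<in> X" for u w
      using fl[OF that, of n''] mult_nonneg_nonneg[OF lc, of "D u w"] unfolding g_def by (simp add: abs_le_iff max_def)
    have Lg_y: "(L ^^ k2) g y \<le> C' * d + 2 * F * d"
    proof -
      have "(L ^^ k2) g y \<le> (L ^^ k2) (\<lambda>z. (Ms + d - f n'' z) + 2 * F * indicator (far R1) z) y"
      proof (intro Ln_mono gbm bm_add bm_diff bm_mult bm_const far_bm fbm y)
        fix z assume z: "z \<in> X"
        have "0 \<le> 2 * F * indicator (far R1) z" using F0 by (intro mult_nonneg_nonneg) auto
        then show "g z \<le> Ms + d - f n'' z + 2 * F * indicator (far R1) z"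
          unfolding g_def using above[OF nn(4) z] by (simp add: max_def)
      qed
      also have "\<dots> = (Ms + d - f n' y) + 2 * F * (L ^^ k2) (indicator (far R1)) y"
        using y(1) by (simp add: Ln_add Ln_diff Ln_scale Ln_const1 far_bm bm_mult bm_add bm_diff fbm fL nn(2))
      also have "\<dots> \<le> C' * d + 2 * F * d"
        using y(3) k2a[of k2 y] y F0 by (intro add_mono mult_left_mono) (auto simp: k2_def)
      finally show ?thesis .
    qed
    have ball: "Ms + d - f n' z \<le> e1" if z: "z \<in> X" "N z \<le> R" for z
    proof -
      have DW: "D z y \<le> W"
        unfolding W_def using N_diff_le[OF z(1) y(1)] z(2) y(2) \<alpha>_pos by (intro powr_mono2) auto
      have "Ms + d - f n' z = (L ^^ k2) (\<lambda>w. Ms + d - f n'' w) z"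
        using z(1) by (simp add: Ln_diff Ln_const1 fbm fL nn(2))
      also have "\<dots> \<le> (L ^^ k2) g z" by (intro Ln_mono gbm bm_diff bm_const fbm z) (simp add: g_def)
      also have "\<dots> \<le> exp (KA * D z y) * ((L ^^ k2) g y + lc * s k2 * D z y * (L ^^ k2) (\<lambda>_. 1) y)"
        by (rule harnack[OF gbm _ gl lc z(1) y(1)]) (simp_all add: g_def)
      also have "\<dots> \<le> exp (KA * W) * ((C' * d + 2 * F * d) + d)"
      proof (rule mult_mono)
        show "exp (KA * D z y) \<le> exp (KA * W)" using DW KA_nonneg by (simp add: mult_left_mono)
        have "lc * s k2 * D z y \<le> lc * s k2 * W" using DW lc by (intro mult_left_mono mult_nonneg_nonneg) auto
        also have "\<dots> \<le> d" using k2b[of k2] by (simp add: k2_def)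
        finally show "(L ^^ k2) g y + lc * s k2 * D z y * (L ^^ k2) (\<lambda>_. 1) y \<le> (C' * d + 2 * F * d) + d"
          using Lg_y y(1) by (simp add: Ln_one)
        show "0 \<le> (L ^^ k2) g y + lc * s k2 * D z y * (L ^^ k2) (\<lambda>_. 1) y"
          using lc y(1) by (intro add_nonneg_nonneg mult_nonneg_nonneg Ln_nonneg gbm bm_const) (auto simp: g_def)
      qed simp
      also have "\<dots> = CR * d" by (simp add: CR_def algebra_simps)
      finally show ?thesis using d(3) by linarith
    qed
    obtain k0 where k0: "\<And>k x. k \<ge> k0 \<Longrightarrow> x \<in> X \<Longrightarrow> N x \<le> R' \<Longrightarrow> (L ^^ k) (indicator (far R)) x \<le> e1"
      using R(2)[of R'] by blast
    show ?thesis
    proof (intro exI[of _ "k0 + n'"] allI impI ballI)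
      fix k x assume k: "k0 + n' \<le> k" and x: "x \<in> X" and xR: "N x \<le> R'"
      have "Ms + d - f k x = (L ^^ (k - n')) (\<lambda>w. Ms + d - f n' w) x"
        using x k by (simp add: Ln_diff Ln_const1 fbm fL)
      also have "\<dots> \<le> (L ^^ (k - n')) (\<lambda>z. e1 + (2 * F + 1) * indicator (far R) z) x"
      proof (intro Ln_mono bm_add bm_diff bm_mult bm_const far_bm fbm x)
        fix z assume z: "z \<in> X"
        show "Ms + d - f n' z \<le> e1 + (2 * F + 1) * indicator (far R) z"
        proof (cases "N z \<le> R")
          case True
          then show ?thesis using ball[OF z True] z by (simp add: far_def)
        next
          case False
          then show ?thesis using fb[OF z, of n'] Ms d e1 z by (simp add: far_def abs_le_iff)
        qed
      qed
      also have "\<dots> = e1 + (2 * F + 1) * (L ^^ (k - n')) (indicator (far R)) x"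
        using x by (simp add: Ln_add Ln_scale Ln_const1 far_bm bm_mult)
      also have "\<dots> \<le> e1 + (2 * F + 1) * e1"
        using k0[of "k - n'" x] k x xR F0 by (intro add_left_mono mult_left_mono) auto
      also have "\<dots> = (2 * F + 2) * e1" by (simp add: algebra_simps)
      also have "\<dots> = e"
      proof -
        have "2 * F + 2 \<noteq> 0" using F0 by linarith
        then show ?thesis unfolding e1_def by simp
      qed
      finally show "Ms - e \<le> f k x" using d by linarith
    qed
  qed
  have "(\<lambda>n. f n x) \<longlonglongrightarrow> Ms" if x: "x \<in> X" for x
  proof (rule LIMSEQ_I)
    fix e :: real assume e: "0 < e"
    obtain n0 where n0: "\<And>n. n \<ge> n0 \<Longrightarrow> f n x \<le> Ms + e / 2" using upper[of "e / 2" "N x"] e x by auto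
    obtain n1 where n1: "\<And>n. n \<ge> n1 \<Longrightarrow> Ms - e / 2 \<le> f n x" using key[of "e / 2" "N x"] e x by auto
    have "norm (f n x - Ms) < e" if "n \<ge> max n0 n1" for n
      using n0[of n] n1[of n] that e by (simp add: abs_less_iff)
    then show "\<exists>no. \<forall>n\<ge>no. norm (f n x - Ms) < e" by blast
  qed
  then show ?thesis unfolding f_def by blast
qed

end

section \<open>Hoelder approximation of indicators of open sets\<close>

context holder_space
begin

lemma Lip_const [intro]: "(\<lambda>_. t) \<in> Lip"
  by (rule LipI[of _ "norm t" 0]) auto

lemma Lip_add [intro]: assumes "f \<in> Lip" "g \<in> Lip" shows "(\<lambda>x. f x + g x :: real) \<in> Lip"
proof (rule LipI)
  fix x assume "x \<in> X"
  then show "norm (f x + g x) \<le> Lip_norm f + Lip_norm g"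
    using Lip_norm_bounds(1)[OF assms(1), of x] Lip_norm_bounds(1)[OF assms(2), of x] by simp
next
  fix x y assume "x \<in> X" "y \<in> X"
  then show "norm (f x + g x - (f y + g y)) \<le> (Lip_norm f + Lip_norm g) * D x y"
    using Lip_norm_bounds(2)[OF assms(1), of x y] Lip_norm_bounds(2)[OF assms(2), of x y] by (simp add: distrib_right)
qed

lemma Lip_mult [intro]: assumes "f \<in> Lip" "g \<in> Lip" shows "(\<lambda>x. f x * g x :: real) \<in> Lip"
proof (rule LipI)
  note b = Lip_norm_bounds[OF assms(1)] Lip_norm_bounds[OF assms(2)]
  fix x assume "x \<in> X"
  then show "norm (f x * g x) \<le> Lip_norm f * Lip_norm g"
    using b(1,4)[of x] b(3) by (simp add: abs_mult mult_mono)
next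
  note b = Lip_norm_bounds[OF assms(1)] Lip_norm_bounds[OF assms(2)]
  fix x y assume xy: "x \<in> X" "y \<in> X"
  have "f x * g x - f y * g y = f x * (g x - g y) + (f x - f y) * g y" by (simp add: algebra_simps)
  then have "norm (f x * g x - f y * g y) \<le> \<bar>f x\<bar> * \<bar>g x - g y\<bar> + \<bar>f x - f y\<bar> * \<bar>g y\<bar>"
    using abs_triangle_ineq[of "f x * (g x - g y)" "(f x - f y) * g y"] by (simp add: abs_mult)
  also have "\<dots> \<le> Lip_norm f * (Lip_norm g * D x y) + (Lip_norm f * D x y) * Lip_norm g"
    using b(1)[OF xy(1)] b(2)[OF xy] b(3) b(4)[OF xy(2)] b(5)[OF xy] by (intro add_mono mult_mono) auto
  finally show "norm (f x * g x - f y * g y) \<le> (2 * Lip_norm f * Lip_norm g) * D x y" by (simp add: mult_ac)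
qed

lemma Lip_diff [intro]: assumes "f \<in> Lip" "g \<in> Lip" shows "(\<lambda>x. f x - g x :: real) \<in> Lip"
  using Lip_add[OF assms(1) Lip_mult[OF Lip_const[of "-1"] assms(2)]] by simp

lemma Lip_max [intro]: assumes "f \<in> Lip" shows "(\<lambda>x. max t (f x) :: real) \<in> Lip"
proof (rule LipI)
  fix x assume "x \<in> X"
  then show "norm (max t (f x)) \<le> \<bar>t\<bar> + Lip_norm f"
    using Lip_norm_bounds(1)[OF assms, of x] by (auto simp: max_def)
next
  fix x y assume "x \<in> X" "y \<in> X"
  moreover have "\<bar>max t (f x) - max t (f y)\<bar> \<le> \<bar>f x - f y\<bar>" by (auto simp: max_def)
  ultimately show "norm (max t (f x) - max t (f y)) \<le> Lip_norm f * D x y"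
    using Lip_norm_bounds(2)[OF assms, of x y] by simp
qed

lemma Lip_min [intro]: assumes "f \<in> Lip" shows "(\<lambda>x. min t (f x) :: real) \<in> Lip"
proof -
  have "(\<lambda>x. -1 * max (- t) (-1 * f x)) \<in> Lip" using assms by (intro Lip_mult Lip_const Lip_max)
  also have "(\<lambda>x. -1 * max (- t) (-1 * f x)) = (\<lambda>x. min t (f x))" by (auto simp: fun_eq_iff)
  finally show ?thesis .
qed

text \<open>The distance to the complement of \<open>U\<close> in the metric \<open>D\<close>, cut
  off at 1; the case distinction avoids the infimum of an empty set. As an infimum of distances it
  is 1-Lipschitz for \<open>D\<close>.\<close>

definition gap :: "(nat \<Rightarrow> real) set \<Rightarrow> (nat \<Rightarrow> real) \<Rightarrow> real" where
  "gap U x = (if X \<subseteq> U then 1 else min 1 (INF y\<in>X - U. D x y))"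

lemma bm_sum: "finite S \<Longrightarrow> (\<And>i. i \<in> S \<Longrightarrow> f i \<in> bm) \<Longrightarrow> (\<lambda>x. \<Sum>i\<in>S. f i x) \<in> bm"
  by (induction S rule: finite_induct) auto

lemma gap_bounds: "0 \<le> gap U x" "gap U x \<le> 1"
  unfolding gap_def by (auto intro!: cINF_greatest)

lemma gap_lip: assumes xy: "x \<in> X" "y \<in> X" shows "\<bar>gap U x - gap U y\<bar> \<le> D x y"
proof -
  have *: "(INF z\<in>X - U. D x z) \<le> D x y + (INF z\<in>X - U. D y z)" if "\<not> X \<subseteq> U" "x \<in> X" "y \<in> X" for x y
  proof -
    have "(INF z\<in>X - U. D x z) - D x y \<le> D y z" if z: "z \<in> X - U" for z
      using cINF_lower[of "\<lambda>z. D x z" "X - U" z] z D_triangle[of x y z] \<open>x \<in> X\<close> \<open>y \<in> X\<close>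
      by (force intro: bdd_belowI2[of _ 0])
    then have "(INF z\<in>X - U. D x z) - D x y \<le> (INF z\<in>X - U. D y z)"
      using that by (intro cINF_greatest) auto
    then show ?thesis by linarith
  qed
  show ?thesis
  proof (cases "X \<subseteq> U")
    case False
    with * [of x y] * [of y x] xy show ?thesis
      unfolding gap_def D_commute[of y x] by (simp add: abs_le_iff min_def)
  qed (simp add: gap_def)
qed

lemma gap_Lip: "gap U \<in> Lip"
  by (rule LipI[of _ 1 1]) (use gap_bounds gap_lip in auto)

lemma gap_pos: assumes U: "openin T U" and x: "x \<in> U" shows "0 < gap U x"
proof (cases "X \<subseteq> U")
  case False
  obtain r where r: "r > 0" "\<And>y. y \<in> X \<Longrightarrow> N (\<lambda>i. x i - y i) < r \<Longrightarrow> y \<in> U"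
    using U x unfolding openin_T by blast
  have "r powr \<alpha> \<le> (INF y\<in>X - U. D x y)"
  proof (rule cINF_greatest)
    fix y assume y: "y \<in> X - U"
    then have "r \<le> N (\<lambda>i. x i - y i)" using r(2)[of y] by force
    then show "r powr \<alpha> \<le> D x y" using r(1) \<alpha>_pos by (intro powr_mono2) auto
  qed (use False in auto)
  moreover have "0 < r powr \<alpha>" using r by simp
  ultimately have "0 < (INF y\<in>X - U. D x y)" by linarith
  then show ?thesis using False by (simp add: gap_def)
qed (simp add: gap_def)

lemma gap_zero: "x \<in> X \<Longrightarrow> x \<notin> U \<Longrightarrow> gap U x = 0"
proof -
  assume x: "x \<in> X" "x \<notin> U"
  then have "(INF y\<in>X - U. D x y) \<le> D x x" by (intro cINF_lower) (auto intro!: bdd_belowI2[of _ 0])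
  moreover have "\<not> X \<subseteq> U" using x by blast
  ultimately have "gap U x \<le> 0" by (simp add: gap_def min_le_iff_disj)
  with gap_bounds(1)[of U x] show ?thesis by simp
qed

definition bump :: "(nat \<Rightarrow> real) set \<Rightarrow> nat \<Rightarrow> (nat \<Rightarrow> real) \<Rightarrow> real" where
  "bump U j x = min 1 (real j * gap U x)"

lemma bump_Lip: "bump U j \<in> Lip"
  unfolding bump_def[abs_def] by (intro Lip_min Lip_mult Lip_const gap_Lip)

lemma bump_bounds: "0 \<le> bump U j x" "bump U j x \<le> 1"
  using gap_bounds[of U x] by (auto simp: bump_def)

lemma bump_mono: "bump U j x \<le> bump U (Suc j) x"
  using gap_bounds(1)[of U x] by (auto simp: bump_def min_le_iff_disj distrib_right)

lemma bump_outside: "x \<in> X \<Longrightarrow> x \<notin> U \<Longrightarrow> bump U j x = 0"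
  by (simp add: bump_def gap_zero)

lemma bump_eventually: assumes "openin T U" "x \<in> U" shows "\<exists>j0. \<forall>j\<ge>j0. bump U j x = 1"
proof -
  note g = gap_pos[OF assms]
  obtain j0 :: nat where j0: "1 / gap U x < real j0" using reals_Archimedean2 by blast
  have "bump U j x = 1" if "j \<ge> j0" for j
  proof -
    have "1 / gap U x \<le> real j" using j0 that by linarith
    then have "1 \<le> real j * gap U x" using g by (simp add: divide_le_eq)
    then show ?thesis by (simp add: bump_def)
  qed
  then show ?thesis by blast
qed

lemma bump_tendsto: assumes "openin T U" "x \<in> X" shows "(\<lambda>j. bump U j x) \<longlonglongrightarrow> indicator U x"
proof (cases "x \<in> U")
  case True
  then obtain j0 where "\<forall>j\<ge>j0. bump U j x = 1" using bump_eventually[OF assms(1)] by blast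
  then have "\<forall>\<^sub>F j in sequentially. bump U j x = indicator U x" using True by (auto simp: eventually_sequentially)
  then show ?thesis by (rule tendsto_eventually)
next
  case False
  then show ?thesis using assms(2) by (simp add: bump_outside)
qed

lemma bm_integrable: assumes "finite_measure \<mu>" "sets \<mu> = sets \<B>" "f \<in> bm" shows "integrable \<mu> f"
proof -
  interpret finite_measure \<mu> by fact
  obtain B where B: "\<And>x. x \<in> X \<Longrightarrow> \<bar>f x\<bar> \<le> B" using assms(3) by (metis bmE)
  have sp: "space \<mu> = X" using sets_eq_imp_space_eq[OF assms(2)] by simp
  show ?thesis
  proof (rule integrable_const_bound)
    show "AE x in \<mu>. norm (f x) \<le> B" using B by (intro AE_I2) (simp add: sp)
    show "f \<in> borel_measurable \<mu>" using bm_measurable[OF assms(3)] measurable_cong_sets[OF assms(2) refl] by blast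
  qed
qed

lemma integral_bump_tendsto:
  assumes \<mu>: "finite_measure \<mu>" "sets \<mu> = sets \<B>" and U: "openin T U"
  shows "(\<lambda>j. \<integral>x. bump U j x \<partial>\<mu>) \<longlonglongrightarrow> measure \<mu> U"
proof -
  have sp: "space \<mu> = X" using sets_eq_imp_space_eq[OF \<mu>(2)] by simp
  have US: "U \<in> sets \<mu>" using openin_sets[OF U] \<mu>(2) by simp
  have "(\<lambda>j. \<integral>x. bump U j x \<partial>\<mu>) \<longlonglongrightarrow> (\<integral>x. indicator U x \<partial>\<mu>)"
  proof (rule integral_dominated_convergence[where w="\<lambda>_. 1"])
    show "integrable \<mu> (\<lambda>_. 1 :: real)" by (rule bm_integrable[OF \<mu> bm_const])
    show "bump U j \<in> borel_measurable \<mu>" for j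
      by (rule borel_measurable_integrable[OF bm_integrable[OF \<mu> Lip_bm[OF bump_Lip]]])
    show "AE x in \<mu>. (\<lambda>j. bump U j x) \<longlonglongrightarrow> indicator U x" using bump_tendsto[OF U] by (intro AE_I2) (simp add: sp)
    show "AE x in \<mu>. norm (bump U j x) \<le> 1" for j using bump_bounds[of U j] by (intro AE_I2) simp
  qed (use US in simp)
  then show ?thesis using sets.sets_into_space[OF US] by (simp add: Int_absorb2)
qed

text \<open>Open sets are stable under intersection, and their measures are limits of integrals of
  bumps.\<close>

lemma measure_eq_Lip:
  assumes \<mu>: "finite_measure \<mu>" "sets \<mu> = sets \<B>" and \<nu>: "finite_measure \<nu>" "sets \<nu> = sets \<B>"
    and eq: "\<And>f :: (nat \<Rightarrow> real) \<Rightarrow> real. f \<in> Lip \<Longrightarrow> (\<integral>x. f x \<partial>\<mu>) = (\<integral>x. f x \<partial>\<nu>)"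
  shows "\<mu> = \<nu>"
proof (rule measure_eqI_generator_eq)
  show "Int_stable {U. openin T U}" by (auto simp: Int_stable_def)
  show "{U. openin T U} \<subseteq> Pow X" using openin_subset[of T] by auto
  show "sets \<mu> = sigma_sets X {U. openin T U}" "sets \<nu> = sigma_sets X {U. openin T U}"
    using \<mu> \<nu> sets_borel by auto
  show "range (\<lambda>_::nat. X) \<subseteq> {U. openin T U}" using openin_topspace[of T] by auto
  show "emeasure \<mu> ((\<lambda>_::nat. X) i) \<noteq> \<infinity>" for i using finite_measure.emeasure_finite[OF \<mu>(1)] by simp
  fix U assume "U \<in> {U. openin T U}"
  then have U: "openin T U" by simp
  have "measure \<mu> U = measure \<nu> U"
    using LIMSEQ_unique[OF integral_bump_tendsto[OF \<mu> U]] integral_bump_tendsto[OF \<nu> U] eq[OF bump_Lip] by simp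
  then show "emeasure \<mu> U = emeasure \<nu> U"
    using \<mu>(1) \<nu>(1) by (simp add: finite_measure.emeasure_eq_measure)
qed simp

end

section \<open>Measures from functionals on Hoelder functions\<close>

text \<open>Riesz representation asks for local compactness, which \<open>X\<close> does not have,
  so Daniell's continuity condition takes its place. \<open>I_cover\<close> expresses it as a
  covering inequality, the form in which compactness of boxes delivers it.\<close>

locale daniell_functional = holder_space +
  fixes I :: "((nat \<Rightarrow> real) \<Rightarrow> real) \<Rightarrow> real"
  assumes I_add: "\<lbrakk>f \<in> Lip; g \<in> Lip\<rbrakk> \<Longrightarrow> I (\<lambda>x. f x + g x) = I f + I g"
    and I_scale: "f \<in> Lip \<Longrightarrow> I (\<lambda>x. t * f x) = t * I f"
    and I_mono: "\<lbrakk>f \<in> Lip; g \<in> Lip; \<And>x. x \<in> X \<Longrightarrow> f x \<le> g x\<rbrakk> \<Longrightarrow> I f \<le> I g"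
    and I_one: "I (\<lambda>_. 1) = 1"
    and I_cover: "\<lbrakk>\<And>n. F n \<in> Lip; \<And>n x. x \<in> X \<Longrightarrow> 0 \<le> F n x; \<And>x. x \<in> X \<Longrightarrow> 1 \<le> (\<Sum>n::nat. ennreal (F n x))\<rbrakk>
      \<Longrightarrow> 1 \<le> (\<Sum>n. ennreal (I (F n)))"
begin

lemma I_const: "I (\<lambda>_. t) = t"
  using I_scale[of "\<lambda>_. 1" t] I_one by auto

lemma I_nonneg: "\<lbrakk>f \<in> Lip; \<And>x. x \<in> X \<Longrightarrow> 0 \<le> f x\<rbrakk> \<Longrightarrow> 0 \<le> I f"
  using I_mono[of "\<lambda>_. 0" f] I_const[of 0] by auto

lemma I_cong: "\<lbrakk>f \<in> Lip; g \<in> Lip; \<And>x. x \<in> X \<Longrightarrow> f x = g x\<rbrakk> \<Longrightarrow> I f = I g"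
  by (intro antisym I_mono) auto

lemma I_diff: "\<lbrakk>f \<in> Lip; g \<in> Lip\<rbrakk> \<Longrightarrow> I (\<lambda>x. f x - g x) = I f - I g"
  using I_add[of f "\<lambda>x. -1 * g x"] I_scale[of g "-1"] Lip_mult[OF Lip_const[of "-1"], of g] by simp

lemma I_sum: "finite S \<Longrightarrow> (\<And>i. i \<in> S \<Longrightarrow> f i \<in> Lip) \<Longrightarrow> (\<lambda>x. \<Sum>i\<in>S. f i x) \<in> Lip \<and> I (\<lambda>x. \<Sum>i\<in>S. f i x) = (\<Sum>i\<in>S. I (f i))"
  by (induction S rule: finite_induct) (auto simp: I_const I_add)

definition cover :: "(nat \<Rightarrow> (nat \<Rightarrow> real) \<Rightarrow> real) \<Rightarrow> (nat \<Rightarrow> real) set \<Rightarrow> bool" where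
  "cover f S \<longleftrightarrow> (\<forall>n. f n \<in> Lip \<and> (\<forall>x\<in>X. 0 \<le> f n x)) \<and> (\<forall>x\<in>S. 1 \<le> (\<Sum>n. ennreal (f n x)))"

definition cost :: "(nat \<Rightarrow> (nat \<Rightarrow> real) \<Rightarrow> real) \<Rightarrow> ennreal" where
  "cost f = (\<Sum>n. ennreal (I (f n)))"

text \<open>The usual outer measure construction with nonnegative Hoelder functions in place of
  covering sets, so that a cover can be cut by multiplication with a bump.\<close>

definition outer :: "(nat \<Rightarrow> real) set \<Rightarrow> ennreal" where
  "outer S = (INF f\<in>{f. cover f S}. cost f)"

lemma outer_le: "cover f S \<Longrightarrow> outer S \<le> cost f"
  unfolding outer_def by (rule INF_lower) simp

lemma single_cover:
  assumes "f \<in> Lip" "\<And>x. x \<in> X \<Longrightarrow> 0 \<le> f x" "\<And>x. x \<in> S \<Longrightarrow> 1 \<le> f x"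
  shows "outer S \<le> ennreal (I f)"
proof -
  let ?f = "\<lambda>n::nat. if n = 0 then f else (\<lambda>_. 0)"
  have s: "(\<Sum>n. ennreal (?f n x)) = ennreal (f x)" for x
    using sums_unique[OF sums_single[of 0 "\<lambda>_. ennreal (f x)"]] by (simp add: if_distrib if_distribR cong: if_cong)
  have "cost ?f = ennreal (I f)"
    unfolding cost_def using sums_unique[OF sums_single[of 0 "\<lambda>_. ennreal (I f)"]]
    by (simp add: if_distrib[of I] if_distrib[of ennreal] I_const cong: if_cong)
  moreover have "cover ?f S" unfolding cover_def s using assms by auto
  ultimately show ?thesis using outer_le by metis
qed

lemma outer_space: "outer_measure_space (Pow X) outer"
  unfolding outer_measure_space_def
proof (intro conjI)
  show "positive (Pow X) outer"
    using single_cover[of "\<lambda>_. 0" "{}"] by (auto simp: positive_def I_const)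
  show "increasing (Pow X) outer"
    unfolding increasing_def outer_def by (auto intro!: INF_superset_mono simp: cover_def)
  show "countably_subadditive (Pow X) outer"
    unfolding countably_subadditive_def
  proof (intro allI impI)
    fix A :: "nat \<Rightarrow> (nat \<Rightarrow> real) set"
    show "outer (\<Union>i. A i) \<le> (\<Sum>i. outer (A i))"
    proof (rule ennreal_le_epsilon)
      fix e :: real assume fin: "(\<Sum>i. outer (A i)) < top" and e: "0 < e"
      have "\<exists>f. cover f (A i) \<and> cost f \<le> outer (A i) + ennreal (e * (1/2) ^ Suc i)" for i
      proof -
        have "outer (A i) < top" using ennreal_suminf_lessD[OF fin] by simp
        then have "outer (A i) < outer (A i) + ennreal (e * (1/2) ^ Suc i)"
          using e by (simp add: ennreal_add_left_cancel_less[of _ 0, simplified])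
        then show ?thesis unfolding outer_def INF_less_iff by (auto intro: less_imp_le)
      qed
      then obtain f where f: "\<And>i. cover (f i) (A i)" "\<And>i. cost (f i) \<le> outer (A i) + ennreal (e * (1/2) ^ Suc i)" by metis
      define g where "g k = (case prod_decode k of (i, n) \<Rightarrow> f i n)" for k
      have s: "(\<Sum>k. ennreal (g k x)) = (\<Sum>i. \<Sum>n. ennreal (f i n x))" for x
        using suminf_ennreal_2dimen[of "\<lambda>i. \<Sum>n. ennreal (f i n x)" "\<lambda>(i, n). ennreal (f i n x)"]
        by (simp add: g_def split_beta)
      have c: "cost g = (\<Sum>i. cost (f i))"
        using suminf_ennreal_2dimen[of "\<lambda>i. cost (f i)" "\<lambda>(i, n). ennreal (I (f i n))"]
        by (simp add: g_def split_beta cost_def)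
      have "cover g (\<Union>i. A i)"
        unfolding cover_def
      proof (intro conjI ballI allI)
        show "g k \<in> Lip" "\<And>x. x \<in> X \<Longrightarrow> 0 \<le> g k x" for k using f(1) by (auto simp: g_def cover_def split: prod.split)
        fix x assume "x \<in> (\<Union>i. A i)"
        then obtain i where "x \<in> A i" by blast
        then have "1 \<le> (\<Sum>n. ennreal (f i n x))" using f(1)[of i] by (simp add: cover_def)
        also have "\<dots> \<le> (\<Sum>i. \<Sum>n. ennreal (f i n x))"
          using sum_le_suminf[of "\<lambda>i. \<Sum>n. ennreal (f i n x)" "{i}"] by simp
        finally show "1 \<le> (\<Sum>k. ennreal (g k x))" by (simp add: s)
      qed
      then have "outer (\<Union>i. A i) \<le> (\<Sum>i. cost (f i))" using outer_le c by metis
      also have "\<dots> \<le> (\<Sum>i. outer (A i) + ennreal (e * (1/2) ^ Suc i))" by (intro suminf_le f(2)) auto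
      also have "\<dots> = (\<Sum>i. outer (A i)) + (\<Sum>i. ennreal (e * (1/2) ^ Suc i))" by (rule suminf_add[symmetric]) auto
      also have "(\<Sum>i. ennreal (e * (1/2) ^ Suc i)) = ennreal e"
      proof (rule suminf_ennreal_eq)
        show "(\<lambda>i. e * (1/2) ^ Suc i) sums e" using sums_mult[OF power_half_series, of e] by (simp only: mult_1_right)
      qed (use e in simp)
      finally show "outer (\<Union>i. A i) \<le> (\<Sum>i. outer (A i)) + ennreal e" .
    qed
  qed
qed

text \<open>A cover \<open>f\<close> of \<open>S\<close> splits along the increasing bumps of \<open>U\<close>: the products with the bump
  increments cover \<open>S \<inter> U\<close>, and the products with one minus a bump cover \<open>S - U\<close>.\<close>

lemma outer_split:
  assumes U: "openin T U" and S: "S \<subseteq> X" and f: "cover f S"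
  shows "outer (U \<inter> S) + outer ((X - U) \<inter> S) \<le> cost f"
proof -
  have fL: "f n \<in> Lip" "x \<in> X \<Longrightarrow> 0 \<le> f n x" for n x using f by (auto simp: cover_def)
  let ?h = "bump U"
  \<comment> \<open>The increments telescope, so the countable family \<open>f n * u j\<close>
    covers \<open>U \<inter> S\<close> by Hoelder functions, although
    \<open>f n * indicator U\<close> need not be one.\<close>
  define u where "u j x = ?h (Suc j) x - ?h j x" for j x
  have u0: "0 \<le> u j x" for j x using bump_mono by (simp add: u_def)
  have uL: "u j \<in> Lip" for j unfolding u_def by (intro Lip_diff bump_Lip)
  have us: "(\<Sum>j<J. u j x) = ?h J x" for J x
    unfolding u_def by (subst sum_lessThan_telescope) (simp add: bump_def)
  define p where "p n J = I (\<lambda>x. f n x * ?h J x)" for n J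
  have pL: "(\<lambda>x. f n x * ?h J x) \<in> Lip" for n J by (intro Lip_mult fL bump_Lip)
  have p0: "0 \<le> p n J" for n J unfolding p_def by (intro I_nonneg pL mult_nonneg_nonneg fL bump_bounds)
  have pm: "incseq (p n)" for n
    unfolding p_def by (intro incseq_SucI I_mono pL mult_left_mono bump_mono fL)
  define g where "g k = (case prod_decode k of (n, j) \<Rightarrow> (\<lambda>x. f n x * u j x))" for k
  have gs: "(\<Sum>k. ennreal (g k x)) = (\<Sum>n. \<Sum>j. ennreal (f n x * u j x))" for x
    using suminf_ennreal_2dimen[of "\<lambda>n. \<Sum>j. ennreal (f n x * u j x)" "\<lambda>(n, j). ennreal (f n x * u j x)"]
    by (simp add: g_def split_beta)
  have "cost g = (\<Sum>n. \<Sum>j. ennreal (I (\<lambda>x. f n x * u j x)))"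
    unfolding cost_def using suminf_ennreal_2dimen[of "\<lambda>n. \<Sum>j. ennreal (I (\<lambda>x. f n x * u j x))" "\<lambda>(n, j). ennreal (I (\<lambda>x. f n x * u j x))"]
    by (simp add: g_def split_beta)
  also have "\<dots> = (\<Sum>n. SUP J. ennreal (p n J))"
  proof (rule suminf_cong)
    fix n
    have "(\<Sum>j<J. ennreal (I (\<lambda>x. f n x * u j x))) = ennreal (p n J)" for J
    proof -
      have fu: "(\<lambda>x. f n x * u j x) \<in> Lip" for j by (intro Lip_mult fL uL)
      have "(\<Sum>j<J. ennreal (I (\<lambda>x. f n x * u j x))) = ennreal (\<Sum>j<J. I (\<lambda>x. f n x * u j x))"
        by (intro sum_ennreal I_nonneg fu mult_nonneg_nonneg fL u0)
      also have "(\<Sum>j<J. I (\<lambda>x. f n x * u j x)) = I (\<lambda>x. \<Sum>j<J. f n x * u j x)"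
        using I_sum[of "{..<J}" "\<lambda>j x. f n x * u j x"] fu by simp
      also have "\<dots> = p n J" unfolding p_def sum_distrib_left[symmetric] us ..
      finally show ?thesis .
    qed
    then show "(\<Sum>j. ennreal (I (\<lambda>x. f n x * u j x))) = (SUP J. ennreal (p n J))"
      by (simp add: suminf_eq_SUP)
  qed
  \<comment> \<open>Monotone convergence for series. For fixed \<open>J\<close> the inner sum is the
    cost of the family \<open>f n * ?h J\<close>, and together with the cost of
    \<open>f n * (1 - ?h J)\<close> it gives back the cost of \<open>f\<close>.\<close>
  also have "\<dots> = (SUP J. \<Sum>n. ennreal (p n J))"
    by (rule ennreal_suminf_SUP_eq) (use pm in \<open>auto simp: incseq_def intro: ennreal_leI\<close>)
  finally have costg: "cost g = (SUP J. \<Sum>n. ennreal (p n J))" .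
  have "cover g (U \<inter> S)"
    unfolding cover_def
  proof (intro conjI ballI allI)
    show "g k \<in> Lip" "\<And>x. x \<in> X \<Longrightarrow> 0 \<le> g k x" for k
      by (auto simp: g_def intro!: Lip_mult fL uL mult_nonneg_nonneg u0 split: prod.split)
    fix x assume x: "x \<in> U \<inter> S"
    then have xX: "x \<in> X" using S by blast
    obtain J where J: "?h J x = 1" using bump_eventually[OF U, of x] x by blast
    have "1 \<le> (\<Sum>n. ennreal (f n x))" using f x by (simp add: cover_def)
    also have "\<dots> \<le> (\<Sum>n. \<Sum>j. ennreal (f n x * u j x))"
    proof (rule suminf_le)
      fix n
      have "ennreal (f n x) = ennreal (\<Sum>j<J. f n x * u j x)" unfolding sum_distrib_left[symmetric] us J by simp
      also have "\<dots> = (\<Sum>j<J. ennreal (f n x * u j x))"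
        by (rule sum_ennreal[symmetric]) (intro mult_nonneg_nonneg fL u0 xX)
      also have "\<dots> \<le> (\<Sum>j. ennreal (f n x * u j x))" by (rule sum_le_suminf) auto
      finally show "ennreal (f n x) \<le> (\<Sum>j. ennreal (f n x * u j x))" .
    qed auto
    finally show "1 \<le> (\<Sum>k. ennreal (g k x))" by (simp add: gs)
  qed
  then have 1: "outer (U \<inter> S) \<le> (SUP J. \<Sum>n. ennreal (p n J))" using outer_le costg by metis
  have 2: "outer ((X - U) \<inter> S) + (\<Sum>n. ennreal (p n J)) \<le> cost f" for J
  proof -
    let ?q = "\<lambda>n x. f n x * (1 - ?h J x)"
    have qL: "?q n \<in> Lip" for n by (intro Lip_mult Lip_diff Lip_const fL bump_Lip)
    have q0: "0 \<le> ?q n x" if "x \<in> X" for n x using that bump_bounds(2)[of U J x] by (intro mult_nonneg_nonneg fL) auto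
    have "cover ?q ((X - U) \<inter> S)"
      unfolding cover_def
    proof (intro conjI ballI allI qL q0)
      fix x assume x: "x \<in> (X - U) \<inter> S"
      then show "1 \<le> (\<Sum>n. ennreal (?q n x))" using f by (simp add: cover_def bump_outside)
    qed
    then have "outer ((X - U) \<inter> S) + (\<Sum>n. ennreal (p n J)) \<le> cost ?q + (\<Sum>n. ennreal (p n J))"
      by (intro add_right_mono outer_le)
    also have "\<dots> = (\<Sum>n. ennreal (I (?q n)) + ennreal (p n J))"
      unfolding cost_def by (rule suminf_add) auto
    also have "\<dots> = cost f"
      unfolding cost_def
    proof (rule suminf_cong)
      fix n
      have "I (?q n) + p n J = I (\<lambda>x. ?q n x + f n x * ?h J x)" unfolding p_def by (rule I_add[OF qL pL, symmetric])
      also have "(\<lambda>x. ?q n x + f n x * ?h J x) = f n" by (simp add: fun_eq_iff algebra_simps)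
      finally show "ennreal (I (?q n)) + ennreal (p n J) = ennreal (I (f n))"
        using I_nonneg[OF qL q0] p0 by (simp flip: ennreal_plus)
    qed
    finally show ?thesis .
  qed
  have "outer (U \<inter> S) + outer ((X - U) \<inter> S) \<le> (SUP J. \<Sum>n. ennreal (p n J)) + outer ((X - U) \<inter> S)"
    using 1 by (rule add_right_mono)
  also have "\<dots> = (SUP J. (\<Sum>n. ennreal (p n J)) + outer ((X - U) \<inter> S))"
    by (rule ennreal_SUP_add_left[symmetric]) simp
  also have "\<dots> \<le> cost f" using 2 by (intro SUP_least) (simp add: add.commute)
  finally show ?thesis .
qed

lemma open_lambda: assumes U: "openin T U" shows "U \<in> lambda_system X (Pow X) outer"
proof -
  interpret sigma_algebra X "Pow X" by (rule sigma_algebra_Pow)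
  have sub: "subadditive (Pow X) outer"
    using outer_space by (intro countably_subadditive_subadditive) (auto simp: outer_measure_space_def)
  have "outer (U \<inter> S) + outer ((X - U) \<inter> S) = outer S" if S: "S \<in> Pow X" for S
  proof (rule antisym)
    show "outer (U \<inter> S) + outer ((X - U) \<inter> S) \<le> outer S"
      unfolding outer_def[of S] by (rule INF_greatest) (use S outer_split[OF U] in auto)
    have "outer ((U \<inter> S) \<union> ((X - U) \<inter> S)) \<le> outer (U \<inter> S) + outer ((X - U) \<inter> S)"
      using S by (intro subadditiveD[OF sub]) auto
    also have "(U \<inter> S) \<union> ((X - U) \<inter> S) = S" using S by auto
    finally show "outer S \<le> outer (U \<inter> S) + outer ((X - U) \<inter> S)" .
  qed
  then show ?thesis using openin_subset[OF U] by (auto simp: lambda_system_def)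
qed

definition dmeasure :: "(nat \<Rightarrow> real) measure" where
  "dmeasure = measure_of X {U. openin T U} outer"

lemma sets_dmeasure: "sets dmeasure = sets \<B>"
  unfolding dmeasure_def sets_borel using openin_subset[of T] by (subst sets_measure_of) auto

lemma space_dmeasure: "space dmeasure = X"
  using sets_eq_imp_space_eq[OF sets_dmeasure] by simp

lemma emeasure_dmeasure: assumes "S \<in> sets \<B>" shows "emeasure dmeasure S = outer S"
proof -
  interpret sigma_algebra X "Pow X" by (rule sigma_algebra_Pow)
  have ms: "measure_space X (lambda_system X (Pow X) outer) outer"
    by (rule caratheodory_lemma[OF outer_space])
  have "sigma_sets X {U. openin T U} \<subseteq> lambda_system X (Pow X) outer"
    using ms open_lambda by (intro sigma_algebra.sigma_sets_subset) (auto simp: measure_space_def)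
  moreover have "sigma_algebra X (sigma_sets X {U. openin T U})"
    using openin_subset[of T] by (intro sigma_algebra_sigma_sets) auto
  ultimately have "measure_space X (sigma_sets X {U. openin T U}) outer" by (intro measure_down[OF ms])
  then have "positive (sets dmeasure) outer" "countably_additive (sets dmeasure) outer"
    by (simp_all add: measure_space_def sets_dmeasure sets_borel)
  moreover have "{U. openin T U} \<subseteq> Pow X" using openin_subset[of T] by auto
  ultimately show ?thesis
    using assms by (intro emeasure_measure_of[OF dmeasure_def]) (simp_all add: sets_dmeasure)
qed

text \<open>This is where \<open>I_cover\<close> enters: no cover of \<open>X\<close> costs less
  than 1. The total mass 1 later upgrades a one-sided estimate of integrals to an identity.\<close>

lemma prob_space_dmeasure: "prob_space dmeasure"
proof
  have "outer X = 1"
  proof (rule antisym)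
    show "outer X \<le> 1" using single_cover[of "\<lambda>_. 1" X] by (simp add: I_one Lip_const)
    show "1 \<le> outer X" unfolding outer_def cost_def by (rule INF_greatest) (auto simp: cover_def intro!: I_cover)
  qed
  moreover have "X \<in> sets \<B>" using sets.top[of \<B>] by simp
  ultimately show "emeasure dmeasure (space dmeasure) = 1" by (simp add: space_dmeasure emeasure_dmeasure)
qed

lemma staircase: "0 \<le> y \<Longrightarrow> (\<Sum>i<n. min 1 (max 0 (y - real i))) = min (real n) y"
  by (induction n) (auto simp: min_def max_def)

text \<open>A layer-cake argument: \<open>real n * f\<close> is a sum of slices with values in the
  unit interval, and slice \<open>i\<close>, being 1 on \<open>S i\<close>, covers that set, while
  slice \<open>i + 1\<close> lies below its indicator. The bottom slice is only bounded by 1, whence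
  the error \<open>1 / n\<close>.\<close>

lemma integral_le_I:
  assumes f: "f \<in> Lip" "\<And>x. x \<in> X \<Longrightarrow> 0 \<le> f x" "\<And>x. x \<in> X \<Longrightarrow> f x \<le> 1"
  shows "(\<integral>x. f x \<partial>dmeasure) \<le> I f"
proof (rule field_le_epsilon)
  fix e :: real assume e: "0 < e"
  obtain k where k: "1 / real (Suc k) < e" using nat_approx_posE[OF e] by blast
  define n where "n = Suc k"
  have n: "0 < n" "1 / real n < e" using k by (auto simp: n_def)
  interpret prob_space dmeasure by (rule prob_space_dmeasure)
  note fin = finite_measure_axioms
  define S where "S i = {x \<in> X. real (Suc i) < real n * f x}" for i
  have SB: "S i \<in> sets \<B>" for i
  proof -
    note bm_measurable[OF Lip_bm[OF f(1)], measurable]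
    have "{x \<in> space \<B>. real (Suc i) < real n * f x} \<in> sets \<B>" by measurable
    then show ?thesis by (simp add: S_def)
  qed
  let ?\<phi> = "\<lambda>i x. min 1 (max 0 (real n * f x - real i))"
  have \<phi>L: "?\<phi> i \<in> Lip" for i by (intro Lip_min Lip_max Lip_diff Lip_mult Lip_const f)
  have mS: "measure dmeasure (S i) \<le> I (?\<phi> i)" for i
  proof -
    have "outer (S i) \<le> ennreal (I (?\<phi> i))" by (rule single_cover[OF \<phi>L]) (auto simp: S_def)
    then show ?thesis
      using I_nonneg[OF \<phi>L, of i] by (simp add: emeasure_dmeasure[OF SB, symmetric] emeasure_eq_measure)
  qed
  have bmS: "(\<lambda>x. \<Sum>i<n. indicator (S i) x) \<in> bm"
    by (intro bm_sum bm_indicator SB) simp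
  have "real n * (\<integral>x. f x \<partial>dmeasure) = (\<integral>x. real n * f x \<partial>dmeasure)" by simp
  also have "\<dots> \<le> (\<integral>x. 1 + (\<Sum>i<n. indicator (S i) x) \<partial>dmeasure)"
  proof (intro integral_mono bm_integrable[OF fin sets_dmeasure] bm_mult bm_add bm_const bmS Lip_bm[OF f(1)])
    fix x assume "x \<in> space dmeasure"
    then have x: "x \<in> X" by (simp add: space_dmeasure)
    have "real n * f x = (\<Sum>i<n. ?\<phi> i x)"
      using f(2,3)[OF x] by (subst staircase) (auto simp: mult_le_cancel_left1 min_def)
    also have "\<dots> = ?\<phi> 0 x + (\<Sum>i<k. ?\<phi> (Suc i) x)" unfolding n_def by (rule sum.lessThan_Suc_shift)
    also have "\<dots> \<le> 1 + (\<Sum>i<k. indicator (S i) x)"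
      using x by (intro add_mono sum_mono) (auto simp: S_def indicator_def split: split_of_bool)
    also have "\<dots> \<le> 1 + (\<Sum>i<n. indicator (S i) x)" by (simp add: n_def)
    finally show "real n * f x \<le> 1 + (\<Sum>i<n. indicator (S i) x)" .
  qed
  also have "\<dots> = 1 + (\<Sum>i<n. measure dmeasure (S i))"
    using SB by (subst Bochner_Integration.integral_add) (auto simp: bm_integrable[OF fin sets_dmeasure bmS] sets_dmeasure prob_space emeasure_eq_measure
        Int_absorb2 sets.sets_into_space Bochner_Integration.integral_sum)
  also have "\<dots> \<le> 1 + (\<Sum>i<n. I (?\<phi> i))" by (intro add_left_mono sum_mono mS)
  also have "(\<Sum>i<n. I (?\<phi> i)) = I (\<lambda>x. \<Sum>i<n. ?\<phi> i x)" using I_sum[of "{..<n}" ?\<phi>] \<phi>L by simp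
  also have "\<dots> = I (\<lambda>x. real n * f x)"
  proof (rule I_cong)
    show "(\<lambda>x. \<Sum>i<n. ?\<phi> i x) \<in> Lip" using I_sum[of "{..<n}" ?\<phi>] \<phi>L by simp
    fix x assume x: "x \<in> X"
    show "(\<Sum>i<n. ?\<phi> i x) = real n * f x"
      using f(2,3)[OF x] by (subst staircase) (auto simp: mult_le_cancel_left1 min_def)
  qed (intro Lip_mult Lip_const f)
  also have "\<dots> = real n * I f" by (rule I_scale[OF f(1)])
  finally have "real n * ((\<integral>x. f x \<partial>dmeasure) - I f) \<le> 1" by (simp add: algebra_simps)
  then have "(\<integral>x. f x \<partial>dmeasure) - I f \<le> 1 / real n" using n(1) by (simp add: le_divide_eq mult.commute)
  then show "(\<integral>x. f x \<partial>dmeasure) \<le> I f + e" using n(2) by linarith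
qed

text \<open>The inequality for \<open>1 - g\<close> is the reverse inequality for \<open>g\<close>.
  A general \<open>f\<close> is moved affinely into the unit interval; the 1 in
  \<open>2 * C + 1\<close> covers the case \<open>C = 0\<close>.\<close>

lemma integral_eq_I: assumes f: "f \<in> Lip" shows "(\<integral>x. f x \<partial>dmeasure) = I f"
proof -
  interpret prob_space dmeasure by (rule prob_space_dmeasure)
  note fin = finite_measure_axioms
  have unit: "(\<integral>x. g x \<partial>dmeasure) = I g" if g: "g \<in> Lip" "\<And>x. x \<in> X \<Longrightarrow> 0 \<le> g x" "\<And>x. x \<in> X \<Longrightarrow> g x \<le> 1" for g
  proof (rule antisym)
    show "(\<integral>x. g x \<partial>dmeasure) \<le> I g" by (rule integral_le_I[OF g])
    have "(\<integral>x. 1 - g x \<partial>dmeasure) \<le> I (\<lambda>x. 1 - g x)" using g by (intro integral_le_I Lip_diff Lip_const) auto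
    also have "I (\<lambda>x. 1 - g x) = 1 - I g" using I_diff[OF Lip_const[of 1] g(1)] by (simp add: I_one)
    also have "(\<integral>x. 1 - g x \<partial>dmeasure) = 1 - (\<integral>x. g x \<partial>dmeasure)"
      using bm_integrable[OF fin sets_dmeasure Lip_bm[OF g(1)]] prob_space by (subst Bochner_Integration.integral_diff) auto
    finally show "I g \<le> (\<integral>x. g x \<partial>dmeasure)" by simp
  qed
  define C where "C = Lip_norm f"
  define t where "t = 1 / (2 * C + 1)"
  have C: "0 \<le> C" using Lip_norm_bounds(3)[OF f] by (simp add: C_def)
  have t: "0 < t" using C by (simp add: t_def)
  have bnd: "\<bar>f x\<bar> \<le> C" if "x \<in> X" for x using Lip_norm_bounds(1)[OF f that] by (simp add: C_def)
  have "(\<integral>x. t * (f x + C) \<partial>dmeasure) = I (\<lambda>x. t * (f x + C))"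
  proof (rule unit)
    show "(\<lambda>x. t * (f x + C)) \<in> Lip" using f by (intro Lip_mult Lip_add Lip_const)
    fix x assume "x \<in> X"
    from bnd[OF this] C show "0 \<le> t * (f x + C)" "t * (f x + C) \<le> 1" by (auto simp: t_def divide_le_eq)
  qed
  also have "I (\<lambda>x. t * (f x + C)) = t * (I f + C)"
    using I_scale[OF Lip_add[OF f Lip_const[of C]]] I_add[OF f Lip_const[of C]] I_const by simp
  also have "(\<integral>x. t * (f x + C) \<partial>dmeasure) = t * ((\<integral>x. f x \<partial>dmeasure) + C)"
    using bm_integrable[OF fin sets_dmeasure Lip_bm[OF f]] prob_space by simp
  finally show ?thesis using t by simp
qed

end

section \<open>Dini's argument and approximation of continuous functions\<close>

context holder_space
begin

text \<open>Dini's argument: the boxes below a point of the space are compact.\<close>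

lemma box_cover_finite:
  assumes f: "\<And>n. f n \<in> Lip" "\<And>n x. x \<in> X \<Longrightarrow> 0 \<le> f n x" "\<And>x. x \<in> X \<Longrightarrow> 1 \<le> (\<Sum>n. ennreal (f n x))"
    and k: "\<kappa> \<in> X" and e: "0 < e" "e < 1"
  shows "\<exists>M::nat. \<forall>x. (\<forall>i. \<bar>x i\<bar> \<le> \<kappa> i) \<longrightarrow> 1 - e \<le> (\<Sum>n<M. f n x)"
proof (rule ccontr)
  assume neg: "\<not> ?thesis"
  then have "\<forall>M::nat. \<exists>x. (\<forall>i. \<bar>x i\<bar> \<le> \<kappa> i) \<and> (\<Sum>n<M. f n x) < 1 - e" by (simp add: not_le)
  then obtain x where "\<forall>M::nat. (\<forall>i. \<bar>x M i\<bar> \<le> \<kappa> i) \<and> (\<Sum>n<M. f n (x M)) < 1 - e" by (rule choice[THEN exE])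
  then have x: "\<And>M i. \<bar>x M i\<bar> \<le> \<kappa> i" "\<And>M. (\<Sum>n<M. f n (x M)) < 1 - e" by auto
  have k0: "0 \<le> \<kappa> i" for i using x(1)[of 0 i] by linarith
  have xX: "x M \<in> X" for M using x(1) k0 by (intro solid_mem[OF k]) auto
  obtain r y where r: "strict_mono (r :: nat \<Rightarrow> nat)" "y \<in> X" "\<And>i. \<bar>y i\<bar> \<le> \<kappa> i" "(\<lambda>j. N (\<lambda>i. x (r j) i - y i)) \<longlonglongrightarrow> 0"
    by (rule box_subsequence[of \<kappa> x, OF k x(1)]) (rule that)
  have le: "(\<Sum>n<M. f n y) \<le> 1 - e" for M
  proof (rule LIMSEQ_le_const2)
    have "(\<lambda>j. f n (x (r j))) \<longlonglongrightarrow> f n y" for n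
      by (rule Lip_seq_continuous[of "f n" "\<lambda>j. x (r j)", OF f(1) xX r(2) r(4)])
    then show "(\<lambda>j. \<Sum>n<M. f n (x (r j))) \<longlonglongrightarrow> (\<Sum>n<M. f n y)"
      by (rule tendsto_sum)
    show "\<exists>j0. \<forall>j\<ge>j0. (\<Sum>n<M. f n (x (r j))) \<le> 1 - e"
    proof (intro exI allI impI)
      fix j assume j: "M \<le> j"
      have "M \<le> r j" using seq_suble[OF r(1), of j] j by linarith
      then have "(\<Sum>n<M. f n (x (r j))) \<le> (\<Sum>n<r j. f n (x (r j)))"
        using f(2)[OF xX] by (intro sum_mono2) auto
      with x(2)[of "r j"] show "(\<Sum>n<M. f n (x (r j))) \<le> 1 - e" by linarith
    qed
  qed
  have "(\<Sum>n. ennreal (f n y)) \<le> ennreal (1 - e)"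
  proof -
    have "(\<Sum>n<M. ennreal (f n y)) \<le> ennreal (1 - e)" for M
      using le[of M] f(2)[OF r(2)] by (subst sum_ennreal) (auto intro: ennreal_leI)
    then show ?thesis unfolding suminf_eq_SUP by (rule SUP_least)
  qed
  with f(3)[OF r(2)] have "1 \<le> ennreal (1 - e)" by (rule order_trans)
  then show False using e by (simp add: ennreal_ge_1)
qed

text \<open>Inf-convolution with the metric \<open>k * D\<close> gives a function below
  \<open>\<phi>\<close> that is Hoelder with constant \<open>k\<close> by the triangle inequality.
  It carries convergence from Hoelder functions over to bounded continuous ones.\<close>

lemma inf_convolution:
  assumes \<phi>: "\<phi> \<in> cont_b T"
  shows "\<exists>g F. \<forall>k. g k \<in> Lip \<and> (\<forall>x\<in>X. g k x \<le> \<phi> x \<and> \<bar>g k x\<bar> \<le> F \<and> (\<lambda>k::nat. g k x) \<longlonglongrightarrow> \<phi> x)"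
proof -
  obtain F where F: "\<And>x. x \<in> X \<Longrightarrow> \<bar>\<phi> x\<bar> \<le> F" using bmE[OF cont_b_bm[OF \<phi>]] by metis
  have cont: "continuous_map T euclideanreal \<phi>" using \<phi> by (simp add: cont_b_def)
  define g where "g k x = (INF y\<in>X. \<phi> y + real k * D x y)" for k :: nat and x
  have ne: "X \<noteq> {}" using zero_mem by blast
  have low: "- F \<le> \<phi> y + real k * D x y" if "y \<in> X" for k x y
  proof -
    have "0 \<le> real k * D x y" by simp
    with F[OF that] show ?thesis by linarith
  qed
  have bd: "bdd_below ((\<lambda>y. \<phi> y + real k * D x y) ` X)" for k x by (rule bdd_belowI2) (rule low)
  have gle: "g k x \<le> \<phi> y + real k * D x y" if "y \<in> X" for k x y unfolding g_def by (rule cINF_lower[OF bd that])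
  have gge: "- F \<le> g k x" for k x unfolding g_def by (rule cINF_greatest[OF ne low])
  have g1: "g k x \<le> \<phi> x" if "x \<in> X" for k x using gle[OF that, of k x] by simp
  have g2: "\<bar>g k x\<bar> \<le> F" if "x \<in> X" for k x using g1[OF that, of k] gge[of k x] F[OF that] by linarith
  have gL: "g k x \<le> g k y + real k * D x y" if xy: "x \<in> X" "y \<in> X" for k x y
  proof -
    have "g k x - real k * D x y \<le> \<phi> z + real k * D y z" if z: "z \<in> X" for z
      using gle[OF z, of k x] mult_left_mono[OF D_triangle[OF xy z], of "real k"] by (simp add: distrib_left)
    then have "g k x - real k * D x y \<le> g k y" unfolding g_def[of k y] by (intro cINF_greatest ne)
    then show ?thesis by linarith
  qed
  have gLip: "g k \<in> Lip" for k
  proof (rule LipI)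
    show "norm (g k x) \<le> F" if "x \<in> X" for x using g2[OF that] by simp
    show "norm (g k x - g k y) \<le> real k * D x y" if "x \<in> X" "y \<in> X" for x y
      using gL[OF that, of k] gL[OF that(2,1), of k] by (simp add: D_commute[of y x] abs_le_iff)
  qed
  have lim: "(\<lambda>k. g k x) \<longlonglongrightarrow> \<phi> x" if x: "x \<in> X" for x
  proof (rule LIMSEQ_I)
    fix e :: real assume e: "0 < e"
    obtain d where d: "d > 0" "\<And>y. y \<in> X \<Longrightarrow> N (\<lambda>i. x i - y i) < d \<Longrightarrow> \<bar>\<phi> x - \<phi> y\<bar> < e / 2"
      using cont x e unfolding continuous_map_T by (metis half_gt_zero)
    \<comment> \<open>Beyond distance \<open>d\<close> the penalty exceeds \<open>2 * F\<close>, a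
      bound for the oscillation of \<open>\<phi>\<close>, so only points near \<open>x\<close> can
      lower the infimum.\<close>
    obtain k0 :: nat where k0: "2 * F / d powr \<alpha> < real k0" using reals_Archimedean2 by blast
    have "norm (g k x - \<phi> x) < e" if k: "k \<ge> k0" for k
    proof -
      have "\<phi> x - e / 2 \<le> \<phi> y + real k * D x y" if y: "y \<in> X" for y
      proof (cases "N (\<lambda>i. x i - y i) < d")
        case True
        then have "\<bar>\<phi> x - \<phi> y\<bar> < e / 2" by (rule d(2)[OF y])
        moreover have "0 \<le> real k * D x y" by simp
        ultimately show ?thesis by linarith
      next
        case False
        then have "d powr \<alpha> \<le> D x y" using d(1) \<alpha>_pos by (intro powr_mono2) auto
        then have "real k0 * d powr \<alpha> \<le> real k * D x y" using k by (intro mult_mono) auto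
        moreover have "2 * F \<le> real k0 * d powr \<alpha>" using k0 d(1) by (simp add: divide_less_eq)
        ultimately show ?thesis using F[OF x] F[OF y] e by (simp add: abs_le_iff)
      qed
      then have "\<phi> x - e / 2 \<le> g k x" unfolding g_def by (intro cINF_greatest ne)
      with g1[OF x, of k] e show ?thesis by (simp add: abs_less_iff)
    qed
    then show "\<exists>no. \<forall>k\<ge>no. norm (g k x - \<phi> x) < e" by blast
  qed
  show ?thesis using gLip g1 g2 lim by (intro exI[of _ g] exI[of _ F]) auto
qed

text \<open>Hoelder functions are bounded and continuous and determine a finite measure, so the
  definite description has at most one solution.\<close>

lemma dual_op_eq:
  assumes "finite_measure \<rho>" "sets \<rho> = sets \<B>" "\<And>\<phi>. \<phi> \<in> cont_b T \<Longrightarrow> (\<integral>x. \<phi> x \<partial>\<rho>) = (\<integral>x. F \<phi> x \<partial>\<nu>)"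
  shows "dual_op T F \<nu> = \<rho>"
  unfolding dual_op_def
proof (rule the_equality)
  show "finite_measure \<rho> \<and> sets \<rho> = sets \<B> \<and> (\<forall>\<phi>\<in>cont_b T. (\<integral>x. \<phi> x \<partial>\<rho>) = (\<integral>x. F \<phi> x \<partial>\<nu>))" using assms by blast
  fix \<rho>' assume "finite_measure \<rho>' \<and> sets \<rho>' = sets \<B> \<and> (\<forall>\<phi>\<in>cont_b T. (\<integral>x. \<phi> x \<partial>\<rho>') = (\<integral>x. F \<phi> x \<partial>\<nu>))"
  then show "\<rho>' = \<rho>" using assms Lip_cont_b by (intro measure_eq_Lip) auto
qed

end

section \<open>The dual operator\<close>

context ruelle_space
begin

text \<open>The explicit form of the dual: choose \<open>r\<close> by \<open>m\<close> and
  \<open>x\<close> by \<open>\<nu>\<close>, weight with \<open>exp A\<close>, and move to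
  \<open>br r x\<close>. It realizes the description in \<open>dual_op\<close> and extends the
  duality from continuous to bounded Borel functions.\<close>

definition push :: "(nat \<Rightarrow> real) measure \<Rightarrow> (nat \<Rightarrow> real) measure" where
  "push \<nu> = distr (density (m \<Otimes>\<^sub>M \<nu>) (\<lambda>p. ennreal (exp (A (br (fst p) (snd p)))))) \<B> (\<lambda>p. br (fst p) (snd p))"

lemma push:
  assumes \<nu>: "finite_measure \<nu>" "sets \<nu> = sets \<B>"
  shows "finite_measure (push \<nu>)" "sets (push \<nu>) = sets \<B>"
    "\<And>\<phi>. \<phi> \<in> bm \<Longrightarrow> (\<integral>x. \<phi> x \<partial>push \<nu>) = (\<integral>x. L \<phi> x \<partial>\<nu>)"
proof -
  interpret \<nu>: finite_measure \<nu> by fact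
  interpret P: pair_sigma_finite m \<nu> ..
  have fin: "finite_measure (m \<Otimes>\<^sub>M \<nu>)" by (rule finite_measure_pair_measure) unfold_locales
  interpret mn: finite_measure "m \<Otimes>\<^sub>M \<nu>" by fact
  have sp: "space \<nu> = X" using sets_eq_imp_space_eq[OF \<nu>(2)] by simp
  have brm [measurable]: "(\<lambda>p. br (fst p) (snd p)) \<in> m \<Otimes>\<^sub>M \<nu> \<rightarrow>\<^sub>M \<B>"
    using br_measurable_pair_m measurable_cong_sets[OF sets_pair_measure_cong[OF refl \<nu>(2)] refl] by blast
  have mem: "br (fst p) (snd p) \<in> X" if "p \<in> space (m \<Otimes>\<^sub>M \<nu>)" for p
    using that br_mem by (auto simp: space_pair_measure sp)
  show "sets (push \<nu>) = sets \<B>" by (simp add: push_def)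
  have int: "integrable (m \<Otimes>\<^sub>M \<nu>) (\<lambda>p. exp (A (br (fst p) (snd p))) * \<phi> (br (fst p) (snd p)))" if \<phi>: "\<phi> \<in> bm" for \<phi>
  proof -
    obtain C where C: "0 \<le> C" "\<And>y. y \<in> X \<Longrightarrow> \<bar>\<phi> y\<bar> \<le> C" using \<phi> by (metis bmE)
    note bm_measurable[OF \<phi>, measurable]
    show ?thesis
    proof (rule mn.integrable_const_bound[of _ "exp MA * C"])
      show "AE p in m \<Otimes>\<^sub>M \<nu>. norm (exp (A (br (fst p) (snd p))) * \<phi> (br (fst p) (snd p))) \<le> exp MA * C"
        using exp_A_le C mem by (intro AE_I2) (auto simp: abs_mult intro!: mult_mono)
    qed simp
  qed
  show "finite_measure (push \<nu>)"
  proof (rule finite_measureI)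
    have "emeasure (push \<nu>) (space (push \<nu>)) = (\<integral>\<^sup>+p. ennreal (exp (A (br (fst p) (snd p)))) \<partial>(m \<Otimes>\<^sub>M \<nu>))"
      unfolding push_def
    proof (subst emeasure_distr)
      have "(\<lambda>p. br (fst p) (snd p)) -` space \<B> \<inter> space (m \<Otimes>\<^sub>M \<nu>) = space (m \<Otimes>\<^sub>M \<nu>)" using mem by auto
      then show "emeasure (density (m \<Otimes>\<^sub>M \<nu>) (\<lambda>p. ennreal (exp (A (br (fst p) (snd p))))))
          ((\<lambda>p. br (fst p) (snd p)) -` space (distr (density (m \<Otimes>\<^sub>M \<nu>) (\<lambda>p. ennreal (exp (A (br (fst p) (snd p)))))) \<B> (\<lambda>p. br (fst p) (snd p))) \<inter>
            space (density (m \<Otimes>\<^sub>M \<nu>) (\<lambda>p. ennreal (exp (A (br (fst p) (snd p))))))) =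
          (\<integral>\<^sup>+p. ennreal (exp (A (br (fst p) (snd p)))) \<partial>(m \<Otimes>\<^sub>M \<nu>))"
        by (simp add: emeasure_density cong: nn_integral_cong_simp)
    qed (use sets.top[of \<B>] in simp_all)
    also have "\<dots> \<le> (\<integral>\<^sup>+p. ennreal (exp MA) \<partial>(m \<Otimes>\<^sub>M \<nu>))"
      using exp_A_le mem by (intro nn_integral_mono ennreal_leI) auto
    also have "\<dots> < \<infinity>" using mn.emeasure_finite by (simp add: ennreal_mult_eq_top_iff less_top[symmetric])
    finally show "emeasure (push \<nu>) (space (push \<nu>)) \<noteq> \<infinity>" by simp
  qed
  fix \<phi> assume \<phi>: "\<phi> \<in> bm"
  note bm_measurable[OF \<phi>, measurable]
  have "(\<integral>x. \<phi> x \<partial>push \<nu>) = (\<integral>p. exp (A (br (fst p) (snd p))) * \<phi> (br (fst p) (snd p)) \<partial>(m \<Otimes>\<^sub>M \<nu>))"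
    unfolding push_def by (subst integral_distr) (simp_all add: integral_density)
  also have "\<dots> = (\<integral>x. (\<integral>r. exp (A (br r x)) * \<phi> (br r x) \<partial>m) \<partial>\<nu>)"
    by (rule P.integral_snd[of "\<lambda>r x. exp (A (br r x)) * \<phi> (br r x)", unfolded case_prod_beta', OF int[OF \<phi>], symmetric])
  finally show "(\<integral>x. \<phi> x \<partial>push \<nu>) = (\<integral>x. L \<phi> x \<partial>\<nu>)" by (simp add: L_eq)
qed

lemma push_iter:
  assumes \<nu>: "finite_measure \<nu>" "sets \<nu> = sets \<B>"
  shows "\<exists>\<rho>. finite_measure \<rho> \<and> sets \<rho> = sets \<B> \<and> (\<forall>\<phi>\<in>bm. (\<integral>x. \<phi> x \<partial>\<rho>) = (\<integral>x. (L ^^ n) \<phi> x \<partial>\<nu>))"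
proof (induction n)
  case 0
  then show ?case using \<nu> by auto
next
  case (Suc n)
  then obtain \<rho> where \<rho>: "finite_measure \<rho>" "sets \<rho> = sets \<B>" "\<And>\<phi>. \<phi> \<in> bm \<Longrightarrow> (\<integral>x. \<phi> x \<partial>\<rho>) = (\<integral>x. (L ^^ n) \<phi> x \<partial>\<nu>)" by blast
  have "(\<integral>x. \<phi> x \<partial>push \<rho>) = (\<integral>x. (L ^^ Suc n) \<phi> x \<partial>\<nu>)" if "\<phi> \<in> bm" for \<phi>
    using push(3)[OF \<rho>(1,2) that] \<rho>(3)[OF L_bm[OF that]] by (simp add: funpow_swap1)
  with push(1,2)[OF \<rho>(1,2)] show ?case by blast
qed

lemma dual_op_integral:
  assumes \<nu>: "finite_measure \<nu>" "sets \<nu> = sets \<B>"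
  shows "\<phi> \<in> bm \<Longrightarrow> (\<integral>x. \<phi> x \<partial>dual_op T (L ^^ n) \<nu>) = (\<integral>x. (L ^^ n) \<phi> x \<partial>\<nu>)"
proof -
  obtain \<rho> where \<rho>: "finite_measure \<rho>" "sets \<rho> = sets \<B>" "\<And>\<phi>. \<phi> \<in> bm \<Longrightarrow> (\<integral>x. \<phi> x \<partial>\<rho>) = (\<integral>x. (L ^^ n) \<phi> x \<partial>\<nu>)"
    using push_iter[OF \<nu>] by blast
  have "dual_op T (L ^^ n) \<nu> = \<rho>" by (rule dual_op_eq[OF \<rho>(1,2)]) (rule \<rho>(3)[OF cont_b_bm])
  then show "\<phi> \<in> bm \<Longrightarrow> ?thesis" using \<rho>(3) by simp
qed

lemma dual_fixed_iff:
  assumes \<nu>: "finite_measure \<nu>" "sets \<nu> = sets \<B>"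
  shows "dual_op T L \<nu> = \<nu> \<longleftrightarrow> (\<forall>\<phi>\<in>bm. (\<integral>x. L \<phi> x \<partial>\<nu>) = (\<integral>x. \<phi> x \<partial>\<nu>))"
proof
  assume "dual_op T L \<nu> = \<nu>"
  then show "\<forall>\<phi>\<in>bm. (\<integral>x. L \<phi> x \<partial>\<nu>) = (\<integral>x. \<phi> x \<partial>\<nu>)" using dual_op_integral[OF \<nu>, of _ 1] by simp
next
  assume "\<forall>\<phi>\<in>bm. (\<integral>x. L \<phi> x \<partial>\<nu>) = (\<integral>x. \<phi> x \<partial>\<nu>)"
  then show "dual_op T L \<nu> = \<nu>" using cont_b_bm by (intro dual_op_eq \<nu>) auto
qed

section \<open>Positivity on cylinders and full support\<close>

lemma cylinder_positive_step:
  assumes \<mu>: "prob_space \<mu>" "sets \<mu> = sets \<B>" and inv: "\<And>\<phi>. \<phi> \<in> bm \<Longrightarrow> (\<integral>x. L \<phi> x \<partial>\<mu>) = (\<integral>x. \<phi> x \<partial>\<mu>)"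
    and E: "E \<in> sets \<B>" "0 < measure \<mu> E" and J: "J \<in> sets borel" "0 < measure m J"
  shows "{z \<in> X. z 0 \<in> J \<and> sh z \<in> E} \<in> sets \<B>" "0 < measure \<mu> {z \<in> X. z 0 \<in> J \<and> sh z \<in> E}"
proof -
  interpret mu: prob_space \<mu> by fact
  note fin = mu.finite_measure_axioms
  let ?Z = "{z \<in> X. z 0 \<in> J \<and> sh z \<in> E}"
  have "{z \<in> space \<B>. z 0 \<in> J \<and> sh z \<in> E} \<in> sets \<B>" using E J by measurable
  then show Z: "?Z \<in> sets \<B>" by simp
  have bmZ: "indicator ?Z \<in> bm" by (rule bm_indicator[OF Z])
  have bmE: "(\<lambda>x. exp (- MA) * measure m J * indicator E x) \<in> bm" by (intro bm_mult bm_const bm_indicator E)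
  have sp: "space \<mu> = X" using sets_eq_imp_space_eq[OF \<mu>(2)] by simp
  have "0 < exp (- MA) * measure m J * measure \<mu> E" using E J by simp
  also have "\<dots> = (\<integral>x. exp (- MA) * measure m J * indicator E x \<partial>\<mu>)"
    using E sets.sets_into_space[OF E(1)] by (simp add: \<mu>(2) sp Int_absorb2)
  \<comment> \<open>For \<open>x\<close> in \<open>E\<close> the point \<open>br r x\<close> lies in
    \<open>?Z\<close> exactly when \<open>r\<close> lies in \<open>J\<close>, and the density is at
    least \<open>exp (- MA)\<close>.\<close>
  also have "\<dots> \<le> (\<integral>x. L (indicator ?Z) x \<partial>\<mu>)"
  proof (intro integral_mono bm_integrable[OF fin \<mu>(2)] bmE L_bm bmZ)
    fix x assume "x \<in> space \<mu>"
    then have x: "x \<in> X" by (simp add: sp)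
    have Jm: "J \<in> sets m" using J sets_m by simp
    have "exp (- MA) * measure m J * indicator E x = (\<integral>r. exp (- MA) * indicator E x * indicator J r \<partial>m)"
      using Jm by simp
    also have "\<dots> \<le> (\<integral>r. exp (A (br r x)) * indicator ?Z (br r x) \<partial>m)"
    proof (rule integral_mono[OF _ L_integrable[OF bmZ x]])
      show "integrable m (\<lambda>r. exp (- MA) * indicator E x * indicator J r)"
        using Jm by (intro integrable_mult_right integrable_real_indicator) (auto simp: emeasure_eq_measure)
      fix r show "exp (- MA) * indicator E x * indicator J r \<le> exp (A (br r x)) * indicator ?Z (br r x)"
        using exp_A_ge[OF br_mem[OF x, of r]] br_mem[OF x, of r] by (auto simp: indicator_def split: split_of_bool)
    qed
    finally show "exp (- MA) * measure m J * indicator E x \<le> L (indicator ?Z) x" by (simp add: L_eq)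
  qed
  also have "\<dots> = (\<integral>x. indicator ?Z x \<partial>\<mu>)" by (rule inv[OF bmZ])
  also have "\<dots> = measure \<mu> ?Z" using Z sets.sets_into_space[OF Z] by (simp add: \<mu>(2) sp Int_absorb2)
  finally show "0 < measure \<mu> ?Z" .
qed

lemma cylinder_positive:
  assumes \<mu>: "prob_space \<mu>" "sets \<mu> = sets \<B>" and inv: "\<And>\<phi>. \<phi> \<in> bm \<Longrightarrow> (\<integral>x. L \<phi> x \<partial>\<mu>) = (\<integral>x. \<phi> x \<partial>\<mu>)"
    and E: "E \<in> sets \<B>" "0 < measure \<mu> E" and J: "\<And>i. J i \<in> sets borel" "\<And>i. 0 < measure m (J i)"
  shows "{z \<in> X. (\<forall>i<n. (sh ^^ i) z 0 \<in> J i) \<and> (sh ^^ n) z \<in> E} \<in> sets \<B> \<and>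
    0 < measure \<mu> {z \<in> X. (\<forall>i<n. (sh ^^ i) z 0 \<in> J i) \<and> (sh ^^ n) z \<in> E}"
  using J
proof (induction n arbitrary: J)
  case 0
  have "E \<subseteq> X" using sets.sets_into_space[OF E(1)] by simp
  then have "{z \<in> X. z \<in> E} = E" by auto
  then show ?case using E by simp
next
  case (Suc n)
  let ?E = "{z \<in> X. (\<forall>i<n. (sh ^^ i) z 0 \<in> J (Suc i)) \<and> (sh ^^ n) z \<in> E}"
  have IH: "?E \<in> sets \<B> \<and> 0 < measure \<mu> ?E" by (rule Suc.IH) (rule Suc.prems)+
  have "{z \<in> X. (\<forall>i<Suc n. (sh ^^ i) z 0 \<in> J i) \<and> (sh ^^ Suc n) z \<in> E} = {z \<in> X. z 0 \<in> J 0 \<and> sh z \<in> ?E}"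
    using sh_mem by (auto simp: All_less_Suc2 funpow_swap1)
  then show ?case
    using cylinder_positive_step[OF \<mu> inv conjunct1[OF IH] conjunct2[OF IH] Suc.prems(1)[of 0] Suc.prems(2)[of 0]]
    by simp
qed

text \<open>Prescribing the first \<open>n\<close> symbols near those of \<open>x\<close> fixes the
  first \<open>n\<close> coordinates up to \<open>\<eta>\<close>. The remaining ones form
  \<open>B n y\<close> with \<open>y\<close> in a ball of positive measure and are small because
  \<open>B n\<close> contracts. The cylinder of all these points has positive measure and lies in
  the given ball around \<open>x\<close>.\<close>

lemma full_support:
  assumes \<mu>: "prob_space \<mu>" "sets \<mu> = sets \<B>" and inv: "\<And>\<phi>. \<phi> \<in> bm \<Longrightarrow> (\<integral>x. L \<phi> x \<partial>\<mu>) = (\<integral>x. \<phi> x \<partial>\<mu>)"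
    and supp: "measure_support UNIV dist m = UNIV"
  shows "measure_support X (norm_dist N) \<mu> = X"
proof -
  interpret mu: prob_space \<mu> by fact
  have sp: "space \<mu> = X" using sets_eq_imp_space_eq[OF \<mu>(2)] by simp
  have "0 < emeasure \<mu> (met.mball x e)" if x: "x \<in> X" and e: "0 < e" for x e
  proof -
    have EB: "{z \<in> X. N z \<le> R} \<in> sets \<B>" for R
    proof -
      have "{z \<in> space \<B>. N z \<le> R} \<in> sets \<B>" by measurable
      then show ?thesis by simp
    qed
    have "\<exists>R::nat. 0 < measure \<mu> {z \<in> X. N z \<le> real R}"
    proof (rule ccontr)
      assume "\<not> ?thesis"
      then have "measure \<mu> {z \<in> X. N z \<le> real R} = 0" for R :: nat by (simp only: zero_less_measure_iff simp_thms not_ex)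
      then have "emeasure \<mu> {z \<in> X. N z \<le> real R} = 0" for R :: nat by (simp only: mu.emeasure_eq_measure ennreal_0)
      then have "emeasure \<mu> (\<Union>R::nat. {z \<in> X. N z \<le> real R}) = 0"
        using EB \<mu>(2) by (intro emeasure_UN_eq_0) auto
      moreover have "(\<Union>R::nat. {z \<in> X. N z \<le> real R}) = space \<mu>" using real_arch_simple by (auto simp: sp)
      ultimately show False using mu.emeasure_space_1 by simp
    qed
    then obtain R :: nat where R: "0 < measure \<mu> {z \<in> X. N z \<le> real R}" by blast
    have "\<forall>\<^sub>F n in sequentially. N (tail n x) < e / 4" using order_tendstoD(2)[OF N_tail[OF x], of "e/4"] e by simp
    moreover have "\<forall>\<^sub>F n in sequentially. s n * real R powr \<alpha> < (e / 4) powr \<alpha>"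
      using order_tendstoD(2)[OF tendsto_mult_left_zero[OF s_tendsto], of "(e/4) powr \<alpha>" "real R powr \<alpha>"] e by simp
    ultimately have "\<forall>\<^sub>F n in sequentially. N (tail n x) < e / 4 \<and> s n * real R powr \<alpha> < (e / 4) powr \<alpha>" by (rule eventually_conj)
    then obtain n where n: "N (tail n x) < e / 4" "s n * real R powr \<alpha> < (e / 4) powr \<alpha>" by (auto simp: eventually_sequentially)
    \<comment> \<open>The head of the difference, the tail of \<open>x\<close> and the tail of
      \<open>z\<close> get \<open>e / 4\<close> each.\<close>
    define \<eta> where "\<eta> = e / (4 * (real n + 1))"
    have \<eta>: "0 < \<eta>" using e by (simp add: \<eta>_def)
    define J where "J i = ball (weight_prod a 0 i * x i) (weight_prod a 0 i * \<eta>)" for i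
    have J: "J i \<in> sets borel" "0 < measure m (J i)" for i
    proof -
      show "J i \<in> sets borel" by (simp add: J_def)
      have "0 < emeasure m (J i)"
      proof -
        have "\<forall>e>0. 0 < emeasure m (ball (weight_prod a 0 i * x i) e)"
          using supp by (auto simp: measure_support_def set_eq_iff)
        then show ?thesis using \<eta> weight_prod_pos[of 0 i] by (simp add: J_def)
      qed
      then show "0 < measure m (J i)" by (simp add: emeasure_eq_measure)
    qed
    let ?Z = "{z \<in> X. (\<forall>i<n. (sh ^^ i) z 0 \<in> J i) \<and> (sh ^^ n) z \<in> {z \<in> X. N z \<le> real R}}"
    have Z: "0 < measure \<mu> ?Z" by (rule cylinder_positive[THEN conjunct2, OF \<mu> inv EB R J])
    have "?Z \<subseteq> met.mball x e"
    proof
      fix z assume z: "z \<in> ?Z"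
      then have zX: "z \<in> X" by simp
      have c: "\<bar>x i - z i\<bar> \<le> \<eta>" if "i < n" for i
      proof -
        have "weight_prod a 0 i * z i \<in> J i" using z that by (simp add: shn_coord)
        then have "\<bar>weight_prod a 0 i * (x i - z i)\<bar> < weight_prod a 0 i * \<eta>" by (simp add: J_def dist_real_def right_diff_distrib)
        then show ?thesis using weight_prod_pos[of 0 i] by (simp add: abs_mult)
      qed
      have tz: "tail n z = B n ((sh ^^ n) z)"
        using weight_prod_pos[of _ n] by (auto simp: fun_eq_iff B_coord shn_coord less_imp_neq[THEN not_sym])
      have "N (tail n z) powr \<alpha> \<le> s n * N ((sh ^^ n) z) powr \<alpha>" unfolding tz by (rule B_powr[OF shn_mem[OF zX]])
      also have "\<dots> \<le> s n * real R powr \<alpha>" using z \<alpha>_pos by (intro mult_left_mono powr_mono2) auto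
      finally have "N (tail n z) powr \<alpha> < (e / 4) powr \<alpha>" using n(2) by linarith
      then have t: "N (tail n z) < e / 4" using \<alpha>_pos e powr_mono2[of \<alpha> "e / 4" "N (tail n z)"] by fastforce
      have "N (\<lambda>i. x i - z i) \<le> (\<Sum>i<n. \<bar>x i - z i\<bar>) + N (tail n (\<lambda>i. x i - z i))"
        by (rule N_le_sum_tail[OF diff_mem[OF x zX]])
      also have "tail n (\<lambda>i. x i - z i) = (\<lambda>i. tail n x i - tail n z i)" by (auto simp: fun_eq_iff)
      also have "N (\<lambda>i. tail n x i - tail n z i) \<le> N (tail n x) + N (tail n z)" by (intro N_diff_le tail_mem x zX)
      also have "(\<Sum>i<n. \<bar>x i - z i\<bar>) \<le> (\<Sum>i<n. \<eta>)" by (intro sum_mono c) simp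
      also have "(\<Sum>i<n. \<eta>) \<le> e / 4" using e by (simp add: \<eta>_def divide_le_eq mult_le_cancel_left)
      finally show "z \<in> met.mball x e" using x zX n(1) t e by (simp add: norm_dist_def)
    qed
    moreover have "met.mball x e \<in> sets \<mu>"
      using openin_sets[of "met.mball x e"] met.openin_mball by (simp add: \<mu>(2) norm_topology_def)
    ultimately have "measure \<mu> ?Z \<le> measure \<mu> (met.mball x e)" by (intro mu.finite_measure_mono)
    with Z show ?thesis by (simp add: mu.emeasure_eq_measure)
  qed
  then show ?thesis unfolding measure_support_def by auto
qed

end

section \<open>The invariant measure and its mixing property\<close>

lemma tendsto_approx:
  fixes f :: "nat \<Rightarrow> real"
  assumes "\<And>e. 0 < e \<Longrightarrow> \<exists>g c. (\<forall>n. \<bar>f n - g n\<bar> \<le> e) \<and> g \<longlonglongrightarrow> c \<and> \<bar>c - l\<bar> \<le> e"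
  shows "f \<longlonglongrightarrow> l"
proof (rule LIMSEQ_I)
  fix e :: real assume e: "0 < e"
  obtain g c where g: "\<And>n. \<bar>f n - g n\<bar> \<le> e / 4" "g \<longlonglongrightarrow> c" "\<bar>c - l\<bar> \<le> e / 4"
    using assms[of "e / 4"] e by auto
  obtain n0 where "\<And>n. n \<ge> n0 \<Longrightarrow> norm (g n - c) < e / 4" using LIMSEQ_D[OF g(2), of "e / 4"] e by auto
  then have h: "\<bar>g n - c\<bar> < e / 4" if "n \<ge> n0" for n using that by simp
  then have "norm (f n - l) < e" if "n \<ge> n0" for n
    using g(1)[of n] g(3) h[OF that] e unfolding real_norm_def by linarith
  then show "\<exists>no. \<forall>n\<ge>no. norm (f n - l) < e" by blast
qed

lemma invariant_measure_vimage:
  assumes inv: "invariant_measure \<mu> f" and C: "C \<in> sets \<mu>"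
  shows "(f ^^ n) -` C \<inter> space \<mu> \<in> sets \<mu>" "measure \<mu> ((f ^^ n) -` C \<inter> space \<mu>) = measure \<mu> C"
proof -
  have f: "f \<in> \<mu> \<rightarrow>\<^sub>M \<mu>" and d: "distr \<mu> \<mu> f = \<mu>" using inv by (auto simp: invariant_measure_def)
  have fn: "f ^^ n \<in> \<mu> \<rightarrow>\<^sub>M \<mu>" for n
    by (induction n) (auto intro: measurable_compose[OF _ f] simp: id_def)
  show "(f ^^ n) -` C \<inter> space \<mu> \<in> sets \<mu>" using fn C by (rule measurable_sets)
  show "measure \<mu> ((f ^^ n) -` C \<inter> space \<mu>) = measure \<mu> C"
  proof (induction n)
    case 0
    then show ?case using sets.sets_into_space[OF C] by (simp add: Int_absorb2)
  next
    case (Suc n)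
    let ?S = "(f ^^ n) -` C \<inter> space \<mu>"
    have S: "?S \<in> sets \<mu>" using fn C by (rule measurable_sets)
    have "(f ^^ Suc n) -` C \<inter> space \<mu> = f -` ?S \<inter> space \<mu>"
      using measurable_space[OF f] by (auto simp: funpow_swap1)
    then have "measure \<mu> ((f ^^ Suc n) -` C \<inter> space \<mu>) = measure (distr \<mu> \<mu> f) ?S"
      using measure_distr[OF f S] by simp
    then show ?case by (simp only: d Suc)
  qed
qed

text \<open>Mixing of an invariant set with itself says that its measure equals its own
  square.\<close>

lemma mixing_imp_ergodic:
  assumes "prob_space \<mu>" "mixing \<mu> f"
  shows "ergodic \<mu> f"
  unfolding ergodic_def
proof (intro ballI impI)
  interpret prob_space \<mu> by fact
  fix B assume B: "B \<in> sets \<mu>" and inv: "f -` B \<inter> space \<mu> = B"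
  have n: "B \<inter> ((f ^^ n) -` B \<inter> space \<mu>) = B" for n
  proof -
    have "(f ^^ n) x \<in> B" if "x \<in> B" for x using that
      by (induction n) (use inv in auto)
    then show ?thesis using inv by auto
  qed
  have "(\<lambda>n. measure \<mu> (B \<inter> ((f ^^ n) -` B \<inter> space \<mu>))) \<longlonglongrightarrow> measure \<mu> B * measure \<mu> B"
    using assms(2) B by (auto simp: mixing_def)
  then have "measure \<mu> B = measure \<mu> B * measure \<mu> B" unfolding n by (simp add: LIMSEQ_const_iff)
  then have "measure \<mu> B = 0 \<or> measure \<mu> B = 1" by auto
  then show "emeasure \<mu> B = 0 \<or> emeasure \<mu> (space \<mu> - B) = 0"
    using prob_compl[OF B] by (auto simp: emeasure_eq_measure)
qed

text \<open>The preimages of a wandering set are disjoint and of equal measure in a space of finite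
  measure.\<close>

lemma invariant_imp_conservative:
  assumes "finite_measure \<mu>" "invariant_measure \<mu> f"
  shows "conservative \<mu> f"
  unfolding conservative_def
proof (intro ballI impI)
  interpret finite_measure \<mu> by fact
  fix B assume B: "B \<in> sets \<mu>" and dj: "disjoint_family (\<lambda>n. (f ^^ n) -` B \<inter> space \<mu>)"
  note v = invariant_measure_vimage[OF assms(2) B]
  have "(\<lambda>n. measure \<mu> ((f ^^ n) -` B \<inter> space \<mu>)) sums measure \<mu> (\<Union>n. (f ^^ n) -` B \<inter> space \<mu>)"
    using v(1) dj by (intro finite_measure_UNION) auto
  then have "summable (\<lambda>n::nat. measure \<mu> B)" unfolding v(2) by (rule sums_summable)
  then have "measure \<mu> B = 0" by (simp add: summable_const_iff)
  then show "emeasure \<mu> B = 0" by (simp add: emeasure_eq_measure)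
qed

section \<open>The limit functional, its measure and mixing\<close>

context ruelle_normal
begin

definition "ell f = lim (\<lambda>n. (L ^^ n) f (\<lambda>_. 0))"

lemma Ln_tendsto_ell: assumes "f \<in> Lip" "x \<in> X" shows "(\<lambda>n. (L ^^ n) f x) \<longlonglongrightarrow> ell f"
proof -
  obtain l where l: "\<And>x. x \<in> X \<Longrightarrow> (\<lambda>n. (L ^^ n) f x) \<longlonglongrightarrow> l" using Ln_converges_const[OF assms(1)] by blast
  have "ell f = l" unfolding ell_def by (rule limI[OF l[OF zero_mem]])
  with l[OF assms(2)] show ?thesis by simp
qed

text \<open>The limit is read off at the starting point 0. The points charged there by
  \<open>L^k\<close> satisfy \<open>(sh ^^ k) z = 0\<close>, so their coordinates from
  \<open>k\<close> on vanish and lie in the box; the indicator of \<open>far 0\<close> after the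
  shift expresses this and integrates to 0. Tightness handles the first \<open>k\<close> coordinates
  and costs one factor \<open>1 - e\<close>, the lower bound on the box the other.\<close>

lemma ell_ge_on_box:
  assumes g: "g \<in> Lip" "\<And>x. x \<in> X \<Longrightarrow> 0 \<le> g x" and e: "0 < e" "e < 1" and \<kappa>: "\<And>i. 0 < \<kappa> i"
    and tight: "\<And>k x. x \<in> X \<Longrightarrow> (L ^^ k) (indicator {z \<in> X. \<exists>i<k. \<kappa> i < \<bar>z i\<bar>}) x \<le> e"
    and ge: "\<And>x. (\<And>i. \<bar>x i\<bar> \<le> \<kappa> i) \<Longrightarrow> 1 - e \<le> g x"
  shows "(1 - e) * (1 - e) \<le> ell g"
proof (rule LIMSEQ_le_const[OF Ln_tendsto_ell[OF g(1) zero_mem]])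
  have "(1 - e) * (1 - e) \<le> (L ^^ k) g (\<lambda>_. 0)" for k
  proof -
    let ?U = "{z \<in> X. \<exists>i<k. \<kappa> i < \<bar>z i\<bar>}"
    let ?g = "indicator (far 0) :: (nat \<Rightarrow> real) \<Rightarrow> real"
    have gs: "(\<lambda>z. ?g ((sh ^^ k) z)) \<in> bm"
      by (rule bmI[of _ 1]) (use measurable_compose[OF shn_measurable bm_measurable[OF far_bm]] in \<open>auto simp: indicator_def\<close>)
    have Ub: "indicator ?U \<in> bm" by (rule bm_indicator[OF box_set])
    have in_box: "\<bar>z i\<bar> \<le> \<kappa> i" if "z \<in> X" "z \<notin> ?U" "(sh ^^ k) z \<notin> far 0" for z i
    proof (cases "i < k")
      case True
      then show ?thesis using that(1,2) by (intro leI) blast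
    next
      case False
      have "(sh ^^ k) z \<in> X" using that(1) by (rule shn_mem)
      with that(3) have "N ((sh ^^ k) z) = 0" by (auto simp: far_def not_less intro: antisym)
      then have "(sh ^^ k) z = (\<lambda>_. 0)" using N_eq_0[OF shn_mem[OF that(1)]] by simp
      then have "(sh ^^ k) z (i - k) = 0" by simp
      then have "weight_prod a (i - k) k * z i = 0" unfolding shn_coord using False by simp
      then show ?thesis using weight_prod_pos[of "i - k" k] \<kappa>[of i] by simp
    qed
    have "(1 - e) * (1 - e) \<le> (1 - e) * (1 - ((L ^^ k) (indicator ?U) (\<lambda>_. 0) + ?g (\<lambda>_. 0)))"
      using tight[OF zero_mem, of k] e by (intro mult_left_mono) (auto simp: far_def)
    also have "\<dots> = (L ^^ k) (\<lambda>z. (1 - e) * (1 - (indicator ?U z + ?g ((sh ^^ k) z)))) (\<lambda>_. 0)"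
      using Ln_coshift[OF zero_mem, of k ?g] by (simp add: Ln_scale Ln_diff Ln_add Ln_const1 Ub gs bm_add)
    also have "\<dots> \<le> (L ^^ k) g (\<lambda>_. 0)"
    proof (intro Ln_mono bm_mult bm_diff bm_const bm_add Ub gs Lip_bm[OF g(1)] zero_mem)
      fix z assume z: "z \<in> X"
      show "(1 - e) * (1 - (indicator ?U z + ?g ((sh ^^ k) z))) \<le> g z"
      proof (cases "z \<in> ?U \<or> (sh ^^ k) z \<in> far 0")
        case True
        then have "1 - (indicator ?U z + ?g ((sh ^^ k) z)) \<le> 0" by (auto simp: indicator_def split: split_of_bool)
        then have "(1 - e) * (1 - (indicator ?U z + ?g ((sh ^^ k) z))) \<le> 0" using e by (simp add: mult_le_0_iff)
        then show ?thesis using g(2)[OF z] by linarith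
      next
        case False
        then have "1 - e \<le> g z" using in_box[OF z] by (intro ge) auto
        then show ?thesis using False by simp
      qed
    qed
    finally show ?thesis .
  qed
  then show "\<exists>N. \<forall>k\<ge>N. (1 - e) * (1 - e) \<le> (L ^^ k) g (\<lambda>_. 0)" by blast
qed

lemma daniell_ell: "daniell_functional X N \<alpha> ell"
proof
  fix f g :: "(nat \<Rightarrow> real) \<Rightarrow> real" and t :: real
  assume f: "f \<in> Lip"
  have "(\<lambda>n. t * (L ^^ n) f (\<lambda>_. 0)) \<longlonglongrightarrow> t * ell f" by (intro tendsto_mult_left Ln_tendsto_ell f zero_mem)
  then have "(\<lambda>n. (L ^^ n) (\<lambda>x. t * f x) (\<lambda>_. 0)) \<longlonglongrightarrow> t * ell f" by (simp add: Ln_scale)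
  then show "ell (\<lambda>x. t * f x) = t * ell f"
    using LIMSEQ_unique Ln_tendsto_ell[OF Lip_mult[OF Lip_const[of t] f] zero_mem] by blast
  assume g: "g \<in> Lip"
  have "(\<lambda>n. (L ^^ n) f (\<lambda>_. 0) + (L ^^ n) g (\<lambda>_. 0)) \<longlonglongrightarrow> ell f + ell g"
    by (intro tendsto_add Ln_tendsto_ell f g zero_mem)
  then have "(\<lambda>n. (L ^^ n) (\<lambda>x. f x + g x) (\<lambda>_. 0)) \<longlonglongrightarrow> ell f + ell g" by (simp add: Ln_add Lip_bm f g)
  then show "ell (\<lambda>x. f x + g x) = ell f + ell g"
    using LIMSEQ_unique Ln_tendsto_ell[OF Lip_add[OF f g] zero_mem] by blast
  assume "\<And>x. x \<in> X \<Longrightarrow> f x \<le> g x"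
  then show "ell f \<le> ell g"
    by (intro LIMSEQ_le[OF Ln_tendsto_ell[OF f zero_mem] Ln_tendsto_ell[OF g zero_mem]]) (auto intro!: Ln_mono Lip_bm f g)
next
  show "ell (\<lambda>_. 1) = 1" unfolding ell_def by (simp add: Ln_one)
next
  fix F :: "nat \<Rightarrow> (nat \<Rightarrow> real) \<Rightarrow> real"
  assume F: "\<And>n. F n \<in> Lip" "\<And>n x. x \<in> X \<Longrightarrow> 0 \<le> F n x" "\<And>x. x \<in> X \<Longrightarrow> 1 \<le> (\<Sum>n. ennreal (F n x))"
  have ell_sum: "(\<lambda>x. \<Sum>n<M. F n x) \<in> Lip \<and> ell (\<lambda>x. \<Sum>n<M. F n x) = (\<Sum>n<M. ell (F n))" for M
  proof (induction M)
    case 0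
    show ?case unfolding ell_def by (simp add: Ln_const1 Lip_const)
  next
    case (Suc M)
    have "(\<lambda>n. (L ^^ n) (\<lambda>x. \<Sum>n<M. F n x) (\<lambda>_. 0) + (L ^^ n) (F M) (\<lambda>_. 0)) \<longlonglongrightarrow> ell (\<lambda>x. \<Sum>n<M. F n x) + ell (F M)"
      using Suc by (intro tendsto_add Ln_tendsto_ell F zero_mem) auto
    then have 1: "(\<lambda>n. (L ^^ n) (\<lambda>x. \<Sum>n<Suc M. F n x) (\<lambda>_. 0)) \<longlonglongrightarrow> (\<Sum>n<Suc M. ell (F n))"
      using Suc by (simp add: Ln_add Lip_bm F)
    have 2: "(\<lambda>x. \<Sum>n<Suc M. F n x) \<in> Lip" using Suc F by (simp add: Lip_add)
    show ?case using 2 LIMSEQ_unique[OF Ln_tendsto_ell[OF 2 zero_mem] 1] by blast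
  qed
  have ell0: "0 \<le> ell (F n)" for n
    by (rule LIMSEQ_le_const[OF Ln_tendsto_ell[OF F(1) zero_mem]]) (auto intro!: Ln_nonneg Lip_bm F)
  \<comment> \<open>Tightness selects a box on which Dini's argument replaces the countable cover by
    a finite sum, and \<open>ell\<close> is additive on finite sums.\<close>
  have ge: "ennreal ((1 - e) * (1 - e)) \<le> (\<Sum>n. ennreal (ell (F n)))" if e: "0 < e" "e < 1" for e
  proof -
    obtain \<kappa> where \<kappa>: "\<kappa> \<in> X" "\<And>i. 0 < \<kappa> i"
      "\<And>k x. x \<in> X \<Longrightarrow> (L ^^ k) (indicator {z \<in> X. \<exists>i<k. \<kappa> i < \<bar>z i\<bar>}) x \<le> e"
      using box_tightness[OF e(1)] by blast
    obtain M :: nat where M: "\<And>x. (\<And>i. \<bar>x i\<bar> \<le> \<kappa> i) \<Longrightarrow> 1 - e \<le> (\<Sum>n<M. F n x)"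
      using box_cover_finite[OF F \<kappa>(1) e] by blast
    have "(1 - e) * (1 - e) \<le> ell (\<lambda>x. \<Sum>n<M. F n x)"
      by (rule ell_ge_on_box[OF _ _ e \<kappa>(2,3) M]) (use ell_sum F(2) in \<open>auto intro: sum_nonneg\<close>)
    also have "\<dots> = (\<Sum>n<M. ell (F n))" using ell_sum by blast
    finally have "ennreal ((1 - e) * (1 - e)) \<le> (\<Sum>n<M. ennreal (ell (F n)))"
      using ell0 by (subst sum_ennreal) (auto intro: ennreal_leI)
    also have "\<dots> \<le> (\<Sum>n. ennreal (ell (F n)))" by (rule sum_le_suminf) auto
    finally show ?thesis .
  qed
  have "(\<lambda>j. ennreal ((1 - 1 / (real j + 2)) * (1 - 1 / (real j + 2)))) \<longlonglongrightarrow> ennreal 1"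
    by (rule tendsto_ennrealI) real_asymp
  then show "1 \<le> (\<Sum>n. ennreal (ell (F n)))"
    by (intro LIMSEQ_le_const2[where X="\<lambda>j. ennreal ((1 - 1 / (real j + 2)) * (1 - 1 / (real j + 2)))"]) (auto intro!: ge)
qed

interpretation dan: daniell_functional X N \<alpha> ell
  by (rule daniell_ell)

definition "gibbs = dan.dmeasure"

lemma gibbs: "prob_space gibbs" "sets gibbs = sets \<B>" "f \<in> Lip \<Longrightarrow> (\<integral>x. f x \<partial>gibbs) = ell f"
  unfolding gibbs_def by (rule dan.prob_space_dmeasure dan.sets_dmeasure dan.integral_eq_I)+

lemma gibbs_finite: "finite_measure gibbs"
  using gibbs(1) by (simp add: prob_space_def)

lemma space_gibbs: "space gibbs = X"
  using sets_eq_imp_space_eq[OF gibbs(2)] by simp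

lemma Ln_tendsto_gibbs: "\<lbrakk>f \<in> Lip; x \<in> X\<rbrakk> \<Longrightarrow> (\<lambda>n. (L ^^ n) f x) \<longlonglongrightarrow> (\<integral>x. f x \<partial>gibbs)"
  using Ln_tendsto_ell gibbs(3) by simp

text \<open>Hoelder approximation from below gives the lower bound; the upper bound is the lower
  bound for \<open>- \<phi>\<close>.\<close>

lemma Ln_tendsto_gibbs_cont:
  assumes \<phi>: "\<phi> \<in> cont_b T" and x: "x \<in> X"
  shows "(\<lambda>n. (L ^^ n) \<phi> x) \<longlonglongrightarrow> (\<integral>x. \<phi> x \<partial>gibbs)"
proof -
  have lower: "\<exists>n0. \<forall>n\<ge>n0. (\<integral>x. \<phi> x \<partial>gibbs) - e < (L ^^ n) \<phi> x" if \<phi>: "\<phi> \<in> cont_b T" and e: "0 < e" for \<phi> e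
  proof -
    obtain g F where g: "\<And>k. g k \<in> Lip" "\<And>k x. x \<in> X \<Longrightarrow> g k x \<le> \<phi> x" "\<And>k x. x \<in> X \<Longrightarrow> \<bar>g k x\<bar> \<le> F"
      "\<And>x. x \<in> X \<Longrightarrow> (\<lambda>k::nat. g k x) \<longlonglongrightarrow> \<phi> x"
      using inf_convolution[OF \<phi>] by blast
    have "(\<lambda>k. \<integral>x. g k x \<partial>gibbs) \<longlonglongrightarrow> (\<integral>x. \<phi> x \<partial>gibbs)"
    proof (rule integral_dominated_convergence[where w="\<lambda>_. F"])
      show "\<phi> \<in> borel_measurable gibbs" "\<And>k. g k \<in> borel_measurable gibbs" "integrable gibbs (\<lambda>_. F)"
        using bm_integrable[OF gibbs_finite gibbs(2)] cont_b_bm[OF \<phi>] Lip_bm[OF g(1)] bm_const by (blast intro: borel_measurable_integrable)+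
      show "AE x in gibbs. (\<lambda>k. g k x) \<longlonglongrightarrow> \<phi> x" using g(4) by (intro AE_I2) (simp add: space_gibbs)
      show "AE x in gibbs. norm (g k x) \<le> F" for k using g(3) by (intro AE_I2) (simp add: space_gibbs)
    qed
    then have "\<forall>\<^sub>F k in sequentially. (\<integral>x. \<phi> x \<partial>gibbs) - e < (\<integral>x. g k x \<partial>gibbs)" by (rule order_tendstoD) (use e in simp)
    then obtain k where "(\<integral>x. \<phi> x \<partial>gibbs) - e < (\<integral>x. g k x \<partial>gibbs)" by (auto simp: eventually_sequentially)
    with Ln_tendsto_gibbs[OF g(1)[of k] x] have "\<forall>\<^sub>F n in sequentially. (\<integral>x. \<phi> x \<partial>gibbs) - e < (L ^^ n) (g k) x"
      by (rule order_tendstoD)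
    then obtain n0 where "\<And>n. n \<ge> n0 \<Longrightarrow> (\<integral>x. \<phi> x \<partial>gibbs) - e < (L ^^ n) (g k) x" by (auto simp: eventually_sequentially)
    moreover have "(L ^^ n) (g k) x \<le> (L ^^ n) \<phi> x" for n by (intro Ln_mono Lip_bm[OF g(1)] cont_b_bm[OF \<phi>] g(2) x)
    ultimately show ?thesis by (meson less_le_trans)
  qed
  have m\<phi>: "(\<lambda>x. -1 * \<phi> x) \<in> cont_b T"
    using \<phi> by (auto simp: cont_b_def bounded_iff intro: continuous_map_minus)
  show ?thesis
  proof (rule LIMSEQ_I)
    fix e :: real assume e: "0 < e"
    obtain n0 where n0: "\<And>n. n \<ge> n0 \<Longrightarrow> (\<integral>x. \<phi> x \<partial>gibbs) - e < (L ^^ n) \<phi> x" using lower[OF \<phi> e] by blast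
    obtain n1 where n1: "\<And>n. n \<ge> n1 \<Longrightarrow> (\<integral>x. -1 * \<phi> x \<partial>gibbs) - e < (L ^^ n) (\<lambda>x. -1 * \<phi> x) x" using lower[OF m\<phi> e] by blast
    have "norm ((L ^^ n) \<phi> x - (\<integral>x. \<phi> x \<partial>gibbs)) < e" if "n \<ge> max n0 n1" for n
    proof -
      have "(L ^^ n) (\<lambda>x. -1 * \<phi> x) x = -1 * (L ^^ n) \<phi> x" by (rule Ln_scale[OF x])
      then show ?thesis using n0[of n] n1[of n] that by (simp add: abs_less_iff)
    qed
    then show "\<exists>no. \<forall>n\<ge>no. norm ((L ^^ n) \<phi> x - (\<integral>x. \<phi> x \<partial>gibbs)) < e" by blast
  qed
qed

text \<open>The set \<open>C\<close> is kept arbitrary for the sake of mixing; \<open>C = X\<close>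
  gives weak convergence.\<close>

lemma integral_Ln_tendsto:
  assumes \<nu>: "finite_measure \<nu>" "sets \<nu> = sets \<B>" and \<phi>: "\<phi> \<in> cont_b T" and C: "C \<in> sets \<B>"
  shows "(\<lambda>n. \<integral>x. indicator C x * (L ^^ n) \<phi> x \<partial>\<nu>) \<longlonglongrightarrow> measure \<nu> C * (\<integral>x. \<phi> x \<partial>gibbs)"
proof -
  obtain F where F: "\<And>x. x \<in> X \<Longrightarrow> \<bar>\<phi> x\<bar> \<le> F" using bmE[OF cont_b_bm[OF \<phi>]] by metis
  have sp: "space \<nu> = X" using sets_eq_imp_space_eq[OF \<nu>(2)] by simp
  have b: "\<bar>(L ^^ n) \<phi> x\<bar> \<le> F" if "x \<in> X" for n x by (rule Ln_abs[OF cont_b_bm[OF \<phi>] F that])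
  have "(\<lambda>n. \<integral>x. indicator C x * (L ^^ n) \<phi> x \<partial>\<nu>) \<longlonglongrightarrow> (\<integral>x. indicator C x * (\<integral>x. \<phi> x \<partial>gibbs) \<partial>\<nu>)"
  proof (rule integral_dominated_convergence[where w="\<lambda>_. F"])
    show "integrable \<nu> (\<lambda>_. F)" by (rule bm_integrable[OF \<nu> bm_const])
    show "(\<lambda>x. indicator C x * (\<integral>x. \<phi> x \<partial>gibbs)) \<in> borel_measurable \<nu>"
      by (rule borel_measurable_integrable[OF bm_integrable[OF \<nu> bm_mult[OF bm_indicator[OF C] bm_const]]])
    show "(\<lambda>x. indicator C x * (L ^^ n) \<phi> x) \<in> borel_measurable \<nu>" for n
      by (rule borel_measurable_integrable[OF bm_integrable[OF \<nu> bm_mult[OF bm_indicator[OF C] Ln_bm[OF cont_b_bm[OF \<phi>]]]]])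
    show "AE x in \<nu>. (\<lambda>n. indicator C x * (L ^^ n) \<phi> x) \<longlonglongrightarrow> indicator C x * (\<integral>x. \<phi> x \<partial>gibbs)"
      by (intro AE_I2 tendsto_mult_left Ln_tendsto_gibbs_cont \<phi>) (simp add: sp)
    show "AE x in \<nu>. norm (indicator C x * (L ^^ n) \<phi> x) \<le> F" for n
    proof (rule AE_I2)
      fix x assume "x \<in> space \<nu>"
      then have x: "x \<in> X" by (simp add: sp)
      have "0 \<le> F" using F[OF x] by linarith
      then show "norm (indicator C x * (L ^^ n) \<phi> x) \<le> F" using b[OF x, of n] by (simp add: indicator_def)
    qed
  qed
  also have "(\<integral>x. indicator C x * (\<integral>x. \<phi> x \<partial>gibbs) \<partial>\<nu>) = measure \<nu> C * (\<integral>x. \<phi> x \<partial>gibbs)"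
    using C \<nu>(2) sets.sets_into_space[of C \<nu>] by (simp add: Int_absorb2)
  finally show ?thesis .
qed

lemma integral_Ln_tendsto':
  assumes \<nu>: "prob_space \<nu>" "sets \<nu> = sets \<B>" and \<phi>: "\<phi> \<in> cont_b T"
  shows "(\<lambda>n. \<integral>x. (L ^^ n) \<phi> x \<partial>\<nu>) \<longlonglongrightarrow> (\<integral>x. \<phi> x \<partial>gibbs)"
proof -
  interpret nu: prob_space \<nu> by fact
  have sp: "space \<nu> = X" using sets_eq_imp_space_eq[OF \<nu>(2)] by simp
  have X: "X \<in> sets \<B>" using sets.top[of \<B>] by simp
  have "(\<integral>x. indicator X x * (L ^^ n) \<phi> x \<partial>\<nu>) = (\<integral>x. (L ^^ n) \<phi> x \<partial>\<nu>)" for n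
    by (rule Bochner_Integration.integral_cong) (auto simp: sp)
  then show ?thesis using integral_Ln_tendsto[OF nu.finite_measure_axioms \<nu>(2) \<phi> X] nu.prob_space by (simp add: sp)
qed

text \<open>A shifted sequence has the same limit, so \<open>ell (L f) = ell f\<close>; hence
  \<open>push gibbs\<close> and \<open>gibbs\<close> agree on Hoelder functions and are
  equal.\<close>

lemma integral_L_gibbs: "\<phi> \<in> bm \<Longrightarrow> (\<integral>x. L \<phi> x \<partial>gibbs) = (\<integral>x. \<phi> x \<partial>gibbs)"
proof -
  note p = push[OF gibbs_finite gibbs(2)]
  have "push gibbs = gibbs"
  proof (rule measure_eq_Lip[OF p(1,2) gibbs_finite gibbs(2)])
    fix f :: "(nat \<Rightarrow> real) \<Rightarrow> real" assume f: "f \<in> Lip"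
    have Lf: "L f \<in> Lip" using Ln_Lip(1)[OF f, of 1] by simp
    have "(\<lambda>n. (L ^^ n) (L f) (\<lambda>_. 0)) \<longlonglongrightarrow> ell f"
      using LIMSEQ_Suc[OF Ln_tendsto_ell[OF f zero_mem]] by (simp add: funpow_swap1)
    then have "ell (L f) = ell f" using LIMSEQ_unique[OF Ln_tendsto_ell[OF Lf zero_mem]] by blast
    then show "(\<integral>x. f x \<partial>push gibbs) = (\<integral>x. f x \<partial>gibbs)" using p(3)[OF Lip_bm[OF f]] gibbs(3)[OF Lf] gibbs(3)[OF f] by simp
  qed
  then show "\<phi> \<in> bm \<Longrightarrow> ?thesis" using p(3) by metis
qed

lemma integral_Ln_fixed:
  assumes inv: "\<And>\<phi>. \<phi> \<in> bm \<Longrightarrow> (\<integral>x. L \<phi> x \<partial>\<nu>) = (\<integral>x. \<phi> x \<partial>\<nu>)" and \<phi>: "\<phi> \<in> bm"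
  shows "(\<integral>x. (L ^^ n) \<phi> x \<partial>\<nu>) = (\<integral>x. \<phi> x \<partial>\<nu>)"
  by (induction n) (simp_all add: inv Ln_bm \<phi>)

text \<open>For an invariant measure the integrals of \<open>L^n f\<close> do not depend on
  \<open>n\<close>, while they converge to the integral of \<open>f\<close> over
  \<open>gibbs\<close>.\<close>

lemma gibbs_unique:
  assumes \<nu>: "prob_space \<nu>" "sets \<nu> = sets \<B>" and inv: "\<And>\<phi>. \<phi> \<in> bm \<Longrightarrow> (\<integral>x. L \<phi> x \<partial>\<nu>) = (\<integral>x. \<phi> x \<partial>\<nu>)"
  shows "\<nu> = gibbs"
proof (rule measure_eq_Lip[OF _ \<nu>(2) gibbs_finite gibbs(2)])
  show "finite_measure \<nu>" using \<nu>(1) by (simp add: prob_space_def)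
  fix f :: "(nat \<Rightarrow> real) \<Rightarrow> real" assume f: "f \<in> Lip"
  show "(\<integral>x. f x \<partial>\<nu>) = (\<integral>x. f x \<partial>gibbs)"
    using integral_Ln_tendsto'[OF \<nu> Lip_cont_b[OF f]] integral_Ln_fixed[OF inv Lip_bm[OF f]]
    by (simp add: LIMSEQ_const_iff)
qed

lemma gibbs_invariant: "invariant_measure gibbs sh"
  unfolding invariant_measure_def
proof
  show m: "sh \<in> gibbs \<rightarrow>\<^sub>M gibbs" using sh_measurable measurable_cong_sets[OF gibbs(2) gibbs(2)] by simp
  interpret G: prob_space gibbs by (rule gibbs(1))
  show "distr gibbs gibbs sh = gibbs"
  proof (rule measure_eq_Lip[OF _ _ gibbs_finite gibbs(2)])
    show "finite_measure (distr gibbs gibbs sh)" by (rule G.finite_measure_distr[OF m])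
    show "sets (distr gibbs gibbs sh) = sets \<B>" by (simp add: gibbs(2))
    fix f :: "(nat \<Rightarrow> real) \<Rightarrow> real" assume f: "f \<in> Lip"
    have fb: "(\<lambda>x. f (sh x)) \<in> bm"
    proof (rule bmI)
      show "(\<lambda>x. f (sh x)) \<in> borel_measurable \<B>" by (rule measurable_compose[OF sh_measurable bm_measurable[OF Lip_bm[OF f]]])
      show "\<bar>f (sh x)\<bar> \<le> Lip_norm f" if "x \<in> X" for x using Lip_norm_bounds(1)[OF f sh_mem[OF that]] by simp
    qed
    have "(\<integral>x. f x \<partial>distr gibbs gibbs sh) = (\<integral>x. f (sh x) \<partial>gibbs)"
      using borel_measurable_integrable[OF bm_integrable[OF gibbs_finite gibbs(2) Lip_bm[OF f]]] by (rule integral_distr[OF m])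
    also have "\<dots> = (\<integral>x. L (\<lambda>x. f (sh x)) x \<partial>gibbs)" by (rule integral_L_gibbs[OF fb, symmetric])
    \<comment> \<open>The shift undoes every branch and \<open>L\<close> fixes 1, so
      \<open>L (\<lambda>x. f (sh x))\<close> is \<open>f\<close> on \<open>X\<close>.\<close>
    also have "\<dots> = (\<integral>x. f x \<partial>gibbs)"
      by (rule Bochner_Integration.integral_cong) (use Ln_coshift[of _ 1 f] in \<open>auto simp: space_gibbs\<close>)
    finally show "(\<integral>x. f x \<partial>distr gibbs gibbs sh) = (\<integral>x. f x \<partial>gibbs)" .
  qed
qed

text \<open>By duality the correlation of \<open>\<phi>\<close> with \<open>C\<close> after
  \<open>n\<close> shifts is the integral of \<open>indicator C * L^n \<phi>\<close>, which
  converges because \<open>L^n \<phi>\<close> does. Since \<open>C\<close> is arbitrary from the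
  start, only \<open>B\<close> has to be extended from continuous functions to Borel sets, by a
  Dynkin argument.\<close>

lemma gibbs_mixing: "mixing gibbs sh"
  unfolding mixing_def
proof (intro ballI)
  fix B C assume B: "B \<in> sets gibbs" and C: "C \<in> sets gibbs"
  interpret G: prob_space gibbs by (rule gibbs(1))
  have CB: "C \<in> sets \<B>" using C gibbs(2) by simp
  let ?W = "\<lambda>n. (sh ^^ n) -` C \<inter> space gibbs"
  note W = invariant_measure_vimage[OF gibbs_invariant C]
  let ?P = "\<lambda>B. (\<lambda>n. measure gibbs (B \<inter> ?W n)) \<longlonglongrightarrow> measure gibbs B * measure gibbs C"
  have cont: "(\<lambda>n. \<integral>x. \<phi> x * indicator (?W n) x \<partial>gibbs) \<longlonglongrightarrow> (\<integral>x. \<phi> x \<partial>gibbs) * measure gibbs C" if \<phi>: "\<phi> \<in> cont_b T" for \<phi>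
  proof -
    have "(\<integral>x. \<phi> x * indicator (?W n) x \<partial>gibbs) = (\<integral>x. indicator C x * (L ^^ n) \<phi> x \<partial>gibbs)" for n
    proof -
      have gb: "(\<lambda>x. \<phi> x * indicator (?W n) x) \<in> bm"
        using W(1)[of n] gibbs(2) by (intro bm_mult cont_b_bm[OF \<phi>] bm_indicator) simp
      have "(\<integral>x. \<phi> x * indicator (?W n) x \<partial>gibbs) = (\<integral>x. (L ^^ n) (\<lambda>x. \<phi> x * indicator (?W n) x) x \<partial>gibbs)"
        by (rule integral_Ln_fixed[OF integral_L_gibbs gb, symmetric])
      also have "\<dots> = (\<integral>x. indicator C x * (L ^^ n) \<phi> x \<partial>gibbs)"
      proof (rule Bochner_Integration.integral_cong[OF refl])
        fix x assume "x \<in> space gibbs"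
        then have x: "x \<in> X" by (simp add: space_gibbs)
        have "(L ^^ n) (\<lambda>x. \<phi> x * indicator (?W n) x) x = (L ^^ n) (\<lambda>x. \<phi> x * indicator C ((sh ^^ n) x)) x"
          by (rule Ln_cong[OF _ x]) (simp add: space_gibbs indicator_def)
        then show "(L ^^ n) (\<lambda>x. \<phi> x * indicator (?W n) x) x = indicator C x * (L ^^ n) \<phi> x"
          using Ln_shift[OF x, of n \<phi> "indicator C"] by simp
      qed
      finally show ?thesis .
    qed
    then show ?thesis using integral_Ln_tendsto[OF gibbs_finite gibbs(2) \<phi> CB] by (simp add: mult.commute)
  qed
  have "Int_stable {U. openin T U}" by (auto simp: Int_stable_def)
  moreover have "{U. openin T U} \<subseteq> Pow X" using openin_subset[of T] by auto
  moreover have "B \<in> sigma_sets X {U. openin T U}" using B gibbs(2) sets_borel by simp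
  ultimately show "?P B"
  proof (induction rule: sigma_sets_induct_disjoint)
    case (basic U)
    then have U: "openin T U" by simp
    have UB: "U \<in> sets gibbs" using openin_sets[OF U] gibbs(2) by simp
    have iU: "integrable gibbs (\<lambda>x. indicator U x :: real)"
      by (rule bm_integrable[OF gibbs_finite gibbs(2) bm_indicator]) (use UB gibbs(2) in simp)
    show ?case
    proof (rule tendsto_approx)
      fix e :: real assume e: "0 < e"
      obtain j where j: "norm ((\<integral>x. bump U j x \<partial>gibbs) - measure gibbs U) < e"
        using LIMSEQ_D[OF integral_bump_tendsto[OF gibbs_finite gibbs(2) U] e] by auto
      have ib: "integrable gibbs (bump U j)" by (rule bm_integrable[OF gibbs_finite gibbs(2) Lip_bm[OF bump_Lip]])
      have le: "bump U j x \<le> indicator U x" if "x \<in> X" for x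
        using that bump_bounds(2)[of U j x] bump_outside[of x U j] by (auto simp: indicator_def)
      have mU: "(\<integral>x. indicator U x \<partial>gibbs) = measure gibbs U"
        using UB sets.sets_into_space[OF UB] by (simp add: Int_absorb2)
      \<comment> \<open>The error is at most the difference of the integrals of
        \<open>indicator U\<close> and the bump, whatever \<open>n\<close>; this uniformity is what
        \<open>tendsto_approx\<close> asks for.\<close>
      have "\<bar>measure gibbs (U \<inter> ?W n) - (\<integral>x. bump U j x * indicator (?W n) x \<partial>gibbs)\<bar> \<le> e" for n
      proof -
        have iW: "integrable gibbs (\<lambda>x. f x * indicator (?W n) x)" if "integrable gibbs f" for f :: "(nat \<Rightarrow> real) \<Rightarrow> real"
          using integrable_mult_indicator[OF W(1)[of n] that] by (simp add: mult.commute)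
        have "(U \<inter> ?W n) \<inter> space gibbs = U \<inter> ?W n" by auto
        then have "measure gibbs (U \<inter> ?W n) = (\<integral>x. indicator (U \<inter> ?W n) x \<partial>gibbs)"
          by (simp only: Bochner_Integration.integral_indicator)
        also have "\<dots> = (\<integral>x. indicator U x * indicator (?W n) x \<partial>gibbs)" by (simp only: indicator_inter_arith)
        finally have "measure gibbs (U \<inter> ?W n) - (\<integral>x. bump U j x * indicator (?W n) x \<partial>gibbs)
            = (\<integral>x. (indicator U x - bump U j x) * indicator (?W n) x \<partial>gibbs)"
          using Bochner_Integration.integral_diff[OF iW[OF iU] iW[OF ib]] by (simp add: left_diff_distrib)
        moreover have "(\<integral>x. (indicator U x - bump U j x) * indicator (?W n) x \<partial>gibbs) \<le> (\<integral>x. indicator U x - bump U j x \<partial>gibbs)"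
        proof (intro integral_mono iW Bochner_Integration.integrable_diff iU ib)
          fix x assume "x \<in> space gibbs"
          then show "(indicator U x - bump U j x) * indicator (?W n) x \<le> indicator U x - bump U j x"
            using le[of x] indicator_le_1[of "?W n" x] by (intro mult_left_le) (auto simp: space_gibbs)
        qed
        moreover have "0 \<le> (\<integral>x. (indicator U x - bump U j x) * indicator (?W n) x \<partial>gibbs)"
          using le by (intro Bochner_Integration.integral_nonneg) (auto simp: space_gibbs indicator_def)
        moreover have "(\<integral>x. indicator U x - bump U j x \<partial>gibbs) = measure gibbs U - (\<integral>x. bump U j x \<partial>gibbs)"
          using Bochner_Integration.integral_diff[OF iU ib] mU by simp
        ultimately show ?thesis using j unfolding real_norm_def by linarith
      qed
      moreover have "\<bar>(\<integral>x. bump U j x \<partial>gibbs) * measure gibbs C - measure gibbs U * measure gibbs C\<bar> \<le> e"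
      proof -
        have "\<bar>(\<integral>x. bump U j x \<partial>gibbs) - measure gibbs U\<bar> * measure gibbs C \<le> e * 1"
          using j e by (intro mult_mono) auto
        then show ?thesis by (simp add: abs_mult flip: left_diff_distrib)
      qed
      ultimately show "\<exists>g c. (\<forall>n. \<bar>measure gibbs (U \<inter> ?W n) - g n\<bar> \<le> e) \<and> g \<longlonglongrightarrow> c \<and> \<bar>c - measure gibbs U * measure gibbs C\<bar> \<le> e"
        using cont[OF Lip_cont_b[OF bump_Lip[of U j]]]
        by (intro exI[of _ "\<lambda>n. \<integral>x. bump U j x * indicator (?W n) x \<partial>gibbs"]
            exI[of _ "(\<integral>x. bump U j x \<partial>gibbs) * measure gibbs C"] conjI allI)
    qed
  next
    case empty
    then show ?case by simp
  next
    case (compl B)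
    then have B: "B \<in> sets gibbs" using gibbs(2) sets_borel by simp
    have "measure gibbs ((X - B) \<inter> ?W n) = measure gibbs C - measure gibbs (B \<inter> ?W n)" for n
    proof -
      have "(X - B) \<inter> ?W n = ?W n - (B \<inter> ?W n)" by (auto simp: space_gibbs)
      then show ?thesis using G.finite_measure_Diff[OF W(1)[of n], of "B \<inter> ?W n"] B W by auto
    qed
    moreover have "measure gibbs (X - B) = 1 - measure gibbs B" using G.prob_compl[OF B] by (simp add: space_gibbs)
    moreover have "(\<lambda>n. measure gibbs C - measure gibbs (B \<inter> ?W n)) \<longlonglongrightarrow> measure gibbs C - measure gibbs B * measure gibbs C"
      by (intro tendsto_diff tendsto_const compl.IH)
    ultimately show ?case by (simp add: left_diff_distrib)
  next
    case (union D)
    then have D: "range D \<subseteq> sets gibbs" using gibbs(2) sets_borel by auto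
    let ?U = "\<Union>i. D i"
    have US: "?U \<in> sets gibbs" using D by auto
    have sm: "(\<lambda>i. measure gibbs (D i)) sums measure gibbs ?U"
      using D union.hyps(1) by (rule G.finite_measure_UNION)
    show ?case
    proof (rule tendsto_approx)
      fix e :: real assume e: "0 < e"
      obtain k where k: "norm ((\<Sum>i<k. measure gibbs (D i)) - measure gibbs ?U) < e"
        using LIMSEQ_D[OF sm[unfolded sums_def] e] by auto
      let ?F = "\<Union>i<k. D i"
      have FS: "?F \<in> sets gibbs" using D by auto
      have mF: "measure gibbs ?F = (\<Sum>i<k. measure gibbs (D i))"
        using D union.hyps(1) by (intro G.finite_measure_finite_Union) (auto simp: disjoint_family_on_def)
      have mFn: "measure gibbs (?F \<inter> ?W n) = (\<Sum>i<k. measure gibbs (D i \<inter> ?W n))" for n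
      proof -
        have "measure gibbs (\<Union>i<k. D i \<inter> ?W n) = (\<Sum>i<k. measure gibbs (D i \<inter> ?W n))"
          using D W(1)[of n] union.hyps(1) by (intro G.finite_measure_finite_Union) (auto simp: disjoint_family_on_def)
        then show ?thesis by (simp add: UN_extend_simps del: UN_simps)
      qed
      \<comment> \<open>The part beyond the first \<open>k\<close> pieces lies in
        \<open>?U - ?F\<close>, whose measure is below \<open>e\<close> independently of
        \<open>n\<close>.\<close>
      have "\<bar>measure gibbs (?U \<inter> ?W n) - (\<Sum>i<k. measure gibbs (D i \<inter> ?W n))\<bar> \<le> e" for n
      proof -
        have "measure gibbs (?F \<inter> ?W n) \<le> measure gibbs (?U \<inter> ?W n)"
          using US W(1)[of n] by (intro G.finite_measure_mono) auto
        moreover have "measure gibbs (?U \<inter> ?W n) \<le> measure gibbs ((?F \<inter> ?W n) \<union> (?U - ?F))"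
          using US FS W(1)[of n] by (intro G.finite_measure_mono) auto
        moreover have "\<dots> \<le> measure gibbs (?F \<inter> ?W n) + measure gibbs (?U - ?F)"
          using US FS W(1)[of n] by (intro measure_Un_le) auto
        moreover have "measure gibbs (?U - ?F) = measure gibbs ?U - measure gibbs ?F"
          using US FS by (intro G.finite_measure_Diff) auto
        ultimately show ?thesis using k unfolding mFn[symmetric] mF[symmetric] real_norm_def by linarith
      qed
      moreover have "(\<lambda>n. \<Sum>i<k. measure gibbs (D i \<inter> ?W n)) \<longlonglongrightarrow> (\<Sum>i<k. measure gibbs (D i) * measure gibbs C)"
        by (intro tendsto_sum union.IH)
      moreover have "\<bar>(\<Sum>i<k. measure gibbs (D i) * measure gibbs C) - measure gibbs ?U * measure gibbs C\<bar> \<le> e"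
      proof -
        have "\<bar>(\<Sum>i<k. measure gibbs (D i)) - measure gibbs ?U\<bar> * measure gibbs C \<le> e * 1"
          using k e by (intro mult_mono) auto
        then show ?thesis by (simp add: abs_mult flip: left_diff_distrib sum_distrib_right)
      qed
      ultimately show "\<exists>g c. (\<forall>n. \<bar>measure gibbs (?U \<inter> ?W n) - g n\<bar> \<le> e) \<and> g \<longlonglongrightarrow> c \<and> \<bar>c - measure gibbs ?U * measure gibbs C\<bar> \<le> e"
        by (intro exI[of _ "\<lambda>n. \<Sum>i<k. measure gibbs (D i \<inter> ?W n)"]
            exI[of _ "\<Sum>i<k. measure gibbs (D i) * measure gibbs C"] conjI allI)
    qed
  qed
qed

lemma gibbs_summary:
  "gibbs \<in> borel_probs T" "dual_op T L gibbs = gibbs"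
  "\<forall>\<mu>'\<in>borel_probs T. dual_op T L \<mu>' = \<mu>' \<longrightarrow> \<mu>' = gibbs"
  "\<forall>\<nu>\<in>borel_probs T. weak_star_lim T (\<lambda>n. dual_op T (L ^^ n) \<nu>) gibbs"
proof -
  show "gibbs \<in> borel_probs T" using gibbs by (simp add: borel_probs_def)
  show "dual_op T L gibbs = gibbs" using integral_L_gibbs by (simp add: dual_fixed_iff[OF gibbs_finite gibbs(2)])
  show "\<forall>\<mu>'\<in>borel_probs T. dual_op T L \<mu>' = \<mu>' \<longrightarrow> \<mu>' = gibbs"
    using gibbs_unique by (auto simp: borel_probs_def dual_fixed_iff prob_space_def)
  show "\<forall>\<nu>\<in>borel_probs T. weak_star_lim T (\<lambda>n. dual_op T (L ^^ n) \<nu>) gibbs"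
    using integral_Ln_tendsto' by (auto simp: borel_probs_def weak_star_lim_def dual_op_integral cont_b_bm prob_space_def)
qed

end

theorem theorem1:
  fixes X :: "(nat \<Rightarrow> real) set" and N :: "(nat \<Rightarrow> real) \<Rightarrow> real"
    and \<alpha> c c' :: real and a :: "nat \<Rightarrow> real"
    and m :: "real measure" and A :: "(nat \<Rightarrow> real) \<Rightarrow> real"
  assumes space: "(X = c0 \<and> N = c0_norm) \<or> (\<exists>p\<ge>1. X = lp p \<and> N = lp_norm p)"
    and exponent: "0 < \<alpha>" "\<alpha> \<le> 1"
    and weights: "0 < c" "c < c'" "1 < c'" "\<forall>n. a n \<in> {c<..<c'}"
    and expansion: "summable (\<lambda>n. weight_inf a (Suc n) powr (- \<alpha>))"
    and apriori: "prob_space m" "sets m = sets borel" "measure_support UNIV dist m = UNIV"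
    and potential: "A \<in> lip_b X (holder_dist N \<alpha>)"
  shows
    "(A \<in> summable_variation X N \<longrightarrow>
       (\<exists>lam \<psi>. positive_eigendata X N \<alpha> m a A lam \<psi> \<and>
          ereal lam = lip_spectral_radius X (holder_dist N \<alpha>) (ruelle m a A) \<and>
          (\<forall>\<phi>\<in>lip_b X (holder_dist N \<alpha>).
             (\<forall>x\<in>X. 0 < \<phi> x) \<and> (\<exists>\<rho>. \<forall>x\<in>X. ruelle m a A \<phi> x = \<rho> * \<phi> x) \<longrightarrow>
             (\<exists>t. \<forall>x\<in>X. \<phi> x = t * \<psi> x))))
     \<and>
     (adapted_tails X a m \<and> (\<forall>x\<in>X. ruelle m a A (\<lambda>_. 1 :: real) x = 1) \<longrightarrow>
       (\<exists>\<mu>\<in>borel_probs (norm_topology X N).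
          dual_op (norm_topology X N) (ruelle m a A) \<mu> = \<mu> \<and>
          (\<forall>\<mu>'\<in>borel_probs (norm_topology X N).
             dual_op (norm_topology X N) (ruelle m a A) \<mu>' = \<mu>' \<longrightarrow> \<mu>' = \<mu>) \<and>
          (\<forall>\<nu>\<in>borel_probs (norm_topology X N).
             weak_star_lim (norm_topology X N)
               (\<lambda>n. dual_op (norm_topology X N) (ruelle m a A ^^ n) \<nu>) \<mu>) \<and>
          invariant_measure \<mu> (weighted_shift a) \<and> mixing \<mu> (weighted_shift a) \<and>
          conservative \<mu> (weighted_shift a) \<and> ergodic \<mu> (weighted_shift a)))
     \<and>
     (A \<in> summable_variation X N \<and> adapted_tails X a m \<longrightarrow>
       (\<forall>lam \<psi>. positive_eigendata X N \<alpha> m a A lam \<psi> \<longrightarrow>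
         (\<exists>\<mu>\<in>borel_probs (norm_topology X N).
            dual_op (norm_topology X N) (ruelle m a (normalized_potential a A lam \<psi>)) \<mu> = \<mu> \<and>
            (\<forall>\<mu>'\<in>borel_probs (norm_topology X N).
               dual_op (norm_topology X N) (ruelle m a (normalized_potential a A lam \<psi>)) \<mu>' = \<mu>' \<longrightarrow>
               \<mu>' = \<mu>) \<and>
            invariant_measure \<mu> (weighted_shift a) \<and> mixing \<mu> (weighted_shift a))))
     \<and>
     (A \<in> summable_variation X N \<and> adapted_tails X a m \<longrightarrow>
       (\<forall>lam \<psi>. positive_eigendata X N \<alpha> m a A lam \<psi> \<longrightarrow>
         (\<forall>\<mu>\<in>borel_probs (norm_topology X N).
            dual_op (norm_topology X N) (ruelle m a (normalized_potential a A lam \<psi>)) \<mu> = \<mu> \<longrightarrow>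
            {x \<in> X. x 0 \<in> measure_support UNIV dist m} \<subseteq> measure_support X (norm_dist N) \<mu> \<and>
            measure_support X (norm_dist N) \<mu> = X)))"
proof -
  have "seq_space X N" using space seq_space_c0 seq_space_lp by auto
  then have "weighted_space X N \<alpha> c c' a"
    using exponent weights expansion
    by (auto simp: weighted_space_def weighted_space_axioms_def holder_space_def holder_space_axioms_def)
  then have rs: "ruelle_space X N \<alpha> c c' a m A'" if "A' \<in> lip_b X (holder_dist N \<alpha>)" for A'
    using apriori that by (simp add: ruelle_space_def ruelle_space_axioms_def)
  interpret ruelle_space X N \<alpha> c c' a m A by (rule rs[OF potential])
  have normal: "ruelle_normal X N \<alpha> c c' a m A'"
    if "A' \<in> lip_b X (holder_dist N \<alpha>)" "adapted_tails X a m" "\<And>x. x \<in> X \<Longrightarrow> ruelle m a A' (\<lambda>_. 1 :: real) x = 1" for A'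
    using rs that by (simp add: ruelle_normal_def ruelle_normal_axioms_def)
  \<comment> \<open>The normalized potential is Hoelder and its operator fixes 1, so the results
    behind b) apply to it and give c).\<close>
  have eigen: "ruelle_normal X N \<alpha> c c' a m (normalized_potential a A lam \<psi>)"
    if "adapted_tails X a m" "positive_eigendata X N \<alpha> m a A lam \<psi>" for lam \<psi>
  proof -
    interpret ruelle_eigen X N \<alpha> c c' a m A lam \<psi> by unfold_locales (rule that)
    show ?thesis by (rule normal[OF normalized_Lip that(1) normalized])
  qed
  show ?thesis
  proof (intro conjI impI allI)
    assume "A \<in> summable_variation X N"
    then interpret sv: ruelle_sv X N \<alpha> c c' a m A by unfold_locales
    obtain lam \<psi> where e: "positive_eigendata X N \<alpha> m a A lam \<psi>" using sv.eigenfunction_exists by blast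
    interpret ruelle_sv_eigen X N \<alpha> c c' a m A lam \<psi> by unfold_locales (rule e)
    show "\<exists>lam \<psi>. positive_eigendata X N \<alpha> m a A lam \<psi> \<and>
          ereal lam = lip_spectral_radius X (holder_dist N \<alpha>) (ruelle m a A) \<and>
          (\<forall>\<phi>\<in>lip_b X (holder_dist N \<alpha>).
             (\<forall>x\<in>X. 0 < \<phi> x) \<and> (\<exists>\<rho>. \<forall>x\<in>X. ruelle m a A \<phi> x = \<rho> * \<phi> x) \<longrightarrow>
             (\<exists>t. \<forall>x\<in>X. \<phi> x = t * \<psi> x))"
      using e spectral_radius eigenfunction_unique by metis
  next
    assume "adapted_tails X a m \<and> (\<forall>x\<in>X. ruelle m a A (\<lambda>_. 1 :: real) x = 1)"
    then interpret n: ruelle_normal X N \<alpha> c c' a m A using normal[OF potential] by blast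
    show "\<exists>\<mu>\<in>borel_probs T. dual_op T (ruelle m a A) \<mu> = \<mu> \<and>
          (\<forall>\<mu>'\<in>borel_probs T. dual_op T (ruelle m a A) \<mu>' = \<mu>' \<longrightarrow> \<mu>' = \<mu>) \<and>
          (\<forall>\<nu>\<in>borel_probs T. weak_star_lim T (\<lambda>n. dual_op T (ruelle m a A ^^ n) \<nu>) \<mu>) \<and>
          invariant_measure \<mu> sh \<and> mixing \<mu> sh \<and> conservative \<mu> sh \<and> ergodic \<mu> sh"
      using n.gibbs_summary n.gibbs_invariant n.gibbs_mixing mixing_imp_ergodic[OF n.gibbs(1) n.gibbs_mixing]
        invariant_imp_conservative[OF n.gibbs_finite n.gibbs_invariant] by blast
  next
    fix lam \<psi> assume h: "A \<in> summable_variation X N \<and> adapted_tails X a m" "positive_eigendata X N \<alpha> m a A lam \<psi>"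
    interpret n: ruelle_normal X N \<alpha> c c' a m "normalized_potential a A lam \<psi>" using eigen h by blast
    show "\<exists>\<mu>\<in>borel_probs T. dual_op T (ruelle m a (normalized_potential a A lam \<psi>)) \<mu> = \<mu> \<and>
            (\<forall>\<mu>'\<in>borel_probs T. dual_op T (ruelle m a (normalized_potential a A lam \<psi>)) \<mu>' = \<mu>' \<longrightarrow> \<mu>' = \<mu>) \<and>
            invariant_measure \<mu> sh \<and> mixing \<mu> sh"
      using n.gibbs_summary n.gibbs_invariant n.gibbs_mixing by blast
  next
    fix lam \<psi> assume h: "A \<in> summable_variation X N \<and> adapted_tails X a m" "positive_eigendata X N \<alpha> m a A lam \<psi>"
    interpret n: ruelle_normal X N \<alpha> c c' a m "normalized_potential a A lam \<psi>" using eigen h by blast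
    \<comment> \<open>The equality with \<open>X\<close> is proved directly, and the inclusion in d)
      follows from it.\<close>
    have full: "measure_support X (norm_dist N) \<mu> = X"
      if "\<mu> \<in> borel_probs T" "dual_op T (ruelle m a (normalized_potential a A lam \<psi>)) \<mu> = \<mu>" for \<mu>
    proof (rule n.full_support[OF _ _ _ apriori(3)])
      show \<mu>: "prob_space \<mu>" "sets \<mu> = sets \<B>" using that(1) by (auto simp: borel_probs_def)
      show "(\<integral>x. n.L \<phi> x \<partial>\<mu>) = (\<integral>x. \<phi> x \<partial>\<mu>)" if "\<phi> \<in> bm" for \<phi>
        using n.dual_fixed_iff[of \<mu>] \<mu> \<open>dual_op T _ \<mu> = \<mu>\<close> that by (simp add: prob_space_def)
    qed
    then show "\<forall>\<mu>\<in>borel_probs T. dual_op T (ruelle m a (normalized_potential a A lam \<psi>)) \<mu> = \<mu> \<longrightarrow>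
            {x \<in> X. x 0 \<in> measure_support UNIV dist m} \<subseteq> measure_support X (norm_dist N) \<mu> \<and>
            measure_support X (norm_dist N) \<mu> = X" by blast
  qed
qed

end
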